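(* Let $R$ be a non-semisimple Lie conformal algebra of rank two. Then, up to isomorphism, $R$ is one of the following types. (1) If $R$ is nilpotent, then $R\cong R_{nil}(Q(\lambda,\partial))$ for some skew-symmetric polynomial $Q(\lambda,\partial)$; and $R_{nil}(Q(\lambda,\partial))\cong R_{nil}(Q'(\lambda,\partial))$ if and only if $Q(\lambda,\partial)=kQ'(\lambda,\partial)$ for some $k\in\mathbb{C}^\times$. (2) If $R$ is solvable but not nilpotent, then $R\cong R_{sol}(a(\lambda))$ for some non-zero polynomial $a(\lambda)\in\mathbb{C}[\lambda]$; and $R_{sol}(a(\lambda))\cong R_{sol}(a'(\lambda))$ if and only if $a(\lambda)=ka'(\lambda)$ for some $k\in\mathbb{C}^\times$. (3) If $R$ is not solvable, then one of the following holds. (3i) $R$ is the direct sum of a rank one commutative Lie conformal algebra and the Virasoro Lie conformal algebra. (3ii) $R$ has a basis $\{A,B\}$ such that $[A_\lambda A]=0$, $[B_\lambda A]=(c\lambda+d+\partial)A$ and $[B_\lambda B]=Q_c(\lambda,\partial)A+(2\lambda+\partial)B$ for some constants $c,d\in\mathbb{C}$ and some skew-symmetric polynomial $Q_c(\lambda,\partial)$, where moreover $Q_c(\lambda,\partial)\neq 0$ only when $d=0$ and $c\in\{1,0,-1,-4,-6\}$, in which case $Q_c(\lambda,\partial)$ has the following form, with $\beta,\gamma\in\mathbb{C}$: - $c=1$: $Q_c=\beta(2\lambda+\partial)$; - $c=0$: $Q_c=\beta(2\lambda+\partial)(\lambda^2+\lambda\partial)+\gamma(2\lambda+\partial)\partial$;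 - $c=-1$: $Q_c=\beta(2\lambda+\partial)\partial^2+\gamma(2\lambda+\partial)(\lambda^2+\lambda\partial)\partial$; - $c=-4$: $Q_c=\beta(2\lambda+\partial)(\lambda^2+\lambda\partial)^3$; - $c=-6$: $Q_c=\beta(2\lambda+\partial)\left[11(\lambda^2+\lambda\partial)^4+2(\lambda^2+\lambda\partial)^3\partial^2\right]$. Denote a Lie conformal algebra in the class (3ii) (with $Q_c$ subject to these restrictions) by $R(c,d,Q_c(\lambda,\partial))$. Then $R(c,d,Q_c(\lambda,\partial))\cong R(c',d',Q'_{c'}(\lambda,\partial))$ if and only if $c=c'$, $d=d'$ and $Q_c(\lambda,\partial)=kQ'_{c'}(\lambda,\partial)$ for some $k\in\mathbb{C}^\times$.
   Context: All vector spaces are over $\mathbb{C}$. A Lie conformal algebra is a $\mathbb{C}[\partial]$-module $R$ with a $\mathbb{C}$-linear map $R\otimes R\to\mathbb{C}[\lambda]\otimes R$, $a\otimes b\mapsto[a_\lambda b]$, such that for all $a,b,c\in R$: $[\partial a_\lambda b]=-\lambda[a_\lambda b]$ and $[a_\lambda\partial b]=(\lambda+\partial)[a_\lambda b]$; $[b_\lambda a]=-[a_{-\lambda-\partial}b]$; $[a_\lambda[b_\mu c]]-[b_\mu[a_\lambda c]]=[[a_\lambda b]_{\lambda+\mu}c]$. It has rank $n$ if it is free of rank $n$ as a $\mathbb{C}[\partial]$-module; a basis means a $\mathbb{C}[\partial]$-basis. A homomorphism is a $\mathbb{C}[\partial]$-module map preserving $\lambda$-brackets. The $n$-th products $a_{(n)}b\in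 R$ are defined by $[a_\lambda b]=\sum_{n\ge 0}\frac{\lambda^n}{n!}a_{(n)}b$. An ideal is a $\mathbb{C}[\partial]$-submodule $S$ with $a_{(n)}b\in S$ for all $a\in R,b\in S,n\ge0$. The derived algebra $R'$ is the $\mathbb{C}$-span of all $a_{(n)}b$, $a,b\in R$, $n\ge 0$; $R^{(1)}=R$, $R^{(n)}=(R^{(n-1)})'$ for $n\ge2$; $R$ is solvable if $R^{(n)}=0$ for some $n\ge1$. $R^n$ is the span of all $a^1_{(m_1)}(a^2_{(m_2)}(\cdots(a^{n-1}_{(m_{n-1})}a^n)))$ with $a^i\in R$, $m_i\ge0$; $R$ is nilpotent if $R^n=0$ for some $n\geq 1$. $R$ is commutative if $[a_\lambda b]=0$ for all $a,b$, and semisimple if it has no non-zero solvable ideal. The Virasoro Lie conformal algebra is $\mathbb{C}[\partial]L$ with $[L_\lambda L]=(2\lambda+\partial)L$. A polynomial $f(x,y)\in\mathbb{C}[x,y]$ is skew-symmetric if $f(x,y)=-f(-x-y,y)$. For a skew-symmetric polynomial $Q(\lambda,\partial)$, $R_{nil}(Q(\lambda,\partial))$ is the rank two Lie conformal algebra with basis $\{A,B\}$ and $[A_\lambda A]=[B_\lambda A]=0$, $[B_\lambda B]=Q(\lambda,\partial)A$. For a non-zero $a(\lambda)\in\mathbb{C}[\lambda]$, $R_{sol}(a(\lambda))$ is the rank two Lie conformal algebra with basis $\{A,B\}$ and $[A_\lambda A]=[B_\lambda B]=0$, $[B_\lambda A]=a(\lambda)A$. *)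

theory Defs
  imports
    Complex_Main
    "HOL-Library.Product_Plus"
    "HOL-Computational_Algebra.Polynomial"
begin

section \<open>Lie conformal algebras\<close>

text \<open>
  The \<open>\<complex>[\<partial>]\<close>-module structure of \<open>R\<close> is a module (in the sense of \<^locale>\<open>module\<close>) over the ring
  \<^typ>\<open>complex poly\<close>, the indeterminate being \<open>\<partial>\<close>. The space \<open>\<complex>[\<lambda>] \<otimes> R = R[\<lambda>]\<close> is \<^typ>\<open>'a poly\<close>,
  and \<open>R[\<lambda>,\<mu>]\<close> is \<^typ>\<open>'a poly poly\<close> with outer variable \<open>\<mu>\<close> and inner variable \<open>\<lambda>\<close>.
\<close>

record (overloaded) 'a conf_alg =
  act :: "complex poly \<Rightarrow> 'a::zero \<Rightarrow> 'a"
  br :: "'a \<Rightarrow> 'a \<Rightarrow> 'a poly"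

definition cscale :: "'a::zero conf_alg \<Rightarrow> complex \<Rightarrow> 'a \<Rightarrow> 'a" where
  "cscale R z = act R [:z:]"

definition deriv_op :: "'a::zero conf_alg \<Rightarrow> 'a \<Rightarrow> 'a" where
  "deriv_op R = act R [:0, 1:]"

text \<open>\<open>subst_op T \<iota> (\<Sum>n. \<lambda>\<^sup>n r\<^sub>n) = \<Sum>n. T\<^sup>n (\<iota> r\<^sub>n)\<close>: substitution of the operator \<open>T\<close> for \<open>\<lambda>\<close>.\<close>

definition subst_op :: "('v \<Rightarrow> 'v) \<Rightarrow> ('a::zero \<Rightarrow> 'v) \<Rightarrow> 'a poly \<Rightarrow> 'v::comm_monoid_add" where
  "subst_op T \<iota> P = (\<Sum>n\<le>degree P. (T ^^ n) (\<iota> (coeff P n)))"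

text \<open>Multiplication by \<open>\<lambda>\<close> is \<^term>\<open>pCons 0\<close> on \<open>R[\<lambda>]\<close>, but \<^term>\<open>map_poly (pCons 0)\<close> on
  \<open>R[\<lambda>,\<mu>]\<close>, where \<^term>\<open>pCons 0\<close> is multiplication by \<open>\<mu>\<close>.\<close>

definition neg_lam_del :: "'a::ab_group_add conf_alg \<Rightarrow> 'a poly \<Rightarrow> 'a poly" where
  "neg_lam_del R P = - pCons 0 P - map_poly (deriv_op R) P"  \<comment> \<open>\<open>-\<lambda> - \<partial>\<close>\<close>

definition mult_lam :: "'a::zero poly poly \<Rightarrow> 'a poly poly" where
  "mult_lam = map_poly (pCons 0)"

definition mult_mu :: "'a::zero poly poly \<Rightarrow> 'a poly poly" where
  "mult_mu = pCons 0"

definition mult_lam_mu :: "'a::ab_group_add poly poly \<Rightarrow> 'a poly poly" where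
  "mult_lam_mu P = mult_lam P + mult_mu P"

text \<open>The first four bracket axioms express that the bracket is \<open>\<complex>\<close>-bilinear. In \<open>jacobi\<close> the three terms are
  \<open>[a\<^sub>\<lambda> [b\<^sub>\<mu> c]] = \<Sum>j. \<mu>\<^sup>j [a\<^sub>\<lambda> r\<^sub>j]\<close> where \<open>[b\<^sub>\<mu> c] = \<Sum>j. \<mu>\<^sup>j r\<^sub>j\<close>,
  \<open>[b\<^sub>\<mu> [a\<^sub>\<lambda> c]] = \<Sum>i. \<lambda>\<^sup>i [b\<^sub>\<mu> s\<^sub>i]\<close> where \<open>[a\<^sub>\<lambda> c] = \<Sum>i. \<lambda>\<^sup>i s\<^sub>i\<close>, and
  \<open>[[a\<^sub>\<lambda> b]\<^bsub>\<lambda>+\<mu>\<^esub> c] = \<Sum>k. \<lambda>\<^sup>k [t\<^sub>k \<^bsub>\<lambda>+\<mu>\<^esub> c]\<close> where \<open>[a\<^sub>\<lambda> b] = \<Sum>k. \<lambda>\<^sup>k t\<^sub>k\<close>.\<close>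

locale lie_conformal_algebra = module "act R"
  for R :: "'a::ab_group_add conf_alg" +
  assumes br_add_left: "br R (a + b) c = br R a c + br R b c"
    and br_add_right: "br R a (b + c) = br R a b + br R a c"
    and br_scale_left: "br R (cscale R z a) b = map_poly (cscale R z) (br R a b)"
    and br_scale_right: "br R a (cscale R z b) = map_poly (cscale R z) (br R a b)"
    and br_deriv_left: "br R (deriv_op R a) b = - pCons 0 (br R a b)"
    and br_deriv_right:
      "br R a (deriv_op R b) = pCons 0 (br R a b) + map_poly (deriv_op R) (br R a b)"
    and skew_symmetry: "br R b a = - subst_op (neg_lam_del R) (\<lambda>r. [:r:]) (br R a b)"
    and jacobi:
      "subst_op mult_mu (\<lambda>r. [:br R a r:]) (br R b c)
       - subst_op mult_lam (\<lambda>s. map_poly (\<lambda>u. [:u:]) (br R b s)) (br R a c)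
       = subst_op mult_lam (\<lambda>t. subst_op mult_lam_mu (\<lambda>u. [:[:u:]:]) (br R t c)) (br R a b)"

definition is_basis :: "'a::ab_group_add conf_alg \<Rightarrow> 'a set \<Rightarrow> bool" where
  "is_basis R X \<longleftrightarrow> \<not> module.dependent (act R) X \<and> module.span (act R) X = UNIV"

definition has_rank :: "'a::ab_group_add conf_alg \<Rightarrow> nat \<Rightarrow> bool" where
  "has_rank R n \<longleftrightarrow> (\<exists>X. finite X \<and> card X = n \<and> is_basis R X)"

definition conf_hom ::
  "'a::ab_group_add conf_alg \<Rightarrow> 'b::ab_group_add conf_alg \<Rightarrow> ('a \<Rightarrow> 'b) \<Rightarrow> bool" where
  "conf_hom R S f \<longleftrightarrow> module_hom (act R) (act S) f \<and>
     (\<forall>a b. br S (f a) (f b) = map_poly f (br R a b))"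

definition conf_iso ::
  "'a::ab_group_add conf_alg \<Rightarrow> 'b::ab_group_add conf_alg \<Rightarrow> bool" (infix \<open>\<cong>\<^sub>c\<close> 50) where
  "R \<cong>\<^sub>c S \<longleftrightarrow> (\<exists>f. conf_hom R S f \<and> bij f)"

definition nth_product :: "'a::zero conf_alg \<Rightarrow> 'a \<Rightarrow> nat \<Rightarrow> 'a \<Rightarrow> 'a" where
  "nth_product R a n b = cscale R (fact n) (coeff (br R a b) n)"

definition conf_ideal :: "'a::ab_group_add conf_alg \<Rightarrow> 'a set \<Rightarrow> bool" where
  "conf_ideal R S \<longleftrightarrow> module.subspace (act R) S \<and>
     (\<forall>a. \<forall>b\<in>S. \<forall>n. nth_product R a n b \<in> S)"

definition cspan :: "'a::ab_group_add conf_alg \<Rightarrow> 'a set \<Rightarrow> 'a set" where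
  "cspan R = module.span (cscale R)"

text \<open>Solvability is defined for subsets, so as to apply to ideals as well as to \<open>R\<close> itself.
  The series are numbered from \<open>1\<close>: \<open>derived_series R S 1 = S\<close> and \<open>lower_series R 1\<close> is the whole
  algebra.\<close>

definition derived :: "'a::ab_group_add conf_alg \<Rightarrow> 'a set \<Rightarrow> 'a set" where
  "derived R S = cspan R {nth_product R a n b | a b n. a \<in> S \<and> b \<in> S}"

definition derived_series :: "'a::ab_group_add conf_alg \<Rightarrow> 'a set \<Rightarrow> nat \<Rightarrow> 'a set" where
  "derived_series R S n = (derived R ^^ (n - 1)) S"

definition solvable_on :: "'a::ab_group_add conf_alg \<Rightarrow> 'a set \<Rightarrow> bool" where
  "solvable_on R S \<longleftrightarrow> (\<exists>n\<ge>1. derived_series R S n = {0})"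

definition solvable :: "'a::ab_group_add conf_alg \<Rightarrow> bool" where
  "solvable R \<longleftrightarrow> solvable_on R UNIV"

text \<open>\<open>nested R k\<close> consists of the right-nested products of \<open>k + 1\<close> elements.\<close>

primrec nested :: "'a::zero conf_alg \<Rightarrow> nat \<Rightarrow> 'a set" where
  "nested R 0 = UNIV"
| "nested R (Suc k) = {nth_product R a m x | a m x. x \<in> nested R k}"

definition lower_series :: "'a::ab_group_add conf_alg \<Rightarrow> nat \<Rightarrow> 'a set" where
  "lower_series R n = cspan R (nested R (n - 1))"

definition nilpotent :: "'a::ab_group_add conf_alg \<Rightarrow> bool" where
  "nilpotent R \<longleftrightarrow> (\<exists>n\<ge>1. lower_series R n = {0})"

definition commutative :: "'a::zero conf_alg \<Rightarrow> bool" where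
  "commutative R \<longleftrightarrow> (\<forall>a b. br R a b = 0)"

definition semisimple :: "'a::ab_group_add conf_alg \<Rightarrow> bool" where
  "semisimple R \<longleftrightarrow> \<not> (\<exists>S. conf_ideal R S \<and> S \<noteq> {0} \<and> solvable_on R S)"

definition pair_poly :: "'a::ab_group_add poly \<Rightarrow> 'b::ab_group_add poly \<Rightarrow> ('a \<times> 'b) poly" where
  "pair_poly P Q = map_poly (\<lambda>x. (x, 0)) P + map_poly (\<lambda>y. (0, y)) Q"

definition direct_sum ::
  "'a::ab_group_add conf_alg \<Rightarrow> 'b::ab_group_add conf_alg \<Rightarrow> ('a \<times> 'b) conf_alg" where
  "direct_sum R S =
    \<lparr>act = (\<lambda>p (x, y). (act R p x, act S p y)),
     br = (\<lambda>(x, y) (x', y'). pair_poly (br R x x') (br S y y'))\<rparr>"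

section \<open>Polynomials in \<open>\<lambda>\<close> and \<open>\<partial>\<close>\<close>

text \<open>\<open>\<complex>[\<lambda>,\<partial>]\<close> is \<^typ>\<open>complex poly poly\<close> with outer variable \<open>\<lambda>\<close> and inner variable \<open>\<partial>\<close>, that is,
  \<open>M[\<lambda>]\<close> for the module \<open>M = \<complex>[\<partial>]\<close>.\<close>

definition lam :: "complex poly poly" where
  "lam = [:0, 1:]"

definition del :: "complex poly poly" where
  "del = [:[:0, 1:]:]"

definition const2 :: "complex \<Rightarrow> complex poly poly" where
  "const2 z = [:[:z:]:]"

definition at2 :: "complex poly \<Rightarrow> complex poly poly \<Rightarrow> complex poly poly" where
  "at2 f x = poly (map_poly const2 f) x"  \<comment> \<open>\<open>f(x)\<close> for \<open>x \<in> \<complex>[\<lambda>,\<partial>]\<close>\<close>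

text \<open>\<open>f(\<lambda>,\<partial>) = - f(-\<lambda>-\<partial>,\<partial>)\<close>\<close>

definition skew_sym :: "complex poly poly \<Rightarrow> bool" where
  "skew_sym f \<longleftrightarrow> f = - pcompose f (- lam - del)"

text \<open>\<open>Q(\<lambda>,\<partial>) x \<in> R[\<lambda>]\<close>\<close>

definition poly_act :: "'a::zero conf_alg \<Rightarrow> complex poly poly \<Rightarrow> 'a \<Rightarrow> 'a poly" where
  "poly_act R Q x = map_poly (\<lambda>p. act R p x) Q"

section \<open>The algebras of the classification\<close>

text \<open>In a free module, sesquilinearity forces \<open>[f(\<partial>)x\<^sub>\<lambda> g(\<partial>)y] = f(-\<lambda>) g(\<lambda>+\<partial>) [x\<^sub>\<lambda> y]\<close>.\<close>

definition sesqui :: "complex poly \<Rightarrow> complex poly \<Rightarrow> complex poly poly" where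
  "sesqui f g = at2 f (- lam) * at2 g (lam + del)"

text \<open>Every free module of rank one is isomorphic to one whose underlying group is
  \<^typ>\<open>complex poly\<close>, so quantifying over rank one algebras on this type loses no generality.\<close>

definition Vir :: "complex poly conf_alg" where
  "Vir = \<lparr>act = (*), br = (\<lambda>f g. sesqui f g * (2 * lam + del))\<rparr>"

text \<open>\<open>rank2 M Q V\<close> is the free module on \<open>A = (1, 0)\<close> and \<open>B = (0, 1)\<close> with
  \<open>[A\<^sub>\<lambda> A] = 0\<close>, \<open>[B\<^sub>\<lambda> A] = M A\<close> and \<open>[B\<^sub>\<lambda> B] = Q A + V B\<close>. By skew-symmetry
  \<open>[A\<^sub>\<lambda> B] = - M(-\<lambda>-\<partial>,\<partial>) A\<close>.\<close>

definition rank2 ::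
  "complex poly poly \<Rightarrow> complex poly poly \<Rightarrow> complex poly poly \<Rightarrow> (complex poly \<times> complex poly) conf_alg"
  where "rank2 M Q V =
    \<lparr>act = (\<lambda>p (x, y). (p * x, p * y)),
     br = (\<lambda>(f, g) (f', g'). pair_poly
       (sesqui g f' * M - sesqui f g' * pcompose M (- lam - del) + sesqui g g' * Q)
       (sesqui g g' * V))\<rparr>"

definition R_nil :: "complex poly poly \<Rightarrow> (complex poly \<times> complex poly) conf_alg" where
  "R_nil Q = rank2 0 Q 0"

definition R_sol :: "complex poly \<Rightarrow> (complex poly \<times> complex poly) conf_alg" where
  "R_sol a = rank2 (at2 a lam) 0 0"

definition R_vir ::
  "complex \<Rightarrow> complex \<Rightarrow> complex poly poly \<Rightarrow> (complex poly \<times> complex poly) conf_alg" where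
  "R_vir c d Q = rank2 (const2 c * lam + const2 d + del) Q (2 * lam + del)"

definition admissible :: "complex \<Rightarrow> complex \<Rightarrow> complex poly poly \<Rightarrow> bool" where
  "admissible c d Q \<longleftrightarrow> skew_sym Q \<and>
    (Q \<noteq> 0 \<longrightarrow> d = 0 \<and>
      (c = 1 \<and> (\<exists>\<beta>. Q = const2 \<beta> * (2 * lam + del)) \<or>
       c = 0 \<and> (\<exists>\<beta> \<gamma>. Q = const2 \<beta> * (2 * lam + del) * (lam^2 + lam * del)
                        + const2 \<gamma> * (2 * lam + del) * del) \<or>
       c = - 1 \<and> (\<exists>\<beta> \<gamma>. Q = const2 \<beta> * (2 * lam + del) * del^2
                        + const2 \<gamma> * (2 * lam + del) * (lam^2 + lam * del) * del) \<or>
       c = - 4 \<and> (\<exists>\<beta>. Q = const2 \<beta> * (2 * lam + del) * (lam^2 + lam * del)^3) \<or>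
       c = - 6 \<and> (\<exists>\<beta>. Q = const2 \<beta> * (2 * lam + del) *
                        (11 * (lam^2 + lam * del)^4 + 2 * (lam^2 + lam * del)^3 * del^2))))"

section \<open>Well-definedness of the models\<close>

text \<open>\<^const>\<open>R_nil\<close>, \<^const>\<open>R_sol\<close> and \<^const>\<open>R_vir\<close> are Lie conformal algebras with a basis
  \<open>{A, B}\<close> on which the bracket is the prescribed one. Identities in \<open>R[\<lambda>]\<close> and \<open>R[\<lambda>,\<mu>]\<close> are
  checked by evaluating both components at all complex values of the variables.\<close>

definition additive_map :: "('a::ab_group_add \<Rightarrow> complex) \<Rightarrow> bool" where
  "additive_map h \<longleftrightarrow> (\<forall>x y. h (x + y) = h x + h y)"

lemma additive_map_add: "additive_map h \<Longrightarrow> h (x + y) = h x + h y" by (simp add: additive_map_def)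
lemma additive_map_0: "additive_map h \<Longrightarrow> h 0 = 0" by (metis additive_map_def add_cancel_right_right)
lemma additive_map_minus: "additive_map h \<Longrightarrow> h (- x) = - h x"
  by (metis additive_map_0 additive_map_def add.right_inverse add_eq_0_iff)
lemma additive_map_diff: "additive_map h \<Longrightarrow> h (x - y) = h x - h y"
  by (metis additive_map_add additive_map_minus diff_conv_add_uminus)
lemma additive_map_sum: "additive_map h \<Longrightarrow> h (sum f A) = (\<Sum>i\<in>A. h (f i))"
  by (induction A rule: infinite_finite_induct) (auto simp: additive_map_0 additive_map_add)

definition ev1 :: "('a::ab_group_add \<Rightarrow> complex) \<Rightarrow> complex \<Rightarrow> 'a poly \<Rightarrow> complex" where
  "ev1 h l P = poly (map_poly h P) l"

lemma additive_map_ev: assumes "additive_map h" shows "additive_map (ev1 h l)"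
proof -
  have "map_poly h (x + y) = map_poly h x + map_poly h y" for x y
    by (rule poly_eqI) (simp add: coeff_map_poly additive_map_0 additive_map_add assms)
  then show ?thesis by (simp add: additive_map_def ev1_def)
qed

lemma ev1_eqI:
  assumes "\<And>h. h \<in> F \<Longrightarrow> additive_map h" "\<And>x. (\<forall>h\<in>F. h x = 0) \<Longrightarrow> x = 0"
    and "\<And>h l. h \<in> F \<Longrightarrow> ev1 h l P = ev1 h l Q"
  shows "P = Q"
proof -
  have "coeff P n - coeff Q n = 0" for n
  proof (rule assms(2), rule ballI)
    fix h assume h: "h \<in> F"
    have "map_poly h P = map_poly h Q" using assms(3)[OF h] unfolding ev1_def
      by (simp add: poly_eq_poly_eq_iff[symmetric] fun_eq_iff)
    then have "coeff (map_poly h P) n = coeff (map_poly h Q) n" by simp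
    then show "h (coeff P n - coeff Q n) = 0"
      by (simp add: coeff_map_poly additive_map_0 additive_map_diff assms(1) h)
  qed
  then show ?thesis by (simp add: poly_eq_iff)
qed

lemma ev1_pCons: "additive_map h \<Longrightarrow> ev1 h l (pCons a P) = h a + l * ev1 h l P"
  by (cases "a = 0 \<and> P = 0") (auto simp: ev1_def map_poly_pCons additive_map_0)
lemma ev1_0: "ev1 h l 0 = 0" by (simp add: ev1_def)
lemma ev1_const: "additive_map h \<Longrightarrow> ev1 h l [:a:] = h a"
  by (simp add: ev1_pCons ev1_0)
lemma ev1_map: "f 0 = 0 \<Longrightarrow> additive_map h \<Longrightarrow> ev1 h l (map_poly f P) = ev1 (\<lambda>x. h (f x)) l P"
  by (simp add: ev1_def map_poly_map_poly additive_map_0 comp_def)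
lemma ev1_sum: "additive_map h \<Longrightarrow> ev1 h l P = (\<Sum>n\<le>degree P. l ^ n * h (coeff P n))"
proof -
  assume a: "additive_map h"
  have "degree (map_poly h P) \<le> degree P"
    by (rule degree_le) (simp add: coeff_map_poly additive_map_0 a coeff_eq_0)
  then have "poly (map_poly h P) l = (\<Sum>n\<le>degree P. coeff (map_poly h P) n * l ^ n)"
    unfolding poly_altdef by (intro sum.mono_neutral_left) (auto simp: coeff_eq_0)
  then show ?thesis by (simp add: ev1_def coeff_map_poly additive_map_0 a mult.commute)
qed
lemma ev1_lin: assumes "additive_map h" "additive_map h'"
  shows "ev1 (\<lambda>x. K * h x + K' * h' x) l P = K * ev1 h l P + K' * ev1 h' l P"
proof -
  have "additive_map (\<lambda>x. K * h x + K' * h' x)" using assms by (auto simp: additive_map_def algebra_simps)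
  then show ?thesis using assms
    by (simp add: ev1_sum sum_distrib_left sum.distrib algebra_simps)
qed
lemma ev1_scale: assumes "additive_map h" shows "ev1 (\<lambda>x. K * h x) l P = K * ev1 h l P"
  using ev1_lin[OF assms assms, of K 0] by simp

lemma subst_ev:
  assumes "additive_map F" "\<And>x. F (T x) = t * F x" "\<And>x. F (i x) = g x" "additive_map g"
  shows "F (subst_op T i P) = ev1 g t P"
proof -
  have "F ((T ^^ n) x) = t ^ n * F x" for n x by (induction n) (auto simp: assms)
  then show ?thesis using assms by (simp add: subst_op_def additive_map_sum ev1_sum)
qed

definition ev2 :: "complex poly poly \<Rightarrow> complex \<Rightarrow> complex \<Rightarrow> complex" where
  "ev2 P l d = poly (poly P [:l:]) d"

lemma poly_poly: "poly (poly M p) d = poly (poly M [:poly p d:]) d"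
  by (induction M) auto
lemma at2_pCons: "at2 (pCons c f) x = const2 c + x * at2 f x"
  by (cases "c = 0 \<and> f = 0") (auto simp: at2_def map_poly_pCons const2_def)
lemma ev2_simps: "ev2 (P + Q) l d = ev2 P l d + ev2 Q l d" "ev2 (P - Q) l d = ev2 P l d - ev2 Q l d"
  "ev2 (P * Q) l d = ev2 P l d * ev2 Q l d" "ev2 (- P) l d = - ev2 P l d" "ev2 lam l d = l" "ev2 del l d = d"
  "ev2 (const2 z) l d = z" "ev2 0 l d = 0" "ev2 1 l d = 1" "ev2 (numeral n) l d = numeral n"
  "ev2 (P ^ k) l d = ev2 P l d ^ k"
  "ev2 (pcompose M (- lam - del)) l d = ev2 M (- l - d) d"
  subgoal by (simp add: ev2_def)
  subgoal by (simp add: ev2_def)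
  subgoal by (simp add: ev2_def)
  subgoal by (simp add: ev2_def)
  subgoal by (simp add: ev2_def lam_def)
  subgoal by (simp add: ev2_def del_def)
  subgoal by (simp add: ev2_def const2_def)
  subgoal by (simp add: ev2_def)
  subgoal by (simp add: ev2_def)
  subgoal by (simp add: ev2_def)
  subgoal by (simp add: ev2_def poly_power)
  subgoal by (simp add: ev2_def poly_pcompose) (subst poly_poly, simp add: lam_def del_def)
  done
lemma ev2_at2: "ev2 (at2 f x) l d = poly f (ev2 x l d)"
  by (induction f) (auto simp: at2_pCons ev2_simps at2_def[of 0])
lemma ev2_sesqui: "ev2 (sesqui f g) l d = poly f (- l) * poly g (l + d)"
  by (simp add: sesqui_def ev2_simps ev2_at2)

definition fst_at :: "complex \<Rightarrow> complex poly \<times> complex poly \<Rightarrow> complex" where "fst_at d x = poly (fst x) d"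
definition snd_at :: "complex \<Rightarrow> complex poly \<times> complex poly \<Rightarrow> complex" where "snd_at d x = poly (snd x) d"
definition coords_at where "coords_at = range fst_at \<union> range snd_at"
lemma additive_coords[simp]: "additive_map (fst_at d)" "additive_map (snd_at d)" by (auto simp: additive_map_def fst_at_def snd_at_def)
lemma coords_at_0: "(\<forall>h\<in>coords_at. h x = 0) \<Longrightarrow> x = 0"
  by (cases x) (simp add: coords_at_def fst_at_def snd_at_def ball_Un poly_all_0_iff_0 zero_prod_def)

lemma ev1_pair: "ev1 (fst_at d) l (pair_poly P Q) = ev2 P l d" "ev1 (snd_at d) l (pair_poly P Q) = ev2 Q l d"
proof -
  have p: "ev1 (\<lambda>x. poly x d) l P = ev2 P l d" for P
  proof (induction P)
    case (pCons a P)
    have "additive_map (\<lambda>x::complex poly. poly x d)" by (simp add: additive_map_def)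
    with pCons show ?case by (simp add: ev1_pCons ev2_def)
  qed (simp add: ev1_0 ev2_def)
  have 0: "ev1 (\<lambda>x. 0) l (P :: 'b::ab_group_add poly) = 0" for P
    by (simp add: ev1_sum additive_map_def)
  show "ev1 (fst_at d) l (pair_poly P Q) = ev2 P l d" "ev1 (snd_at d) l (pair_poly P Q) = ev2 Q l d"
    by (simp_all add: pair_poly_def additive_map_add additive_map_ev ev1_map zero_prod_def) 
       (simp_all add: fst_at_def snd_at_def p 0)
qed

context fixes M Q V :: "complex poly poly" begin
lemma rank2_ev_br: 
  "ev1 (fst_at d) l (br (rank2 M Q V) a b) = snd_at (-l) a * fst_at (l+d) b * ev2 M l d - fst_at (-l) a * snd_at (l+d) b * ev2 M (-l-d) d
     + snd_at (-l) a * snd_at (l+d) b * ev2 Q l d"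
  "ev1 (snd_at d) l (br (rank2 M Q V) a b) = snd_at (-l) a * snd_at (l+d) b * ev2 V l d"
  by (cases a; cases b; simp add: rank2_def ev1_pair ev2_simps ev2_sesqui fst_at_def snd_at_def)+

lemma rank2_act_at: "fst_at d (act (rank2 M Q V) p x) = poly p d * fst_at d x" "snd_at d (act (rank2 M Q V) p x) = poly p d * snd_at d x"
  by (cases x; simp add: rank2_def fst_at_def snd_at_def)+
lemma rank2_act_0: "act (rank2 M Q V) p 0 = 0" by (simp add: rank2_def zero_prod_def)
lemma rank2_module: "module (act (rank2 M Q V))"
  by standard (auto simp: rank2_def algebra_simps)

lemma pair_poly_eqI: assumes "\<And>l d. ev1 (fst_at d) l X = ev1 (fst_at d) l Y" "\<And>l d. ev1 (snd_at d) l X = ev1 (snd_at d) l Y"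
  shows "X = Y"
  by (rule ev1_eqI[of coords_at]) (auto simp: coords_at_0 coords_at_def assms)

lemma pair_poly_poly_eqI: assumes "\<And>l m d. ev1 (ev1 (fst_at d) l) m X = ev1 (ev1 (fst_at d) l) m Y"
  "\<And>l m d. ev1 (ev1 (snd_at d) l) m X = ev1 (ev1 (snd_at d) l) m Y"
  shows "X = Y"
proof (rule ev1_eqI[of "{ev1 h l | h l. h \<in> coords_at}"])
  fix x assume "\<forall>h\<in>{ev1 h l |h l. h \<in> coords_at}. h x = 0"
  then show "x = 0" by (intro ev1_eqI[of coords_at]) (auto simp: coords_at_0 ev1_0 coords_at_def)
qed (auto simp: coords_at_def assms additive_map_ev)

lemmas rank2_ev_simps = rank2_act_at rank2_ev_br rank2_act_0 additive_map_add[OF additive_coords(1)] additive_map_add[OF additive_coords(2)] 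
   additive_map_add[OF additive_map_ev[OF additive_coords(1)]] additive_map_add[OF additive_map_ev[OF additive_coords(2)]]
   additive_map_diff[OF additive_map_ev[OF additive_coords(1)]] additive_map_diff[OF additive_map_ev[OF additive_coords(2)]]
   additive_map_minus[OF additive_map_ev[OF additive_coords(1)]] additive_map_minus[OF additive_map_ev[OF additive_coords(2)]] ev1_scale ev1_pCons ev1_0
   additive_map_0[OF additive_coords(1)] additive_map_0[OF additive_coords(2)] ev1_map ev1_const additive_map_ev

lemma rank2_lca:
  assumes Q: "\<And>l d. ev2 Q l d = - ev2 Q (- l - d) d"
    and V: "\<And>l d. ev2 V l d = - ev2 V (- l - d) d"
    and J1: "\<And>l m d. ev2 M m (l+d) * ev2 M l d - ev2 M l (m+d) * ev2 M m d = ev2 V l (-l-m) * ev2 M (l+m) d"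
    and J2: "\<And>l m d. ev2 V m (l+d) * ev2 V l d - ev2 V l (m+d) * ev2 V m d = ev2 V l (-l-m) * ev2 V (l+m) d"
    and J3: "\<And>l m d. ev2 Q m (l+d) * ev2 M l d + ev2 V m (l+d) * ev2 Q l d
         - (ev2 Q l (m+d) * ev2 M m d + ev2 V l (m+d) * ev2 Q m d)
       = - ev2 Q l (-l-m) * ev2 M (-l-m-d) d + ev2 V l (-l-m) * ev2 Q (l+m) d"
  shows "lie_conformal_algebra (rank2 M Q V)"
proof (intro lie_conformal_algebra.intro lie_conformal_algebra_axioms.intro)
  show "module (act (rank2 M Q V))" by (rule rank2_module)
  fix a b c z
  show "br (rank2 M Q V) (a + b) c = br (rank2 M Q V) a c + br (rank2 M Q V) b c" by (rule pair_poly_eqI) (simp_all add: rank2_ev_simps algebra_simps)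
  show "br (rank2 M Q V) a (b + c) = br (rank2 M Q V) a b + br (rank2 M Q V) a c" by (rule pair_poly_eqI) (simp_all add: rank2_ev_simps algebra_simps)
  show "br (rank2 M Q V) (cscale (rank2 M Q V) z a) b = map_poly (cscale (rank2 M Q V) z) (br (rank2 M Q V) a b)"
    by (rule pair_poly_eqI) (simp_all add: rank2_ev_simps cscale_def algebra_simps)
  show "br (rank2 M Q V) a (cscale (rank2 M Q V) z b) = map_poly (cscale (rank2 M Q V) z) (br (rank2 M Q V) a b)"
    by (rule pair_poly_eqI) (simp_all add: rank2_ev_simps cscale_def algebra_simps)
  show "br (rank2 M Q V) (deriv_op (rank2 M Q V) a) b = - pCons 0 (br (rank2 M Q V) a b)"
    by (rule pair_poly_eqI) (simp_all add: rank2_ev_simps deriv_op_def algebra_simps)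
  show "br (rank2 M Q V) a (deriv_op (rank2 M Q V) b) = pCons 0 (br (rank2 M Q V) a b) + map_poly (deriv_op (rank2 M Q V)) (br (rank2 M Q V) a b)"
    by (rule pair_poly_eqI) (simp_all add: rank2_ev_simps deriv_op_def algebra_simps)
  show "br (rank2 M Q V) b a = - subst_op (neg_lam_del (rank2 M Q V)) (\<lambda>r. [:r:]) (br (rank2 M Q V) a b)"
  proof (rule pair_poly_eqI)
    fix l d
    have "ev1 (fst_at d) l (subst_op (neg_lam_del (rank2 M Q V)) (\<lambda>r. [:r:]) (br (rank2 M Q V) a b)) = ev1 (fst_at d) (-l-d) (br (rank2 M Q V) a b)"
      by (rule subst_ev) (simp_all add: rank2_ev_simps neg_lam_del_def deriv_op_def algebra_simps)
    then show "ev1 (fst_at d) l (br (rank2 M Q V) b a) = ev1 (fst_at d) l (- subst_op (neg_lam_del (rank2 M Q V)) (\<lambda>r. [:r:]) (br (rank2 M Q V) a b))"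
      using Q[of l d] by (simp add: rank2_ev_simps algebra_simps)
    have "ev1 (snd_at d) l (subst_op (neg_lam_del (rank2 M Q V)) (\<lambda>r. [:r:]) (br (rank2 M Q V) a b)) = ev1 (snd_at d) (-l-d) (br (rank2 M Q V) a b)"
      by (rule subst_ev) (simp_all add: rank2_ev_simps neg_lam_del_def deriv_op_def algebra_simps)
    then show "ev1 (snd_at d) l (br (rank2 M Q V) b a) = ev1 (snd_at d) l (- subst_op (neg_lam_del (rank2 M Q V)) (\<lambda>r. [:r:]) (br (rank2 M Q V) a b))"
      using V[of l d] by (simp add: rank2_ev_simps algebra_simps)
  qed
  have aev: "additive_map (\<lambda>r. ev1 h l (br (rank2 M Q V) a r))" "additive_map (\<lambda>r. ev1 h l (br (rank2 M Q V) r a))" if "h \<in> coords_at" for h l a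
    using that unfolding coords_at_def
    by (auto simp: additive_map_def rank2_ev_br additive_map_add[OF additive_coords(1)] additive_map_add[OF additive_coords(2)] algebra_simps
        simp del: add_Pair split_paired_All)
  have f1: "ev1 (ev1 h l) m (subst_op mult_mu (\<lambda>r. [:br (rank2 M Q V) a r:]) (br (rank2 M Q V) b c)) 
      = ev1 (\<lambda>r. ev1 h l (br (rank2 M Q V) a r)) m (br (rank2 M Q V) b c)" if "h \<in> coords_at" for h l m
    using that by (intro subst_ev[where F="ev1 (ev1 h l) m" and t="m" and g="\<lambda>r. ev1 h l (br (rank2 M Q V) a r)"]) (auto simp: aev that additive_map_ev mult_mu_def ev1_pCons ev1_const coords_at_def additive_map_0)
  have f2: "ev1 (ev1 h l) m (subst_op mult_lam (\<lambda>s. map_poly (\<lambda>u. [:u:]) (br (rank2 M Q V) b s)) (br (rank2 M Q V) a c))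
      = ev1 (\<lambda>r. ev1 h m (br (rank2 M Q V) b r)) l (br (rank2 M Q V) a c)" if "h \<in> coords_at" for h l m
    using that by (intro subst_ev[where F="ev1 (ev1 h l) m" and t="l" and g="\<lambda>r. ev1 h m (br (rank2 M Q V) b r)"]) (auto simp: aev that additive_map_ev mult_lam_def ev1_map ev1_pCons ev1_scale ev1_const coords_at_def additive_map_0)
  have f3': "ev1 (ev1 h l) m (subst_op mult_lam_mu (\<lambda>u. [:[:u:]:]) (br (rank2 M Q V) t c))
      = ev1 h (l + m) (br (rank2 M Q V) t c)" if "h \<in> coords_at" for h l m t
    using that by (intro subst_ev[where F="ev1 (ev1 h l) m" and t="l + m" and g="h"]) (auto simp: aev that additive_map_ev additive_map_add[OF additive_map_ev] mult_lam_mu_def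
      mult_mu_def mult_lam_def ev1_map ev1_pCons ev1_scale ev1_const coords_at_def additive_map_0 algebra_simps)
  have f3: "ev1 (ev1 h l) m (subst_op mult_lam (\<lambda>t. subst_op mult_lam_mu (\<lambda>u. [:[:u:]:]) (br (rank2 M Q V) t c)) (br (rank2 M Q V) a b))
      = ev1 (\<lambda>t. ev1 h (l + m) (br (rank2 M Q V) t c)) l (br (rank2 M Q V) a b)" if "h \<in> coords_at" for h l m
    using that by (intro subst_ev[where F="ev1 (ev1 h l) m" and t="l" and g="\<lambda>t. ev1 h (l + m) (br (rank2 M Q V) t c)"]) (auto simp: f3' aev that additive_map_ev mult_lam_def
      ev1_map ev1_pCons ev1_scale ev1_const coords_at_def additive_map_0 algebra_simps)
  note lin = ev1_lin[OF additive_coords(1) additive_coords(2)]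
  have g1: "(\<lambda>r. ev1 (fst_at d) l (br (rank2 M Q V) a r)) = (\<lambda>r. (snd_at (-l) a * ev2 M l d) * fst_at (l+d) r +
      (snd_at (-l) a * ev2 Q l d - fst_at (-l) a * ev2 M (-l-d) d) * snd_at (l+d) r)" for l d a
    by (auto simp: rank2_ev_br algebra_simps)
  have g2: "(\<lambda>r. ev1 (snd_at d) l (br (rank2 M Q V) a r)) = (\<lambda>r. 0 * fst_at (l+d) r + (snd_at (-l) a * ev2 V l d) * snd_at (l+d) r)" for l d a
    by (auto simp: rank2_ev_br algebra_simps)
  have g3: "(\<lambda>r. ev1 (fst_at d) l (br (rank2 M Q V) r c)) = (\<lambda>r. (- snd_at (l+d) c * ev2 M (-l-d) d) * fst_at (-l) r +
      (snd_at (l+d) c * ev2 Q l d + fst_at (l+d) c * ev2 M l d) * snd_at (-l) r)" for l d c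
    by (auto simp: rank2_ev_br algebra_simps)
  have g4: "(\<lambda>r. ev1 (snd_at d) l (br (rank2 M Q V) r c)) = (\<lambda>r. 0 * fst_at (-l) r + (snd_at (l+d) c * ev2 V l d) * snd_at (-l) r)" for l d c
    by (auto simp: rank2_ev_br algebra_simps)
  show "subst_op mult_mu (\<lambda>r. [:br (rank2 M Q V) a r:]) (br (rank2 M Q V) b c)
       - subst_op mult_lam (\<lambda>s. map_poly (\<lambda>u. [:u:]) (br (rank2 M Q V) b s)) (br (rank2 M Q V) a c)
       = subst_op mult_lam (\<lambda>t. subst_op mult_lam_mu (\<lambda>u. [:[:u:]:]) (br (rank2 M Q V) t c)) (br (rank2 M Q V) a b)" (is "?L = ?R")
  proof (rule pair_poly_poly_eqI)
    fix l m d
    have H: "fst_at d \<in> coords_at" "snd_at d \<in> coords_at" by (auto simp: coords_at_def)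
    have s: "- (l + m) - d = - l - m - d" "-(l+m) = -l-m" "l - (l+m) = -m" "m - (l+m) = -l"
       "l + (-l-m) = -m" "l + (m + d) = m + (l+d)" "l+m+d = m+(l+d)" "- l - (-l-m) = m" "- m - (l+d) = - l - m - d"
        "- l - (m+d) = -l-m-d" by simp_all
    show "ev1 (ev1 (snd_at d) l) m ?L = ev1 (ev1 (snd_at d) l) m ?R"
      unfolding additive_map_diff[OF additive_map_ev[OF additive_map_ev[OF additive_coords(2)]]] f1[OF H(2)] f2[OF H(2)] f3[OF H(2)]
      unfolding g2 g4 lin
      unfolding rank2_ev_br s
      using arg_cong[OF J2[of m l d], of "\<lambda>x. snd_at (-l) a * snd_at (-m) b * snd_at (m+(l+d)) c * x"]
      by (simp add: algebra_simps)
      have q2: "m + (-l-m-d) = -l-d" "-m-(-l-m-d) = l+d" "-l-m-d+d = -l-m"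
        "l + (-l-m-d) = -m-d" "-l-(-l-m-d) = m+d" by simp_all
      have k1: "ev2 M m (l+d) * ev2 M l d - ev2 M l (m+d) * ev2 M m d - ev2 V l (-l-m) * ev2 M (l+m) d = 0"
        using J1[of m l d] by simp
      have k2: "ev2 M (-l-m-d) (m+d) * ev2 M m d - ev2 M m (-l-m) * ev2 M (-l-m-d) d - ev2 V m (l+d) * ev2 M (-l-d) d = 0"
        using J1[where m="-l-m-d" and l=m and d=d] unfolding q2 by simp
      have k3: "ev2 M (-l-m-d) (l+d) * ev2 M l d - ev2 M l (-l-m) * ev2 M (-l-m-d) d - ev2 V l (m+d) * ev2 M (-m-d) d = 0"
        using J1[where m="-l-m-d" and l=l and d=d] unfolding q2 by simp
      have k4: "ev2 Q m (l+d) * ev2 M l d + ev2 V m (l+d) * ev2 Q l d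
         - (ev2 Q l (m+d) * ev2 M m d + ev2 V l (m+d) * ev2 Q m d)
         - (- ev2 Q l (-l-m) * ev2 M (-l-m-d) d + ev2 V l (-l-m) * ev2 Q (l+m) d) = 0"
        using J3[of m l d] by simp
      have E: "snd_at (-l) a * snd_at (-m) b * fst_at (m+(l+d)) c * (ev2 M m (l+d) * ev2 M l d - ev2 M l (m+d) * ev2 M m d - ev2 V l (-l-m) * ev2 M (l+m) d)
        + fst_at (-l) a * snd_at (-m) b * snd_at (m+(l+d)) c * (ev2 M (-l-m-d) (m+d) * ev2 M m d - ev2 M m (-l-m) * ev2 M (-l-m-d) d - ev2 V m (l+d) * ev2 M (-l-d) d)
        - snd_at (-l) a * fst_at (-m) b * snd_at (m+(l+d)) c * (ev2 M (-l-m-d) (l+d) * ev2 M l d - ev2 M l (-l-m) * ev2 M (-l-m-d) d - ev2 V l (m+d) * ev2 M (-m-d) d)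
        + snd_at (-l) a * snd_at (-m) b * snd_at (m+(l+d)) c * (ev2 Q m (l+d) * ev2 M l d + ev2 V m (l+d) * ev2 Q l d
         - (ev2 Q l (m+d) * ev2 M m d + ev2 V l (m+d) * ev2 Q m d)
         - (- ev2 Q l (-l-m) * ev2 M (-l-m-d) d + ev2 V l (-l-m) * ev2 Q (l+m) d)) = 0"
        unfolding k1 k2 k3 k4 by simp
    show "ev1 (ev1 (fst_at d) l) m ?L = ev1 (ev1 (fst_at d) l) m ?R"
      unfolding additive_map_diff[OF additive_map_ev[OF additive_map_ev[OF additive_coords(1)]]] f1[OF H(1)] f2[OF H(1)] f3[OF H(1)]
      unfolding g1 g3 lin
      unfolding rank2_ev_br s
      using E by (simp add: algebra_simps)
  qed
qed
end

lemma rank2_basis: "is_basis (rank2 M Q V) {(1, 0), (0, 1)}"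
proof -
  interpret module "act (rank2 M Q V)" by (rule rank2_module)
  have "\<not> dependent {(1, 0), (0, 1)}"
    unfolding dependent_finite[OF finite.insertI[OF finite.insertI[OF finite.emptyI]]]
    by (auto simp: rank2_def zero_prod_def)
  moreover have "x \<in> span {(1, 0), (0, 1)}" for x
  proof -
    have "x = act (rank2 M Q V) (fst x) (1, 0) + act (rank2 M Q V) (snd x) (0, 1)"
      by (cases x) (simp add: rank2_def)
    also have "\<dots> \<in> span {(1, 0), (0, 1)}"
      by (intro span_add span_scale span_base) auto
    finally show ?thesis .
  qed
  ultimately show ?thesis by (auto simp: is_basis_def)
qed

lemma rank2_brackets:
  defines "A \<equiv> (1, 0)" and "B \<equiv> (0, 1)"
  shows "br (rank2 M Q V) A A = 0"
    and "br (rank2 M Q V) B A = poly_act (rank2 M Q V) M A"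
    and "br (rank2 M Q V) B B = poly_act (rank2 M Q V) Q A + poly_act (rank2 M Q V) V B"
proof -
  have at: "at2 0 x = 0" "at2 1 x = 1" for x
    using at2_pCons[of 1 0 x] by (simp_all add: at2_def const2_def flip: one_pCons)
  show "br (rank2 M Q V) A A = 0"
    and "br (rank2 M Q V) B A = poly_act (rank2 M Q V) M A"
    and "br (rank2 M Q V) B B = poly_act (rank2 M Q V) Q A + poly_act (rank2 M Q V) V B"
    by (simp_all add: rank2_def A_def B_def sesqui_def at poly_act_def pair_poly_def)
qed

lemma skew_sym_ev2: "skew_sym Q \<Longrightarrow> ev2 Q l d = - ev2 Q (- l - d) d"
  by (metis skew_sym_def ev2_simps(4,12))

lemma lie_conformal_algebra_R_nil: "skew_sym Q \<Longrightarrow> lie_conformal_algebra (R_nil Q)"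
  unfolding R_nil_def by (rule rank2_lca) (simp_all add: ev2_simps skew_sym_ev2[symmetric])

lemma lie_conformal_algebra_R_sol: "lie_conformal_algebra (R_sol a)"
  unfolding R_sol_def by (rule rank2_lca) (simp_all add: ev2_simps ev2_at2)

lemma lie_conformal_algebra_R_vir:
  assumes "admissible c d Q"
  shows "lie_conformal_algebra (R_vir c d Q)"
  unfolding R_vir_def
proof (rule rank2_lca)
  fix l m x
  show "ev2 Q l x = - ev2 Q (- l - x) x" using assms by (auto simp: admissible_def intro: skew_sym_ev2)
  show "ev2 Q m (l + x) * ev2 (const2 c * lam + const2 d + del) l x + ev2 (2 * lam + del) m (l + x) * ev2 Q l x
         - (ev2 Q l (m + x) * ev2 (const2 c * lam + const2 d + del) m x + ev2 (2 * lam + del) l (m + x) * ev2 Q m x)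
       = - ev2 Q l (-l-m) * ev2 (const2 c * lam + const2 d + del) (-l-m-x) x + ev2 (2 * lam + del) l (-l-m) * ev2 Q (l+m) x"
  proof (cases "Q = 0")
    case True
    then show ?thesis by (simp add: ev2_simps)
  next
    case False
    with assms have "d = 0" and
      "c = 1 \<and> (\<exists>\<beta>. Q = const2 \<beta> * (2 * lam + del)) \<or>
       c = 0 \<and> (\<exists>\<beta> \<gamma>. Q = const2 \<beta> * (2 * lam + del) * (lam^2 + lam * del)
                        + const2 \<gamma> * (2 * lam + del) * del) \<or>
       c = - 1 \<and> (\<exists>\<beta> \<gamma>. Q = const2 \<beta> * (2 * lam + del) * del^2
                        + const2 \<gamma> * (2 * lam + del) * (lam^2 + lam * del) * del) \<or>
       c = - 4 \<and> (\<exists>\<beta>. Q = const2 \<beta> * (2 * lam + del) * (lam^2 + lam * del)^3) \<or>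
       c = - 6 \<and> (\<exists>\<beta>. Q = const2 \<beta> * (2 * lam + del) *
                        (11 * (lam^2 + lam * del)^4 + 2 * (lam^2 + lam * del)^3 * del^2))"
      unfolding admissible_def by blast+
    from this(2) show ?thesis unfolding \<open>d = 0\<close>
      apply -
      apply (elim disjE conjE exE)
          apply (simp_all only: ev2_simps)
      subgoal premises by algebra
      subgoal premises by algebra
      subgoal premises by algebra
      subgoal premises by algebra
      subgoal premises by algebra
      done
  qed
qed (simp_all add: ev2_simps algebra_simps)

end

theory Submission
  imports Defs
begin

text \<open>
  The presentation. If \<open>R\<close> is not semisimple, the last non-zero term of the derived series of a non-zero
  solvable ideal is a non-zero abelian ideal \<open>T\<close> of \<open>R\<close>. Take \<open>a \<in> T\<close> non-zero and divide its coordinates by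
  their greatest common divisor \<open>g\<close>: then \<open>a = g(\<partial>)A\<close> with \<open>A\<close> a member of a basis \<open>{A, B}\<close>. Since brackets
  are sesquilinear and \<open>R\<close> has no torsion, \<open>[A\<^sub>\<lambda> A] = 0\<close>. If \<open>T\<close> lies in \<open>\<complex>[\<partial>]A\<close>, then \<open>[B\<^sub>\<lambda> A]\<close> is a
  multiple of \<open>A\<close> because \<open>T\<close> is an ideal; otherwise \<open>T\<close> contains an element with a non-zero \<open>B\<close>-component
  that commutes with \<open>a\<close>, and \<open>[B\<^sub>\<lambda> A] = 0\<close>. So \<open>R\<close> is \<open>rank2 M Q V\<close> for three polynomials
  (\<open>rank2_presentation\<close>), and skew-symmetry and the Jacobi identity become functional equations for their
  values (\<open>structure_equations\<close>).

  The quotient and its module. The equations for \<open>V\<close> and \<open>M\<close> say that \<open>R / \<complex>[\<partial>]A\<close> is a Lie conformal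
  algebra of rank one and that \<open>\<complex>[\<partial>]A\<close> is a module over it. Comparing top powers of \<open>\<partial>\<close> shows that \<open>V\<close> and \<open>M\<close> are
  affine in \<open>\<partial>\<close>; then \<open>V\<close> is a multiple of \<open>2\<lambda> + \<partial>\<close>, and \<open>M = a(\<lambda>)\<close> if \<open>V = 0\<close>, while \<open>M = 0\<close> or
  \<open>M = c\<lambda> + d + \<partial>\<close> if \<open>V = 2\<lambda> + \<partial>\<close>. Whether \<open>R\<close> is nilpotent, solvable or neither is read off from
  \<open>M\<close> and \<open>V\<close> by following the \<open>A\<close>- and \<open>B\<close>-components of iterated products.

  The extension. Finally \<open>Q\<close> is a \<open>2\<close>-cocycle, and replacing \<open>B\<close> by \<open>B + g(\<partial>)A\<close> changes it by the coboundary
  of \<open>g\<close>. For \<open>V = 0\<close> and \<open>M = a(\<lambda>) \<noteq> 0\<close>, and for \<open>V = 2\<lambda> + \<partial>\<close> and \<open>M = 0\<close>, every cocycle is a coboundary.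
  The heart of the proof is the case \<open>V = 2\<lambda> + \<partial>\<close>, \<open>M = c\<lambda> + d + \<partial>\<close>, where the Jacobi identity is expanded in
  powers of its second spectral variable \<open>\<mu>\<close>. The constant term is a contracting homotopy if \<open>d \<noteq> 0\<close>. If \<open>d = 0\<close>,
  the identity is homogeneous, so the components \<open>Q\<^sub>N\<close> of \<open>Q\<close> can be treated one at a time. The coefficient of
  \<open>\<mu>\<close> is Euler's identity and makes \<open>Q\<^sub>N\<close> a coboundary unless \<open>N = 3 - c\<close> or \<open>N\<close> is small. In the resonant degree
  \<open>N = 3 - c \<ge> 5\<close>, a coboundary can be subtracted so that \<open>Q\<^sub>N\<close> is divisible by \<open>\<lambda>\<^sup>3\<close>; the coefficient of \<open>\<mu>\<^sup>2\<close> is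
  then a recursion that determines \<open>Q\<^sub>N\<close> from its \<open>\<lambda>\<^sup>3\<close>-coefficient \<open>a\<^sub>3\<close>, and for \<open>N \<ge> 8\<close> the coefficient of
  \<open>\<mu>\<^sup>3\<lambda>\<^sup>4\<close> gives \<open>(N - 4)(N - 9) a\<^sub>3 = 0\<close>. Skew-symmetry excludes \<open>N = 5\<close> and \<open>N = 6\<close>, and what remains is
  \<open>N = 7\<close> and \<open>N = 9\<close>, that is, \<open>c = -4\<close> and \<open>c = -6\<close>; the degrees below \<open>5\<close> give \<open>c \<in> {1, 0, -1}\<close>.

  Isomorphism. In each of the three families an isomorphism must preserve \<open>\<complex>[\<partial>]A\<close> (except between commutative
  algebras), hence it is triangular with constant diagonal, and comparing brackets leaves only the rescaling of \<open>A\<close>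
  and \<open>B\<close> and a coboundary. The normal forms of the Virasoro cocycles are linearly independent modulo coboundaries,
  which is checked degree by degree.
\<close>

section \<open>Homogeneous cocycles and their Taylor coefficients\<close>

text \<open>The coboundary of \<open>g = \<partial>\<^sup>n\<close> for the module \<open>M = c\<lambda> + \<partial>\<close> over the Virasoro algebra:
  \<open>g(\<lambda>+\<partial>) M(\<lambda>,\<partial>) - g(-\<lambda>) M(-\<lambda>-\<partial>,\<partial>) - g(\<partial>) (2\<lambda>+\<partial>)\<close>. Cocycles are treated as functions of two complex numbers,
  the values \<open>l\<close> of \<open>\<lambda>\<close> and \<open>x\<close> of \<open>\<partial>\<close>.\<close>

definition cob :: "complex \<Rightarrow> nat \<Rightarrow> complex \<Rightarrow> complex \<Rightarrow> complex" where
  "cob c n l x = (l + x) ^ n * (c * l + x) - (- l) ^ n * ((1 - c) * x - c * l) - (2 * l + x) * x ^ n"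

definition skew_fun :: "(complex \<Rightarrow> complex \<Rightarrow> complex) \<Rightarrow> bool" where
  "skew_fun F \<longleftrightarrow> (\<forall>l x. F l x = - F (- l - x) x)"

text \<open>The \<open>A\<close>-component of the Jacobi identity for \<open>B, B, B\<close> when \<open>[B\<^sub>\<lambda> A] = (c\<lambda> + \<partial>)A\<close> and
  \<open>[B\<^sub>\<lambda> B] = F(\<lambda>,\<partial>)A + (2\<lambda> + \<partial>)B\<close>. All its terms have the degree of \<open>F\<close> plus one.\<close>

definition cocycle :: "complex \<Rightarrow> (complex \<Rightarrow> complex \<Rightarrow> complex) \<Rightarrow> bool" where
  "cocycle c F \<longleftrightarrow> (\<forall>l m x. F m (l + x) * (c * l + x) + (2 * m + l + x) * F l x
      - F l (m + x) * (c * m + x) - (2 * l + m + x) * F m x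
    = - F l (- l - m) * (c * (- l - m - x) + x) + (l - m) * F (l + m) x)"

definition homog_fun :: "nat \<Rightarrow> (nat \<Rightarrow> complex) \<Rightarrow> complex \<Rightarrow> complex \<Rightarrow> complex" where
  "homog_fun N a l x = (\<Sum>i\<le>N. a i * l ^ i * x ^ (N - i))"

definition is_homog :: "nat \<Rightarrow> (complex \<Rightarrow> complex \<Rightarrow> complex) \<Rightarrow> bool" where
  "is_homog N F \<longleftrightarrow> (\<exists>a. F = homog_fun N a)"

lemma is_homog_add: "is_homog N F \<Longrightarrow> is_homog N G \<Longrightarrow> is_homog N (\<lambda>l x. F l x + G l x)"
proof -
  assume "is_homog N F" "is_homog N G"
  then obtain a b where "F = homog_fun N a" "G = homog_fun N b" by (auto simp: is_homog_def)
  then show ?thesis unfolding is_homog_def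
    by (intro exI[of _ "\<lambda>i. a i + b i"]) (simp add: homog_fun_def fun_eq_iff sum.distrib algebra_simps)
qed

lemma is_homog_scale: "is_homog N F \<Longrightarrow> is_homog N (\<lambda>l x. z * F l x)"
proof -
  assume "is_homog N F"
  then obtain a where "F = homog_fun N a" by (auto simp: is_homog_def)
  then show ?thesis unfolding is_homog_def
    by (intro exI[of _ "\<lambda>i. z * a i"]) (simp add: homog_fun_def fun_eq_iff sum_distrib_left mult.assoc)
qed

lemma is_homog_diff: "is_homog N F \<Longrightarrow> is_homog N G \<Longrightarrow> is_homog N (\<lambda>l x. F l x - G l x)"
  using is_homog_add[of N F "\<lambda>l x. - 1 * G l x"] is_homog_scale[of N G "-1"] by simp

lemma is_homog_lam: "is_homog N F \<Longrightarrow> is_homog (Suc N) (\<lambda>l x. l * F l x)"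
proof -
  assume "is_homog N F"
  then obtain a where "F = homog_fun N a" by (auto simp: is_homog_def)
  then show ?thesis unfolding is_homog_def
    by (intro exI[of _ "case_nat 0 a"])
      (simp add: homog_fun_def fun_eq_iff sum.atMost_Suc_shift sum_distrib_left algebra_simps del: sum.atMost_Suc)
qed

lemma is_homog_del: "is_homog N F \<Longrightarrow> is_homog (Suc N) (\<lambda>l x. x * F l x)"
proof -
  assume "is_homog N F"
  then obtain a where "F = homog_fun N a" by (auto simp: is_homog_def)
  then show ?thesis unfolding is_homog_def
    by (intro exI[of _ "\<lambda>i. if i \<le> N then a i else 0"])
      (auto simp: homog_fun_def fun_eq_iff sum_distrib_left Suc_diff_le algebra_simps intro!: sum.cong)
qed

lemma is_homog_const: "is_homog 0 (\<lambda>l x. z)"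
  unfolding is_homog_def by (intro exI[of _ "\<lambda>_. z"]) (simp add: homog_fun_def fun_eq_iff)

lemma is_homog_linear: "is_homog N F \<Longrightarrow> is_homog (Suc N) (\<lambda>l x. (u * l + v * x) * F l x)"
  using is_homog_add[OF is_homog_scale[OF is_homog_lam, of N F u] is_homog_scale[OF is_homog_del, of N F v]]
  by (simp add: algebra_simps)

lemma is_homog_linear_power: "is_homog n (\<lambda>l x. (u * l + v * x) ^ n)"
proof (induction n)
  case 0 then show ?case using is_homog_const[of 1] by simp
next
  case (Suc n) then show ?case using is_homog_linear[of n _ u v] by simp
qed

lemma is_homog_cob: "is_homog (Suc n) (cob c n)"
proof -
  have "is_homog (Suc n) (\<lambda>l x. (c * l + 1 * x) * (1 * l + 1 * x) ^ n
      - (- c * l + (1 - c) * x) * ((-1) * l + 0 * x) ^ n - (2 * l + 1 * x) * (0 * l + 1 * x) ^ n)"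
    by (intro is_homog_diff is_homog_linear is_homog_linear_power)
  also have "(\<lambda>l x. (c * l + 1 * x) * (1 * l + 1 * x) ^ n
      - (- c * l + (1 - c) * x) * ((-1) * l + 0 * x) ^ n - (2 * l + 1 * x) * (0 * l + 1 * x) ^ n) = cob c n"
    by (simp add: fun_eq_iff cob_def algebra_simps)
  finally show ?thesis .
qed

lemma skew_fun_diff: "skew_fun F \<Longrightarrow> skew_fun G \<Longrightarrow> skew_fun (\<lambda>l x. F l x - z * G l x)"
  unfolding skew_fun_def by (metis (no_types, lifting) minus_diff_minus mult_minus_right)

lemma cocycle_diff: 
  assumes "cocycle c F" "cocycle c G" shows "cocycle c (\<lambda>l x. F l x - z * G l x)"
  unfolding cocycle_def
proof (intro allI)
  fix l m x
  show "(F m (l + x) - z * G m (l + x)) * (c * l + x) + (2 * m + l + x) * (F l x - z * G l x) -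
       (F l (m + x) - z * G l (m + x)) * (c * m + x) - (2 * l + m + x) * (F m x - z * G m x) =
       - (F l (- l - m) - z * G l (- l - m)) * (c * (- l - m - x) + x) +
       (l - m) * (F (l + m) x - z * G (l + m) x)"
    using assms[unfolded cocycle_def, rule_format, of m l x] by algebra
qed

lemma skew_cob: "skew_fun (cob c n)"
  by (simp add: skew_fun_def cob_def algebra_simps)

text \<open>The instance of \<open>d \<circ> d = 0\<close> needed here: replacing \<open>B\<close> by \<open>B + \<partial>\<^sup>nA\<close> cannot destroy the Jacobi identity.\<close>

lemma cocycle_cob: "cocycle c (cob c n)"
  unfolding cocycle_def
proof (intro allI)
  fix l m x :: complex
  have e: "m + (l + x) = l + m + x" "l + (m + x) = l + m + x" "l + (- l - m) = - m" "- (l + m) = - l - m"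
    by (simp_all add: algebra_simps)
  show "cob c n m (l + x) * (c * l + x) + (2 * m + l + x) * cob c n l x
      - cob c n l (m + x) * (c * m + x) - (2 * l + m + x) * cob c n m x
    = - cob c n l (- l - m) * (c * (- l - m - x) + x) + (l - m) * cob c n (l + m) x"
    unfolding cob_def e by (simp add: algebra_simps)
qed

lemma poly_eq_by_values: "(\<And>t::complex. poly p t = poly q t) \<Longrightarrow> p = q"
  by (simp add: poly_eq_poly_eq_iff[symmetric] fun_eq_iff)

text \<open>Unlike \<open>coeff_linear_poly_power\<close> this covers \<open>i > n\<close>, where both sides vanish, so that it applies
  uniformly under sums.\<close>

lemma coeff_linear_power:
  fixes a b :: "'a::comm_semiring_1"
  shows "coeff ([:a, b:] ^ n) i = of_nat (n choose i) * b ^ i * a ^ (n - i)"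
proof (cases "i \<le> n")
  case False
  have "degree ([:a, b:] ^ n) \<le> n"
    by (rule order.trans[OF degree_power_le]) (simp add: degree_pCons_eq_if)
  with False show ?thesis by (simp add: coeff_eq_0 binomial_eq_0)
qed (rule coeff_linear_poly_power)

text \<open>The cocycle identity at \<open>m = 0\<close>. In the degrees where \<open>cob c N\<close> is not identically zero this forces the
  cocycle to be divisible by \<open>\<lambda>\<close>.\<close>

lemma cocycle_coeff_0:
  assumes F: "F = homog_fun N a" and "skew_fun F" "cocycle c F"
  shows "a 0 * cob c N l x = 0"
proof -
  have F0: "F 0 y = a 0 * y ^ N" for y
    unfolding F homog_fun_def by (simp add: power_0_left mult.assoc sum.atMost_shift)
  have "F l (- l) = - F 0 (-l)" using assms(2) unfolding skew_fun_def by (metis add.right_inverse diff_0 diff_self diff_conv_add_uminus)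
  with assms(3)[unfolded cocycle_def, rule_format, of 0 l x]
  have "a 0 * (l + x) ^ N * (c * l + x) + (l + x) * F l x - F l x * x - (2 * l + x) * (a 0 * x ^ N)
     = a 0 * (-l) ^ N * (c * (- l - x) + x) + l * F l x" by (simp add: F0)
  then show ?thesis unfolding cob_def by (simp add: algebra_simps)
qed

text \<open>The coefficient of \<open>m\<^bsup>i+1\<^esup>\<close> in the cocycle identity, for a cocycle divisible by \<open>\<lambda>\<^bsup>i+1\<^esup>\<close>. By
  skew-symmetry \<open>F(\<lambda>, -\<lambda>-\<mu>) = -F(\<mu>, -\<lambda>-\<mu>)\<close>, so every term in which \<open>\<mu>\<close> is the first argument of \<open>F\<close> contributes only
  through \<open>a (Suc i)\<close>, and these contributions add up to a coboundary.\<close>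

lemma cocycle_coeff_Suc:
  assumes F: "F = homog_fun N a" and sk: "skew_fun F" and co: "cocycle c F"
    and z: "\<And>k. k < Suc i \<Longrightarrow> a k = 0" and iN: "Suc i \<le> N"
  shows "a (Suc i) * cob c (N - Suc i) l x + (if i = 0 then 2 * F l x else 0)
    = (\<Sum>k\<le>N. a k * l ^ k * (of_nat (N - k choose Suc i) * (x ^ (N - k - Suc i) * x) + c * of_nat (N - k choose i) * x ^ (N - k - i)))
      + (\<Sum>k\<le>N. a k * x ^ (N - k) * (of_nat (k choose Suc i) * (l ^ (k - Suc i) * l) - of_nat (k choose i) * l ^ (k - i)))"
    (is "?lhs = ?s1 + ?s2")
proof -
  define P where "P y = (\<Sum>k\<le>N. monom (a k * y ^ (N - k)) k)" for y
  \<comment> \<open>\<open>P y\<close>, \<open>T3\<close>, \<open>T5\<close> and \<open>T6\<close> are \<open>F(m, y)\<close>, \<open>F(l, m+x)\<close>, \<open>F(m, -l-m)\<close> and \<open>F(l+m, x)\<close> as polynomials in \<open>m\<close>.\<close>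
  define T3 where "T3 = (\<Sum>k\<le>N. smult (a k * l ^ k) ([:x, 1:] ^ (N - k)))"
  define T5 where "T5 = (\<Sum>k\<le>N. monom (a k) k * [:-l, -1:] ^ (N - k))"
  define T6 where "T6 = (\<Sum>k\<le>N. smult (a k * x ^ (N - k)) ([:l, 1:] ^ k))"
  have pP: "poly (P y) m = F m y" for y m
    by (simp add: P_def F homog_fun_def poly_sum poly_monom mult_ac)
  have p3: "poly T3 m = F l (m + x)" for m
    by (simp add: T3_def F homog_fun_def poly_sum poly_power add_ac)
  have p5: "poly T5 m = F m (- l - m)" for m
    by (simp add: T5_def F homog_fun_def poly_sum poly_power poly_monom)
  have p6: "poly T6 m = F (l + m) x" for m
    by (simp add: T6_def F homog_fun_def poly_sum poly_power mult_ac add_ac)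
  have "[:c * l + x:] * P (l + x) + [:(l + x) * F l x, 2 * F l x:] - [:x, c:] * T3 - [:2 * l + x, 1:] * P x
     = [:- c * l - c * x + x, - c:] * T5 + [:l, -1:] * T6"
  proof (rule poly_eq_by_values)
    fix m
    have "- F l (- l - m) = F m (- l - m)" using sk unfolding skew_fun_def
      by (metis add_diff_cancel_left' diff_minus_eq_add minus_minus add.commute minus_add_distrib uminus_add_conv_diff)
    then show "poly ([:c * l + x:] * P (l + x) + [:(l + x) * F l x, 2 * F l x:] - [:x, c:] * T3 - [:2 * l + x, 1:] * P x) m
       = poly ([:- c * l - c * x + x, - c:] * T5 + [:l, -1:] * T6) m"
      using co[unfolded cocycle_def, rule_format, of m l x]
      unfolding poly_add poly_diff poly_mult pP p3 p5 p6 by (simp add: algebra_simps)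
  qed
  from arg_cong[OF this, of "\<lambda>p. coeff p (Suc i)"]
  have E: "(c * l + x) * coeff (P (l + x)) (Suc i) + (if i = 0 then 2 * F l x else 0)
      - (x * coeff T3 (Suc i) + c * coeff T3 i) - ((2 * l + x) * coeff (P x) (Suc i) + coeff (P x) i)
    = (- c * l - c * x + x) * coeff T5 (Suc i) - c * coeff T5 i + (l * coeff T6 (Suc i) - coeff T6 i)"
    by (simp add: mult_pCons_left coeff_pCons split: nat.splits)
  have cP: "coeff (P y) j = (if j \<le> N then a j * y ^ (N - j) else 0)" for y j
    unfolding P_def by (simp add: coeff_sum if_distrib sum.delta cong: if_cong)
  have cP0: "coeff (P x) i = 0" using z by (simp add: cP)
  have cPS: "coeff (P y) (Suc i) = a (Suc i) * y ^ (N - Suc i)" for y using iN by (simp add: cP)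
  have c3: "coeff T3 j = (\<Sum>k\<le>N. a k * l ^ k * (of_nat (N - k choose j) * x ^ (N - k - j)))" for j
    by (simp add: T3_def coeff_sum coeff_linear_power)
  have c6: "coeff T6 j = (\<Sum>k\<le>N. a k * x ^ (N - k) * (of_nat (k choose j) * l ^ (k - j)))" for j
    by (simp add: T6_def coeff_sum coeff_linear_power)
  have c5: "coeff T5 j = (\<Sum>k\<le>N. if k = Suc i \<and> k = j then a k * (-l) ^ (N - k) else 0)" if "j \<le> Suc i" for j
    unfolding T5_def coeff_sum coeff_monom_mult
    using that z by (intro sum.cong refl) (auto simp: coeff_linear_power not_less less_Suc_eq_le)
  have c50: "coeff T5 i = 0" by (subst c5) (auto intro!: sum.neutral)
  have c5S: "coeff T5 (Suc i) = a (Suc i) * (-l) ^ (N - Suc i)"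
    using iN by (subst c5) (auto simp: sum.delta' cong: if_cong)
  have s1: "?s1 = x * coeff T3 (Suc i) + c * coeff T3 i"
    unfolding c3 sum_distrib_left sum.distrib[symmetric] by (intro sum.cong refl) (simp add: algebra_simps)
  have s2: "?s2 = l * coeff T6 (Suc i) - coeff T6 i"
    unfolding c6 sum_distrib_left sum_subtractf[symmetric] by (intro sum.cong refl) (simp add: algebra_simps)
  show ?thesis unfolding s1 s2 using E unfolding cP0 cPS c50 c5S cob_def by (simp add: algebra_simps)
qed

lemma choose_mult_power: "of_nat (n choose Suc i) * ((x::complex) ^ (n - Suc i) * x) = of_nat (n choose Suc i) * x ^ (n - i)"
proof (cases "Suc i \<le> n")
  case True
  then have "n - i = Suc (n - Suc i)" by simp
  then show ?thesis by (simp add: mult.commute)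
qed (simp add: binomial_eq_0)

text \<open>In the coefficient of \<open>m\<close>, the two sums are \<open>(\<partial> d/d\<partial> + c) F\<close> and \<open>(\<lambda> d/d\<lambda> - 1) F\<close>, and Euler's identity
  turns them into a multiple of \<open>F\<close>. Outside the resonant degree \<open>N = 3 - c\<close> the cocycle is therefore a coboundary.\<close>

lemma cocycle_coeff_1:
  assumes F: "F = homog_fun N a" and "skew_fun F" "cocycle c F" "a 0 = 0" "1 \<le> N"
  shows "a 1 * cob c (N - 1) l x = (of_nat N + c - 3) * F l x"
proof -
  have "a 1 * cob c (N - 1) l x + 2 * F l x
     = (\<Sum>k\<le>N. a k * l ^ k * (of_nat (N - k) * x ^ (N - k) + c * x ^ (N - k)))
      + (\<Sum>k\<le>N. a k * x ^ (N - k) * (of_nat k * l ^ k - l ^ k))"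
    using cocycle_coeff_Suc[OF assms(1-3), of 0 l x] assms(4,5) unfolding choose_mult_power by simp
  also have "\<dots> = (of_nat N + c - 1) * F l x"
    unfolding F homog_fun_def sum_distrib_left sum.distrib[symmetric]
    by (intro sum.cong refl) (simp add: of_nat_diff algebra_simps)
  finally show ?thesis by (simp add: algebra_simps)
qed

text \<open>Stated without division, as polynomial identities that \<open>algebra\<close> can use.\<close>

lemma choose_numeral:
  "2 * of_nat (n choose 2) = (of_nat n * (of_nat n - 1) :: complex)"
  "6 * of_nat (n choose 3) = (of_nat n * (of_nat n - 1) * (of_nat n - 2) :: complex)"
  "24 * of_nat (n choose 4) = (of_nat n * (of_nat n - 1) * (of_nat n - 2) * (of_nat n - 3) :: complex)"
proof -
  have s: "(2::nat) = Suc (Suc 0)" "(3::nat) = Suc (Suc (Suc 0))" "(4::nat) = Suc (Suc (Suc (Suc 0)))" by simp_all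
  show "2 * of_nat (n choose 2) = (of_nat n * (of_nat n - 1) :: complex)"
    unfolding binomial_gbinomial s gbinomial_prod_rev by (simp only: prod.atLeast0_lessThan_Suc) (simp add: fact_numeral)
  show "6 * of_nat (n choose 3) = (of_nat n * (of_nat n - 1) * (of_nat n - 2) :: complex)"
    unfolding binomial_gbinomial s gbinomial_prod_rev by (simp only: prod.atLeast0_lessThan_Suc) (simp add: fact_numeral)
  show "24 * of_nat (n choose 4) = (of_nat n * (of_nat n - 1) * (of_nat n - 2) * (of_nat n - 3) :: complex)"
    unfolding binomial_gbinomial s gbinomial_prod_rev by (simp only: prod.atLeast0_lessThan_Suc) (simp add: fact_numeral)
qed

text \<open>The dehomogenization of \<open>cob c n\<close> at \<open>\<partial> = 1\<close>, whose coefficients can be read off.\<close>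

definition cob_poly :: "complex \<Rightarrow> nat \<Rightarrow> complex poly" where
  "cob_poly c n = [:1, c:] * [:1, 1:] ^ n - [:1 - c, - c:] * monom ((-1) ^ n) n - [:1, 2:]"

lemma poly_cob_poly: "poly (cob_poly c n) l = cob c n l 1"
proof -
  have "(- l) ^ n = (- 1) ^ n * l ^ n" by (simp flip: power_mult_distrib)
  then show ?thesis by (simp add: cob_poly_def cob_def poly_power poly_monom algebra_simps)
qed

text \<open>The lower bounds on \<open>n\<close> keep the term \<open>(-\<lambda>)\<^sup>n(\<dots>)\<close> from contributing to the coefficient.\<close>

lemma coeff_cob_poly:
  "3 \<le> n \<Longrightarrow> coeff (cob_poly c n) 1 = of_nat n + c - 2"
  "4 \<le> n \<Longrightarrow> coeff (cob_poly c n) 2 = of_nat (n choose 2) + c * of_nat n"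
  "5 \<le> n \<Longrightarrow> coeff (cob_poly c n) 4 = of_nat (n choose 4) + c * of_nat (n choose 3)"
proof -
  have h: "coeff ([:u, v:] * q) (Suc j) = u * coeff q (Suc j) + v * coeff q j" for u v and q :: "complex poly" and j
    by (simp add: mult_pCons_left)
  have b: "coeff ([:1, 1:] ^ n) j = of_nat (n choose j)" for j
    by (simp add: coeff_linear_power)
  show "3 \<le> n \<Longrightarrow> coeff (cob_poly c n) 1 = of_nat n + c - 2"
    unfolding One_nat_def cob_poly_def coeff_diff h b coeff_monom by simp
  have 2: "(2::nat) = Suc 1" "(4::nat) = Suc 3" by simp_all
  have 3: "coeff [:1, 2:] (Suc 1) = (0::complex)" "coeff [:1, 2:] (Suc 3) = (0::complex)"
    by (simp_all add: numeral_eq_Suc)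
  show "4 \<le> n \<Longrightarrow> coeff (cob_poly c n) 2 = of_nat (n choose 2) + c * of_nat n"
    unfolding 2 cob_poly_def coeff_diff h b coeff_monom 3 by simp
  show "5 \<le> n \<Longrightarrow> coeff (cob_poly c n) 4 = of_nat (n choose 4) + c * of_nat (n choose 3)"
    unfolding 2(2) cob_poly_def coeff_diff h b coeff_monom 3 by simp
qed

section \<open>Classification of homogeneous cocycles\<close>

text \<open>Representatives of the non-trivial cocycle classes, by weight \<open>c\<close> and degree \<open>N\<close>. In each case \<open>N\<close> is the
  resonant degree \<open>3 - c\<close> or one less.\<close>

definition nf :: "complex \<Rightarrow> nat \<Rightarrow> complex \<Rightarrow> complex \<Rightarrow> complex" where
  "nf c N l x = (2 * l + x) *
    (if c = 1 \<and> N = 1 then 1 else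
     if c = 0 \<and> N = 2 then x else
     if c = 0 \<and> N = 3 then l^2 + l * x else
     if c = - 1 \<and> N = 3 then x^2 else
     if c = - 1 \<and> N = 4 then (l^2 + l * x) * x else
     if c = - 4 \<and> N = 7 then (l^2 + l * x)^3 else
     if c = - 6 \<and> N = 9 then 11 * (l^2 + l * x)^4 + 2 * (l^2 + l * x)^3 * x^2 else 0)"

text \<open>The coefficient of \<open>\<lambda>\<partial>\<^sup>n\<close> in \<open>cob c n\<close> vanishes only for \<open>c = 2 - n\<close>, and then that of
  \<open>\<lambda>\<^sup>2\<partial>\<^bsup>n-1\<^esup>\<close> is \<open>n(3 - n)/2\<close>.\<close>

lemma cob_nonzero:
  assumes "4 \<le> n" "\<And>l x. z * cob c n l x = 0"
  shows "z = 0"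
proof (rule ccontr)
  assume z: "z \<noteq> 0"
  define p where "p = cob_poly c n"
  have p: "\<And>l. poly p l = cob c n l 1" "coeff p 1 = of_nat n + c - 2"
    "coeff p 2 = of_nat (n choose 2) + c * of_nat n"
    using coeff_cob_poly[of n c] assms(1) by (simp_all add: p_def poly_cob_poly)
  have "p = 0" using assms(2)[of _ 1] z by (intro poly_eq_by_values) (simp add: p(1))
  with p(2) have "of_nat n + c - 2 = 0" by simp
  moreover from p(3) \<open>p = 0\<close> have "of_nat (n choose 2) + c * of_nat n = 0" by simp
  ultimately have "of_nat n * (3 - of_nat n) = (0::complex)" using choose_numeral(1)[of n] by algebra
  moreover have "(of_nat n :: complex) \<noteq> of_nat 3" using assms(1) unfolding of_nat_eq_iff by simp
  ultimately show False using assms(1) by auto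
qed

text \<open>The coefficient of \<open>\<mu>\<^sup>2\<close>, which expresses invariance under the Virasoro mode \<open>L\<^sub>1\<close>. The factor \<open>i - 2\<close> leaves
  \<open>a 3\<close> free and determines all later coefficients.\<close>

lemma resonant_recursion:
  assumes F: "F = homog_fun N a" and sk: "skew_fun F" and co: "cocycle c F"
    and c: "c = 3 - of_nat N" and a: "a 0 = 0" "a 1 = 0" "a 2 = 0" and N: "2 \<le> N" and i: "1 \<le> i" "i < N"
  shows "a (Suc i) * ((of_nat i + 1) * (of_nat i - 2)) = a i * ((of_nat N - of_nat i) * (of_nat N + of_nat i - 5))"
proof -
  define f where "f k = a k * (of_nat (N - k choose 2) + c * of_nat (N - k))" for k
  define g where "g k = a k * (of_nat (k choose 2) - of_nat k)" for k
  have z: "a k = 0" if "k < Suc 1" for k using that a by (cases k) auto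
  have "(\<Sum>k\<le>N. monom (f k) k) + (\<Sum>k\<le>N. monom (g k) (k - 1)) = 0"
  proof (rule poly_eq_by_values)
    fix l
    have "0 = (\<Sum>k\<le>N. a k * l ^ k * (of_nat (N - k choose 2) + c * of_nat (N - k)))
      + (\<Sum>k\<le>N. a k * (of_nat (k choose 2) * (l ^ (k - 2) * l) - of_nat k * l ^ (k - 1)))"
      using cocycle_coeff_Suc[where i=1 and l=l and x=1, OF F sk co z] N a by (simp add: numeral_2_eq_2)
    also have "(\<Sum>k\<le>N. a k * (of_nat (k choose 2) * (l ^ (k - 2) * l) - of_nat k * l ^ (k - 1))) = (\<Sum>k\<le>N. g k * l ^ (k - 1))"
    proof -
      have "of_nat (k choose 2) * (l ^ (k - 2) * l) = of_nat (k choose 2) * l ^ (k - 1)" for k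
        using choose_mult_power[of k 1 l] by (simp add: numeral_2_eq_2)
      then show ?thesis unfolding g_def by (simp only: right_diff_distrib left_diff_distrib mult.assoc)
    qed
    finally show "poly ((\<Sum>k\<le>N. monom (f k) k) + (\<Sum>k\<le>N. monom (g k) (k - 1))) l = poly 0 l"
      by (simp add: poly_sum poly_monom f_def algebra_simps)
  qed
  then have "coeff ((\<Sum>k\<le>N. monom (f k) k) + (\<Sum>k\<le>N. monom (g k) (k - 1))) i = 0" by simp
  moreover have "coeff (\<Sum>k\<le>N. monom (f k) k) i = f i"
    using i by (simp add: coeff_sum sum.delta' cong: if_cong)
  moreover have "coeff (\<Sum>k\<le>N. monom (g k) (k - 1)) i = (\<Sum>k\<le>N. if k = Suc i then g k else 0)"
    unfolding coeff_sum coeff_monom using i by (intro sum.cong) auto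
  ultimately have "f i + g (Suc i) = 0" using i by simp
  moreover have "of_nat (N - i) = (of_nat N - of_nat i :: complex)" using i by (simp add: of_nat_diff)
  ultimately have "a i * (of_nat (N - i choose 2) + c * of_nat (N - i)) + a (Suc i) * (of_nat (Suc i choose 2) - of_nat (Suc i)) = 0"
    and "2 * of_nat (N - i choose 2) = ((of_nat N - of_nat i) * (of_nat N - of_nat i - 1) :: complex)"
    and "2 * of_nat (Suc i choose 2) = ((of_nat i + 1) * of_nat i :: complex)"
    and "of_nat (N - i) = (of_nat N - of_nat i :: complex)" and "of_nat (Suc i) = (of_nat i + 1 :: complex)"
    using choose_numeral(1)[of "N - i"] choose_numeral(1)[of "Suc i"] by (simp_all add: f_def g_def)
  then show ?thesis using c by algebra
qed

text \<open>The coefficient of \<open>\<mu>\<^sup>3\<lambda>\<^sup>4\<close>, combined with the recursion, is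
  \<open>a\<^sub>3 (N-2)(N-3)(N-4)\<^sup>2(N-5)(N-9)\<close> up to a constant. The bound \<open>8 \<le> N\<close> keeps \<open>(-\<lambda>)\<^bsup>N-3\<^esup>\<close> out of the \<open>\<lambda>\<^sup>4\<close>-term.\<close>

lemma resonant_vanishing:
  assumes F: "F = homog_fun N a" and sk: "skew_fun F" and co: "cocycle c F"
    and c: "c = 3 - of_nat N" and a: "a 0 = 0" "a 1 = 0" "a 2 = 0" and N: "8 \<le> N" "N \<noteq> 9"
  shows "a 3 = 0"
proof -
  define p where "p = cob_poly c (N - 3)"
  have p: "\<And>l. poly p l = cob c (N - 3) l 1"
    and p4: "coeff p 4 = of_nat (N - 3 choose 4) + c * of_nat (N - 3 choose 3)"
    using coeff_cob_poly(3)[of "N - 3" c] N by (simp_all add: p_def poly_cob_poly)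
  define f where "f k = a k * (of_nat (N - k choose 3) + c * of_nat (N - k choose 2))" for k
  define g where "g k = a k * (of_nat (k choose 3) - of_nat (k choose 2))" for k
  have z: "a k = 0" if "k < Suc 2" for k using that a by (auto simp: less_Suc_eq numeral_2_eq_2)
  have "smult (a 3) p = (\<Sum>k\<le>N. monom (f k) k) + (\<Sum>k\<le>N. monom (g k) (k - 2))"
  proof (rule poly_eq_by_values)
    fix l
    have "a 3 * cob c (N - 3) l 1 = (\<Sum>k\<le>N. a k * l ^ k * (of_nat (N - k choose 3) + c * of_nat (N - k choose 2)))
      + (\<Sum>k\<le>N. a k * (of_nat (k choose 3) * (l ^ (k - 3) * l) - of_nat (k choose 2) * l ^ (k - 2)))"
      using cocycle_coeff_Suc[where i=2 and l=l and x=1, OF F sk co z] N a by (simp add: numeral_3_eq_3)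
    also have "(\<Sum>k\<le>N. a k * (of_nat (k choose 3) * (l ^ (k - 3) * l) - of_nat (k choose 2) * l ^ (k - 2))) = (\<Sum>k\<le>N. g k * l ^ (k - 2))"
    proof -
      have "of_nat (k choose 3) * (l ^ (k - 3) * l) = of_nat (k choose 3) * l ^ (k - 2)" for k
        using choose_mult_power[of k 2 l] by (simp add: numeral_3_eq_3)
      then show ?thesis unfolding g_def by (simp only: right_diff_distrib left_diff_distrib mult.assoc)
    qed
    finally show "poly (smult (a 3) p) l = poly ((\<Sum>k\<le>N. monom (f k) k) + (\<Sum>k\<le>N. monom (g k) (k - 2))) l"
      by (simp add: poly_sum poly_monom f_def p algebra_simps)
  qed
  then have "a 3 * coeff p 4 = coeff ((\<Sum>k\<le>N. monom (f k) k) + (\<Sum>k\<le>N. monom (g k) (k - 2))) 4"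
    by (metis coeff_smult)
  moreover have "coeff (\<Sum>k\<le>N. monom (f k) k) 4 = f 4"
    using N by (simp add: coeff_sum sum.delta' cong: if_cong)
  moreover have "coeff (\<Sum>k\<le>N. monom (g k) (k - 2)) 4 = (\<Sum>k\<le>N. if k = 6 then g k else 0)"
    unfolding coeff_sum coeff_monom by (intro sum.cong) auto
  ultimately have E: "a 3 * coeff p 4 = f 4 + g 6" using N by simp
  define n :: complex where "n = of_nat N"
  have d: "of_nat (N - 3) = n - 3" "of_nat (N - 4) = n - 4" using N by (simp_all add: n_def of_nat_diff)
  note rec = resonant_recursion[OF F sk co c a]
  have r: "a 4 * 4 = a 3 * ((n - 3) * (n - 2))" "a 5 * 10 = a 4 * ((n - 4) * (n - 1))"
    "a 6 * 18 = a 5 * ((n - 5) * n)"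
    using rec[of 3] rec[of 4] rec[of 5] N by (simp_all add: n_def)
  have g6: "g 6 = 5 * a 6" by (simp add: g_def numeral_eq_Suc)
  have "a 3 * ((n - 2) * (n - 3) * (n - 4) * (n - 5) * ((n - 4) * (n - 9))) = 0"
    using E[unfolded g6 f_def p4 c, folded n_def] r choose_numeral[of "N - 3", unfolded d]
      choose_numeral[of "N - 4", unfolded d] by algebra
  moreover have "n \<noteq> of_nat k" if "k < 8 \<or> k = 9" for k using that N unfolding n_def of_nat_eq_iff by auto
  from this[of 2] this[of 3] this[of 4] this[of 5] this[of 9]
  have "n \<noteq> 2" "n \<noteq> 3" "n \<noteq> 4" "n \<noteq> 5" "n \<noteq> 9" by simp_all
  ultimately show "a 3 = 0" by simp
qed

text \<open>By the recursion a resonant cocycle divisible by \<open>\<lambda>\<^sup>3\<close> is determined by \<open>a 3\<close>. The solutions in degrees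
  \<open>7\<close> and \<open>9\<close> are the normal forms; those in degrees \<open>5\<close> and \<open>6\<close> are not skew-symmetric.\<close>

lemma resonant_classification:
  assumes "is_homog N F" and sk: "skew_fun F" and co: "cocycle c F"
    and c: "c = 3 - of_nat N" and N: "5 \<le> N"
    and low: "\<And>a. F = homog_fun N a \<Longrightarrow> a 0 = 0 \<and> a 1 = 0 \<and> a 2 = 0"
  shows "\<exists>\<beta>. \<forall>l x. F l x = \<beta> * nf c N l x"
proof -
  obtain a where F: "F = homog_fun N a" using assms(1) by (auto simp: is_homog_def)
  with low have a: "a 0 = 0" "a 1 = 0" "a 2 = 0" by auto
  have rec: "a (Suc i) * ((of_nat i + 1) * (of_nat i - 2)) = a i * ((of_nat N - of_nat i) * (of_nat N + of_nat i - 5))"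
    if "1 \<le> i" "i < N" for i using resonant_recursion[OF F sk co c a _ that] N by simp
  have zero: "F l x = 0" if "a 3 = 0" for l x
  proof -
    have "a k = 0" if "k \<le> N" for k
      using that
    proof (induction k)
      case (Suc k)
      show ?case
      proof (cases "k \<le> 2")
        case True
        then have "k = 0 \<or> k = 1 \<or> k = 2" by auto
        with a \<open>a 3 = 0\<close> show ?thesis by (auto simp: numeral_3_eq_3 numeral_2_eq_2)
      next
        case False
        then have "(of_nat k :: complex) \<noteq> of_nat 2" unfolding of_nat_eq_iff by simp
        moreover have "(of_nat k :: complex) + 1 \<noteq> 0" by (metis of_nat_Suc of_nat_eq_0_iff add.commute nat.simps(3))
        ultimately show ?thesis using rec[of k] Suc False by auto
      qed
    qed (simp add: a)
    then show ?thesis by (simp add: F homog_fun_def)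
  qed
  have *: ?thesis if "a 3 = 0" using zero[OF that] by (intro exI[of _ 0]) simp
  have e: "Suc 3 = 4" "Suc 4 = 5" "Suc 5 = 6" "Suc 6 = 7" "Suc 7 = 8" "Suc 8 = 9" by simp_all
  note r = rec[of 3, unfolded e] rec[of 4, unfolded e] rec[of 5, unfolded e] rec[of 6, unfolded e]
    rec[of 7, unfolded e] rec[of 8, unfolded e]
  have S: "F l x = (\<Sum>i<Suc N. a i * l ^ i * x ^ (N - i))" for l x
    by (simp add: F homog_fun_def lessThan_Suc_atMost)
  have I: "{..<Suc 5} = {0, 1, 2, 3, 4, 5}" "{..<Suc 6} = {0, 1, 2, 3, 4, 5, 6}"
    "{..<Suc 7} = {0, 1, 2, 3, 4, 5, 6, 7}" "{..<Suc 9} = {0, 1, 2, 3, 4, 5, 6, 7, 8, 9}" by auto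
  consider "N = 5" | "N = 6" | "N = 7" | "N = 9" | "8 \<le> N" "N \<noteq> 9" using N by linarith
  then show ?thesis
  proof cases
    case 1
    have S5: "F l x = a 3 * l ^ 3 * x ^ 2 + a 4 * l ^ 4 * x + a 5 * l ^ 5" for l x
      using a unfolding S 1 I by simp
    have "F 0 1 = - F (-1) 1" using sk unfolding skew_fun_def by (metis diff_0 minus_zero)
    then have "a 3 - a 4 + a 5 = 0" unfolding S5 by (simp add: algebra_simps)
    moreover have "a 4 * 4 = a 3 * 6" "a 5 * 10 = a 4 * 4" using r(1,2) 1 by simp_all
    ultimately have "a 3 = 0" by algebra
    with * show ?thesis .
  next
    case 2
    have S6: "F l x = a 3 * l ^ 3 * x ^ 3 + a 4 * l ^ 4 * x ^ 2 + a 5 * l ^ 5 * x + a 6 * l ^ 6" for l x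
      using a unfolding S 2 I by simp
    have "F 1 1 = - F (- 1 - 1) 1" using sk unfolding skew_fun_def by blast
    then have "a 3 + a 4 + a 5 + a 6 = 8 * a 3 - 16 * a 4 + 32 * a 5 - 64 * a 6" unfolding S6 by simp
    moreover have "a 4 * 4 = a 3 * 12" "a 5 * 10 = a 4 * 10" "a 6 * 18 = a 5 * 6" using r(1,2,3) 2 by simp_all
    ultimately have "a 3 = 0" by algebra
    with * show ?thesis .
  next
    case 3
    have "a 4 * 4 = a 3 * 20" "a 5 * 10 = a 4 * 18" "a 6 * 18 = a 5 * 14" "a 7 * 28 = a 6 * 8" using r(1,2,3,4) 3 by simp_all
    then have k: "a 4 = 5 * a 3" "a 5 = 9 * a 3" "a 6 = 7 * a 3" "a 7 = 2 * a 3" by algebra+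
    have F7: "F l x = a 3 * l ^ 3 * x ^ 4 + a 4 * l ^ 4 * x ^ 3 + a 5 * l ^ 5 * x ^ 2 + a 6 * l ^ 6 * x + a 7 * l ^ 7" for l x
      using a unfolding S 3 I by simp
    have "F l x = a 3 * ((2 * l + x) * (l ^ 2 + l * x) ^ 3)" for l x
      unfolding F7 k by algebra
    then show ?thesis unfolding nf_def c 3 by (intro exI[of _ "a 3"]) simp
  next
    case 4
    have "a 4 * 4 = a 3 * 42" "a 5 * 10 = a 4 * 40" "a 6 * 18 = a 5 * 36" "a 7 * 28 = a 6 * 30" "a 8 * 40 = a 7 * 22" "a 9 * 54 = a 8 * 12"
      using r 4 by simp_all
    then have k: "a 4 * 2 = 21 * a 3" "a 5 = 42 * a 3" "a 6 = 84 * a 3" "a 7 = 90 * a 3" "a 8 * 2 = 99 * a 3" "a 9 = 11 * a 3" by algebra+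
    define \<beta> where "\<beta> = a 3 / 2"
    have k: "a 3 = 2 * \<beta>" "a 4 = 21 * \<beta>" "a 5 = 84 * \<beta>" "a 6 = 168 * \<beta>" "a 7 = 180 * \<beta>" "a 8 = 99 * \<beta>"
      "a 9 = 22 * \<beta>" using k by (simp_all add: \<beta>_def field_simps)
    have F9: "F l x = a 3 * l ^ 3 * x ^ 6 + a 4 * l ^ 4 * x ^ 5 + a 5 * l ^ 5 * x ^ 4 + a 6 * l ^ 6 * x ^ 3
        + a 7 * l ^ 7 * x ^ 2 + a 8 * l ^ 8 * x + a 9 * l ^ 9" for l x
      using a unfolding S 4 I by simp
    have "F l x = \<beta> * ((2 * l + x) * (11 * (l ^ 2 + l * x) ^ 4 + 2 * (l ^ 2 + l * x) ^ 3 * x ^ 2))" for l x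
      unfolding F9 k by algebra
    then show ?thesis unfolding nf_def c 4 by (intro exI[of _ \<beta>]) simp
  next
    case 5
    with * resonant_vanishing[OF F sk co c a] show ?thesis by blast
  qed
qed

text \<open>The second cohomology in one degree. Degrees up to \<open>4\<close> are treated separately, because there the generic
  coefficient comparisons collide with the boundary terms \<open>(-\<lambda>)\<^sup>n\<close>.\<close>

lemma homogeneous_classification:
  assumes hom: "is_homog N F" and sk: "skew_fun F" and co: "cocycle c F"
  shows "\<exists>z \<beta>. \<forall>l x. F l x = z * cob c (N - 1) l x + \<beta> * nf c N l x"
proof -
  obtain a where F: "F = homog_fun N a" using hom by (auto simp: is_homog_def)
  have S: "F l x = (\<Sum>i<Suc N. a i * l ^ i * x ^ (N - i))" for l x
    by (simp add: F homog_fun_def lessThan_Suc_atMost)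
  note c0 = cocycle_coeff_0[OF F sk co]
  note c1 = cocycle_coeff_1[OF F sk co]
  note sk' = sk[unfolded skew_fun_def, rule_format]
  have nonres: ?thesis if "a 0 = 0" "1 \<le> N" "c \<noteq> 3 - of_nat N"
  proof -
    have "of_nat N + c - 3 \<noteq> 0" using that(3) by (simp add: algebra_simps eq_diff_eq)
    then have "F l x = a 1 / (of_nat N + c - 3) * cob c (N - 1) l x + 0 * nf c N l x" for l x
      using c1[OF that(1,2), of l x] by (simp add: field_simps)
    then show ?thesis by blast
  qed
  have I: "{..<Suc 2} = {0, 1, 2}" "{..<Suc 3} = {0, 1, 2, 3}" "{..<Suc 4} = {0, 1, 2, 3, 4}" by auto
  consider "N = 0" | "N = 1" | "N = 2" | "N = 3" | "N = 4" | "5 \<le> N" by linarith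
  then show ?thesis
  proof cases
    case 1
    have "a 0 = 0" using sk'[of 0 0] unfolding S 1 by simp
    then show ?thesis by (intro exI[of _ 0]) (simp add: S 1)
  next
    case 2
    have F1: "F l x = a 0 * x + a 1 * l" for l x unfolding S 2 by simp
    have "a 0 = - (a 0 - a 1)" using sk'[of 0 1] unfolding F1 by simp
    then have a1: "a 1 = 2 * a 0" by algebra
    have F1: "F l x = a 0 * (2 * l + x)" for l x unfolding F1 a1 by algebra
    show ?thesis
    proof (cases "c = 1")
      case True
      show ?thesis by (intro exI[of _ 0] exI[of _ "a 0"]) (simp add: F1 nf_def True 2)
    next
      case False
      have "cob c (N - 1) l x = (c - 1) * (2 * l + x)" for l x by (simp add: 2 cob_def algebra_simps)
      with False show ?thesis by (intro exI[of _ "a 0 / (c - 1)"] exI[of _ 0]) (simp add: F1)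
    qed
  next
    case 3
    have F2: "F l x = a 0 * x ^ 2 + a 1 * l * x + a 2 * l ^ 2" for l x unfolding S 3 I by simp
    have "a 2 = - a 2" "a 0 = - (a 0 - a 1 + a 2)" using sk'[of 1 0] sk'[of 0 1] unfolding F2 by simp_all
    then have b: "a 1 = 2 * a 0" "a 2 = 0" by algebra+
    have "a 0 * (6 * c) = 0" using c0[of 1 1] unfolding 3 cob_def by (simp add: algebra_simps)
    then have "a 0 = 0 \<or> c = 0" by simp
    then show ?thesis
    proof
      assume "a 0 = 0"
      with b show ?thesis by (intro exI[of _ 0]) (simp add: F2)
    next
      assume "c = 0"
      with b show ?thesis by (intro exI[of _ 0] exI[of _ "a 0"]) (simp add: F2 nf_def 3 algebra_simps power2_eq_square)
    qed
  next
    case 4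
    have F3: "F l x = a 0 * x ^ 3 + a 1 * l * x ^ 2 + a 2 * l ^ 2 * x + a 3 * l ^ 3" for l x unfolding S 4 I by simp
    have "a 0 + a 1 + a 2 + a 3 = - (a 0 - 2 * a 1 + 4 * a 2 - 8 * a 3)" "a 0 = - (a 0 - a 1 + a 2 - a 3)"
      using sk'[of 1 1] sk'[of 0 1] unfolding F3 by (simp_all add: algebra_simps)
    then have b: "a 2 * 2 = 3 * a 3" "a 1 * 2 = a 3 + 4 * a 0" by algebra+
    define \<alpha> where "\<alpha> = a 3 / 2"
    have "a 3 = 2 * \<alpha>" by (simp add: \<alpha>_def)
    with b have F3: "F l x = (2 * l + x) * (\<alpha> * (l ^ 2 + l * x) + a 0 * x ^ 2)" for l x unfolding F3 by algebra
    have cob2: "cob c 2 l x = c * (2 * l + x) * (l ^ 2 + l * x)" for l x unfolding cob_def by algebra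
    have "a 0 * (6 * (c + 1)) = 0" using c0[of 1 1] unfolding 4 cob_def by (simp add: algebra_simps)
    then have "a 0 = 0 \<or> c + 1 = 0" by (metis mult_eq_0_iff zero_neq_numeral)
    then have "a 0 = 0 \<or> c = -1" by (simp only: eq_neg_iff_add_eq_0)
    then show ?thesis
    proof
      assume a0: "a 0 = 0"
      show ?thesis
      proof (cases "c = 0")
        case True
        then show ?thesis using a0 by (intro exI[of _ 0] exI[of _ \<alpha>]) (simp add: F3 4 nf_def)
      next
        case False
        then show ?thesis using a0 by (intro exI[of _ "\<alpha> / c"] exI[of _ 0]) (simp add: F3 4 cob2)
      qed
    next
      assume c: "c = -1"
      have nf3: "nf c N l x = (2 * l + x) * x ^ 2" and cob3: "cob c (N - 1) l x = c * (2 * l + x) * (l ^ 2 + l * x)" for l x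
        using cob2[of l x] by (simp_all add: nf_def c 4)
      have "F l x = - \<alpha> * cob c (N - 1) l x + a 0 * nf c N l x" for l x
        unfolding F3 nf3 cob3 using c by (simp add: algebra_simps power2_eq_square)
      then show ?thesis by blast
    qed
  next
    case 5
    have a0: "a 0 = 0" by (rule cob_nonzero[of N]) (use c0 5 in auto)
    show ?thesis
    proof (cases "c = -1")
      case c: True
      have F4: "F l x = a 1 * l * x ^ 3 + a 2 * l ^ 2 * x ^ 2 + a 3 * l ^ 3 * x + a 4 * l ^ 4" for l x
        using a0 unfolding S 5 I by simp
      have "a 4 = - a 4" "a 1 + a 2 + a 3 + a 4 = - (- 2 * a 1 + 4 * a 2 - 8 * a 3 + 16 * a 4)" "0 = - (- a 1 + a 2 - a 3 + a 4)"
        using sk'[of 1 0] sk'[of 1 1] sk'[of 0 1] unfolding F4 by (simp_all add: algebra_simps)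
      then have b: "a 2 = 3 * a 1" "a 3 = 2 * a 1" "a 4 = 0" by algebra+
      have "F l x = a 1 * ((2 * l + x) * ((l ^ 2 + l * x) * x))" for l x using b unfolding F4 by algebra
      then show ?thesis by (intro exI[of _ 0] exI[of _ "a 1"]) (simp add: nf_def c 5)
    next
      case False
      then show ?thesis using nonres a0 5 by simp
    qed
  next
    case 6
    have a0: "a 0 = 0" by (rule cob_nonzero[of N]) (use c0 6 in auto)
    show ?thesis
    proof (cases "c = 3 - of_nat N")
      case False
      then show ?thesis using nonres a0 6 by simp
    next
      case c: True
      define p where "p = cob_poly c (N - 1)"
      have p: "\<And>l. poly p l = cob c (N - 1) l 1" and cp: "coeff p 2 = of_nat (N - 1 choose 2) + c * of_nat (N - 1)"
        using coeff_cob_poly[of "N - 1" c] 6 by (simp_all add: p_def poly_cob_poly)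
      have "of_nat (N - 1) = (of_nat N - 1 :: complex)" using 6 by (simp add: of_nat_diff)
      with cp choose_numeral(1)[of "N - 1"] have "coeff p 2 * 2 = (of_nat N - 1) * (4 - of_nat N)" using c by algebra
      moreover have "(of_nat N :: complex) \<noteq> of_nat 1" "(of_nat N :: complex) \<noteq> of_nat 4"
        using 6 unfolding of_nat_eq_iff by auto
      ultimately have p2: "coeff p 2 \<noteq> 0" by auto
      \<comment> \<open>In the resonant degree the coboundary has no \<open>\<lambda>\<close>-term but a \<open>\<lambda>\<^sup>2\<close>-term, which is used to make the
        \<open>\<lambda>\<^sup>2\<close>-coefficient of \<open>F\<close> vanish.\<close>
      define z where "z = a 2 / coeff p 2"
      define G where "G l x = F l x - z * cob c (N - 1) l x" for l x
      have "is_homog N (cob c (N - 1))" using is_homog_cob[of "N - 1" c] 6 by simp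
      then have hG: "is_homog N G" unfolding G_def by (intro is_homog_diff hom is_homog_scale)
      have skG: "skew_fun G" unfolding G_def by (intro skew_fun_diff sk skew_cob)
      have coG: "cocycle c G" unfolding G_def by (intro cocycle_diff co cocycle_cob)
      have "b 0 = 0 \<and> b 1 = 0 \<and> b 2 = 0" if b: "G = homog_fun N b" for b
      proof -
        have b0: "b 0 = 0" by (rule cob_nonzero[of N]) (use cocycle_coeff_0[OF b skG coG] 6 in auto)
        have "\<And>l x. b 1 * cob c (N - 1) l x = 0"
          using cocycle_coeff_1[OF b skG coG b0] 6 c by simp
        from cob_nonzero[OF _ this] have b1: "b 1 = 0" using 6 by simp
        have "(\<Sum>i\<le>N. monom (b i) i) = (\<Sum>i\<le>N. monom (a i) i) - smult z p"
        proof (rule poly_eq_by_values)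
          fix l
          have "homog_fun N b l 1 = G l 1" by (simp add: b)
          then show "poly (\<Sum>i\<le>N. monom (b i) i) l = poly ((\<Sum>i\<le>N. monom (a i) i) - smult z p) l"
            by (simp add: G_def F homog_fun_def p poly_sum poly_monom)
        qed
        from arg_cong[OF this, of "\<lambda>q. coeff q 2"] have "b 2 = a 2 - z * coeff p 2"
          using 6 by (simp add: coeff_sum sum.delta' cong: if_cong)
        then have "b 2 = 0" using p2 by (simp add: z_def)
        with b0 b1 show ?thesis by simp
      qed
      from resonant_classification[OF hG skG coG c 6 this]
      obtain \<beta> where "\<forall>l x. G l x = \<beta> * nf c N l x" by blast
      then have "\<forall>l x. F l x = z * cob c (N - 1) l x + \<beta> * nf c N l x" by (simp add: G_def algebra_simps)
      then show ?thesis by blast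
    qed
  qed
qed

section \<open>Cocycles of the Virasoro Lie conformal algebra\<close>

text \<open>Polynomials in \<open>\<lambda>\<close> and \<open>\<partial>\<close> are determined by their values; all polynomial identities below are proved
  pointwise.\<close>

lemma ev2_eqI:
  assumes "\<And>l d. ev2 P l d = ev2 Q l d" shows "P = Q"
proof (rule ccontr)
  assume "P \<noteq> Q"
  then have "finite {q. poly (P - Q) q = 0}" by (intro poly_roots_finite) simp
  moreover have "range (\<lambda>l. [:l:]) \<subseteq> {q. poly (P - Q) q = 0}"
  proof safe
    fix l
    have "poly (P - Q) [:l:] = 0"
      by (rule poly_eq_by_values) (use assms in \<open>simp add: ev2_def\<close>)
    then show "poly (P - Q) [:l:] = 0" .
  qed
  moreover have "infinite (range (\<lambda>l. [:l:] :: complex poly))"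
    using finite_imageD[of "\<lambda>l::complex. [:l:]" UNIV] infinite_UNIV_char_0[where 'a=complex] by (auto simp: inj_on_def)
  ultimately show False using finite_subset by blast
qed

lemma ev2_0_left: "ev2 Q 0 x = poly (coeff Q 0) x"
  by (simp add: ev2_def poly_0_coeff_0)

lemma skew_sym_iff: "skew_sym Q \<longleftrightarrow> skew_fun (ev2 Q)"
proof
  assume A: "skew_fun (ev2 Q)"
  have "Q = - pcompose Q (- lam - del)"
  proof (rule ev2_eqI)
    fix l d
    show "ev2 Q l d = ev2 (- pcompose Q (- lam - del)) l d"
      unfolding ev2_simps using A unfolding skew_fun_def by blast
  qed
  then show "skew_sym Q" unfolding skew_sym_def .
next
  assume "skew_sym Q"
  then show "skew_fun (ev2 Q)" unfolding skew_fun_def using skew_sym_ev2 by blast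
qed

text \<open>The restriction of \<open>Q\<close> to the line \<open>t \<mapsto> (t l, t x)\<close>, as a polynomial in \<open>t\<close>: its \<open>N\<close>-th coefficient is the
  homogeneous component of degree \<open>N\<close> of \<open>Q\<close> at \<open>(l, x)\<close>.\<close>

definition on_line :: "complex poly poly \<Rightarrow> complex \<Rightarrow> complex \<Rightarrow> complex poly" where
  "on_line Q l x = poly (map_poly (\<lambda>p. pcompose p [:0, x:]) Q) [:0, l:]"

lemma on_line_pCons: "on_line (pCons p Q) l x = pcompose p [:0, x:] + [:0, l:] * on_line Q l x"
  by (cases "p = 0 \<and> Q = 0") (auto simp: on_line_def map_poly_pCons)

lemma poly_on_line: "poly (on_line Q l x) t = ev2 Q (t * l) (t * x)"
proof (induction Q)
  case 0 then show ?case by (simp add: on_line_def ev2_def)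
next
  case (pCons p Q) then show ?case by (simp add: on_line_pCons ev2_def poly_pcompose)
qed

lemma coeff_on_line: "coeff (on_line Q l x) N = homog_fun N (\<lambda>i. coeff (coeff Q i) (N - i)) l x"
proof (induction Q arbitrary: N)
  case 0 then show ?case by (simp add: on_line_def homog_fun_def)
next
  case (pCons p Q)
  have "coeff (pcompose p [:0, x:]) N = coeff p N * x ^ N"
    by (simp add: coeff_pcompose_linear)
  moreover have "coeff ([:0, l:] * on_line Q l x) N = (case N of 0 \<Rightarrow> 0 | Suc N \<Rightarrow> l * coeff (on_line Q l x) N)"
    by (simp add: mult_pCons_left coeff_pCons split: nat.splits)
  ultimately show ?case
    by (cases N) (simp_all add: on_line_pCons pCons homog_fun_def sum.atMost_Suc_shift sum_distrib_left mult_ac del: sum.atMost_Suc)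
qed

lemma on_line_degree_bounded: "\<exists>K. \<forall>l x. degree (on_line Q l x) \<le> K"
proof (induction Q)
  case 0 then show ?case by (simp add: on_line_def)
next
  case (pCons p Q)
  then obtain K where K: "\<And>l x. degree (on_line Q l x) \<le> K" by blast
  have "degree (on_line (pCons p Q) l x) \<le> max (degree p) (Suc K)" for l x
    unfolding on_line_pCons
  proof (rule degree_add_le)
    have "degree (pcompose p [:0, x:]) \<le> degree p * degree [:0, x:]" by (rule degree_pcompose_le)
    also have "\<dots> \<le> degree p" by simp
    finally show "degree (pcompose p [:0, x:]) \<le> max (degree p) (Suc K)" by simp
    have "degree ([:0, l:] * on_line Q l x) \<le> degree [:0, l:] + degree (on_line Q l x)" by (rule degree_mult_le)
    also have "\<dots> \<le> 1 + K" by (rule add_mono) (simp_all add: K)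
    finally show "degree ([:0, l:] * on_line Q l x) \<le> max (degree p) (Suc K)" by simp
  qed
  then show ?case by blast
qed

lemma is_homog_component: "is_homog N (\<lambda>l x. coeff (on_line Q l x) N)"
  unfolding is_homog_def coeff_on_line by (intro exI[of _ "\<lambda>i. coeff (coeff Q i) (N - i)"] refl)

lemma skew_component: "skew_fun (ev2 Q) \<Longrightarrow> skew_fun (\<lambda>l x. coeff (on_line Q l x) N)"
  unfolding skew_fun_def
proof (intro allI)
  fix l x
  assume A: "\<forall>l x. ev2 Q l x = - ev2 Q (- l - x) x"
  have "on_line Q l x = - on_line Q (- l - x) x"
  proof (intro poly_eq_by_values)
    fix t
    have "t * (- l - x) = - (t * l) - t * x" by (simp add: algebra_simps)
    then show "poly (on_line Q l x) t = poly (- on_line Q (- l - x) x) t"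
      using A[rule_format, of "t * l" "t * x"] by (simp add: poly_on_line)
  qed
  then show "coeff (on_line Q l x) N = - coeff (on_line Q (- l - x) x) N" by simp
qed

text \<open>The cocycle identity at \<open>(t l, t m, t x)\<close> is a polynomial identity in \<open>t\<close>; every term carries one linear
  factor, hence the coefficient of \<open>t\<^bsup>N+1\<^esup>\<close> is the identity for the component of degree \<open>N\<close>.\<close>

lemma cocycle_component:
  assumes "cocycle c (ev2 Q)" shows "cocycle c (\<lambda>l x. coeff (on_line Q l x) N)"
  unfolding cocycle_def
proof (intro allI)
  fix l m x
  have "on_line Q m (l + x) * [:0, c * l + x:] + [:0, 2 * m + l + x:] * on_line Q l x
      - on_line Q l (m + x) * [:0, c * m + x:] - [:0, 2 * l + m + x:] * on_line Q m x
     = - on_line Q l (- l - m) * [:0, c * (- l - m - x) + x:] + [:0, l - m:] * on_line Q (l + m) x" (is "?L = ?R")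
  proof (rule poly_eq_by_values)
    fix t
    show "poly ?L t = poly ?R t"
      using assms[unfolded cocycle_def, rule_format, of "t * m" "t * l" "t * x"]
      by (simp add: poly_on_line algebra_simps)
  qed
  from arg_cong[OF this, of "\<lambda>p. coeff p (Suc N)"]
  show "coeff (on_line Q m (l + x)) N * (c * l + x) + (2 * m + l + x) * coeff (on_line Q l x) N
      - coeff (on_line Q l (m + x)) N * (c * m + x) - (2 * l + m + x) * coeff (on_line Q m x) N
     = - coeff (on_line Q l (- l - m)) N * (c * (- l - m - x) + x) + (l - m) * coeff (on_line Q (l + m) x) N"
    by (simp add: mult_pCons_left mult_pCons_right mult_ac)
qed

text \<open>The change of \<open>Q\<close> when \<open>B\<close> is replaced by \<open>B + g(\<partial>)A\<close>; see \<open>rank2_iso_triangular\<close>.\<close>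

definition coboundary :: "complex poly poly \<Rightarrow> complex poly poly \<Rightarrow> complex poly \<Rightarrow> complex poly poly" where
  "coboundary M V g = at2 g (lam + del) * M - at2 g (- lam) * pcompose M (- lam - del) - at2 g del * V"

lemma ev2_coboundary:
  "ev2 (coboundary M V g) l x = poly g (l + x) * ev2 M l x - poly g (- l) * ev2 M (- l - x) x - poly g x * ev2 V l x"
  by (simp add: coboundary_def ev2_simps ev2_at2)

abbreviation (input) vir_weight :: "complex \<Rightarrow> complex \<Rightarrow> complex poly poly" where
  "vir_weight c d \<equiv> const2 c * lam + const2 d + del"

lemma ev2_coboundary_homogeneous:
  "ev2 (coboundary (vir_weight c 0) (2 * lam + del) (\<Sum>N\<in>A. monom (z N) (k N))) l x = (\<Sum>N\<in>A. z N * cob c (k N) l x)"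
  unfolding ev2_coboundary sum_distrib_right poly_sum poly_monom sum_subtractf[symmetric]
  by (intro sum.cong refl) (simp add: ev2_simps cob_def algebra_simps)

lemma skew_nf: "nf c N l x = - nf c N (- l - x) x"
proof -
  have "2 * (- l - x) + x = - (2 * l + x)" "(- l - x) ^ 2 + (- l - x) * x = l ^ 2 + l * x" by algebra+
  then show ?thesis unfolding nf_def by (simp only: mult_minus_left minus_minus)
qed

lemma nf_cases:
  "(\<forall>l x. nf c N l x = 0) \<or> c = 1 \<and> N = 1 \<or> c = 0 \<and> N = 2 \<or> c = 0 \<and> N = 3 \<or> c = -1 \<and> N = 3
    \<or> c = -1 \<and> N = 4 \<or> c = -4 \<and> N = 7 \<or> c = -6 \<and> N = 9"
proof -
  have "nf c N l x = 0" if "\<not> (c = 1 \<and> N = 1 \<or> c = 0 \<and> N = 2 \<or> c = 0 \<and> N = 3 \<or> c = -1 \<and> N = 3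
    \<or> c = -1 \<and> N = 4 \<or> c = -4 \<and> N = 7 \<or> c = -6 \<and> N = 9)" for l x
    using that by (auto simp: nf_def)
  then show ?thesis by blast
qed

lemma nf_homogeneous: "nf c N (t * l) (t * x) = t ^ N * nf c N l x"
  using nf_cases[of c N]
proof (elim disjE conjE)
  assume c: "c = 1" "N = 1"
  have "nf c N l x = 2 * l + x" for l x by (simp add: nf_def c)
  then show ?thesis by (simp add: c algebra_simps)
next
  assume c: "c = 0" "N = 2"
  have n: "nf c N l x = (2 * l + x) * x" for l x by (simp add: nf_def c)
  show ?thesis unfolding n unfolding c by algebra
next
  assume c: "c = 0" "N = 3"
  have n: "nf c N l x = (2 * l + x) * (l ^ 2 + l * x)" for l x by (simp add: nf_def c)
  show ?thesis unfolding n unfolding c by algebra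
next
  assume c: "c = -1" "N = 3"
  have n: "nf c N l x = (2 * l + x) * x ^ 2" for l x by (simp add: nf_def c)
  show ?thesis unfolding n unfolding c by algebra
next
  assume c: "c = -1" "N = 4"
  have n: "nf c N l x = (2 * l + x) * ((l ^ 2 + l * x) * x)" for l x by (simp add: nf_def c)
  show ?thesis unfolding n unfolding c by algebra
next
  assume c: "c = -4" "N = 7"
  have n: "nf c N l x = (2 * l + x) * (l ^ 2 + l * x) ^ 3" for l x by (simp add: nf_def c)
  show ?thesis unfolding n unfolding c by algebra
next
  assume c: "c = -6" "N = 9"
  have n: "nf c N l x = (2 * l + x) * (11 * (l ^ 2 + l * x) ^ 4 + 2 * (l ^ 2 + l * x) ^ 3 * x ^ 2)" for l x by (simp add: nf_def c)
  show ?thesis unfolding n unfolding c by algebra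
qed simp

lemma nf_eq_0: "N \<notin> {1, 2, 3, 4, 7, 9} \<Longrightarrow> nf c N l x = 0"
  by (auto simp: nf_def)

lemma admissible_nf:
  assumes "\<And>l x. ev2 Q l x = (\<Sum>N\<in>{1, 2, 3, 4, 7, 9}. \<beta> N * nf c N l x)"
  shows "admissible c 0 Q"
  unfolding admissible_def
proof (intro conjI impI refl)
  have "ev2 Q l x = - ev2 Q (- l - x) x" for l x
    by (simp add: assms skew_nf[of c _ l x])
  then show "skew_sym Q" unfolding skew_sym_iff skew_fun_def by blast
  assume "Q \<noteq> 0"
  then obtain l x where "ev2 Q l x \<noteq> 0" using ev2_eqI[of Q 0] unfolding ev2_simps(8) by metis
  then have "(\<Sum>N\<in>{1, 2, 3, 4, 7, 9}. \<beta> N * nf c N l x) \<noteq> 0" by (simp only: assms not_False_eq_True)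
  then obtain N where "\<beta> N * nf c N l x \<noteq> 0" by (rule sum.not_neutral_contains_not_neutral)
  then have "nf c N l x \<noteq> 0" by simp
  then have "c = 1 \<or> c = 0 \<or> c = -1 \<or> c = -4 \<or> c = -6" by (auto simp: nf_def split: if_splits)
  then show "c = 1 \<and> (\<exists>\<beta>. Q = const2 \<beta> * (2 * lam + del)) \<or>
       c = 0 \<and> (\<exists>\<beta> \<gamma>. Q = const2 \<beta> * (2 * lam + del) * (lam^2 + lam * del)
                        + const2 \<gamma> * (2 * lam + del) * del) \<or>
       c = - 1 \<and> (\<exists>\<beta> \<gamma>. Q = const2 \<beta> * (2 * lam + del) * del^2
                        + const2 \<gamma> * (2 * lam + del) * (lam^2 + lam * del) * del) \<or>
       c = - 4 \<and> (\<exists>\<beta>. Q = const2 \<beta> * (2 * lam + del) * (lam^2 + lam * del)^3) \<or>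
       c = - 6 \<and> (\<exists>\<beta>. Q = const2 \<beta> * (2 * lam + del) *
                        (11 * (lam^2 + lam * del)^4 + 2 * (lam^2 + lam * del)^3 * del^2))"
  proof (elim disjE)
    assume c: "c = 1"
    have "Q = const2 (\<beta> 1) * (2 * lam + del)"
      by (rule ev2_eqI) (simp add: assms nf_def c ev2_simps)
    with c show ?thesis by blast
  next
    assume c: "c = 0"
    have "Q = const2 (\<beta> 3) * (2 * lam + del) * (lam^2 + lam * del) + const2 (\<beta> 2) * (2 * lam + del) * del"
      by (rule ev2_eqI) (simp add: assms nf_def c ev2_simps algebra_simps)
    with c show ?thesis by blast
  next
    assume c: "c = -1"
    have "Q = const2 (\<beta> 3) * (2 * lam + del) * del^2 + const2 (\<beta> 4) * (2 * lam + del) * (lam^2 + lam * del) * del"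
      by (rule ev2_eqI) (simp add: assms nf_def c ev2_simps algebra_simps)
    with c show ?thesis by blast
  next
    assume c: "c = -4"
    have "Q = const2 (\<beta> 7) * (2 * lam + del) * (lam^2 + lam * del)^3"
      by (rule ev2_eqI) (simp add: assms nf_def c ev2_simps)
    with c show ?thesis by blast
  next
    assume c: "c = -6"
    have "Q = const2 (\<beta> 9) * (2 * lam + del) * (11 * (lam^2 + lam * del)^4 + 2 * (lam^2 + lam * del)^3 * del^2)"
      by (rule ev2_eqI) (simp add: assms nf_def c ev2_simps)
    with c show ?thesis by blast
  qed
qed

lemma nf_admissible:
  assumes "admissible c 0 Q"
  shows "\<exists>\<beta>. \<forall>l x. ev2 Q l x = (\<Sum>N\<in>{1, 2, 3, 4, 7, 9}. \<beta> N * nf c N l x)"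
proof (cases "Q = 0")
  case True
  then show ?thesis by (intro exI[of _ "\<lambda>_. 0"]) (simp add: ev2_simps)
next
  case False
  with assms consider 
     \<beta> where "c = 1" "Q = const2 \<beta> * (2 * lam + del)"
   | \<beta> \<gamma> where "c = 0" "Q = const2 \<beta> * (2 * lam + del) * (lam^2 + lam * del) + const2 \<gamma> * (2 * lam + del) * del"
   | \<beta> \<gamma> where "c = - 1" "Q = const2 \<beta> * (2 * lam + del) * del^2 + const2 \<gamma> * (2 * lam + del) * (lam^2 + lam * del) * del"
   | \<beta> where "c = - 4" "Q = const2 \<beta> * (2 * lam + del) * (lam^2 + lam * del)^3"
   | \<beta> where "c = - 6" "Q = const2 \<beta> * (2 * lam + del) * (11 * (lam^2 + lam * del)^4 + 2 * (lam^2 + lam * del)^3 * del^2)"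
    unfolding admissible_def by blast
  then show ?thesis
  proof cases
    case 1
    show ?thesis by (intro exI[of _ "\<lambda>_. \<beta>"]) (simp add: nf_def 1 ev2_simps)
  next
    case 2
    show ?thesis by (intro exI[of _ "\<lambda>N. if N = 2 then \<gamma> else \<beta>"]) (simp add: nf_def 2 ev2_simps algebra_simps)
  next
    case 3
    show ?thesis by (intro exI[of _ "\<lambda>N. if N = 4 then \<gamma> else \<beta>"]) (simp add: nf_def 3 ev2_simps algebra_simps)
  next
    case 4
    show ?thesis by (intro exI[of _ "\<lambda>_. \<beta>"]) (simp add: nf_def 4 ev2_simps)
  next
    case 5
    show ?thesis by (intro exI[of _ "\<lambda>_. \<beta>"]) (simp add: nf_def 5 ev2_simps)
  qed
qed

text \<open>Normal forms are not coboundaries in the same degree. Where \<open>cob c (N - 1)\<close> does not vanish identically,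
  it is compared with the normal form at one or two points.\<close>

lemma nf_not_cob:
  assumes E: "\<And>l x. b * nf c N l x = z * cob c (N - 1) l x"
  shows "b * nf c N l x = 0"
proof -
  note nf_cases[of c N]
  then consider "\<And>l x. nf c N l x = 0" | "c = 1" "N = 1" | "c = 0" "N = 2" | "c = 0" "N = 3" | "c = -1" "N = 3"
    | "c = -1" "N = 4" | "c = -4" "N = 7" | "c = -6" "N = 9"
    by blast
  then show ?thesis
  proof cases
    case 5
    with E[of 0 1] show ?thesis by (simp add: nf_def cob_def)
  next
    case 7
    then have "b * 24 = - (z * 204)" "b * 108 = - (z * 1728)" using E[of 1 1] E[of 1 2] by (simp_all add: nf_def cob_def)
    then have "b = 0" by algebra
    then show ?thesis by simp
  next
    case 8
    then have "b * 576 = - (z * 1296)" "b * 4428 = - (z * 27288)" using E[of 1 1] E[of 1 2] by (simp_all add: nf_def cob_def)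
    then have "b = 0" by algebra
    then show ?thesis by simp
  next
    case 1 then show ?thesis by simp
  next
    case 2 show ?thesis unfolding E by (simp add: 2 cob_def)
  next
    case 3 show ?thesis unfolding E by (simp add: 3 cob_def algebra_simps)
  next
    case 4
    have "cob 0 2 l x = 0" unfolding cob_def by algebra
    then show ?thesis unfolding E by (simp add: 4)
  next
    case 6
    have "cob (-1) 3 l x = 0" unfolding cob_def by algebra
    then show ?thesis unfolding E by (simp add: 6)
  qed
qed

text \<open>If \<open>d \<noteq> 0\<close>, the cocycle identity at \<open>m = 0\<close> says that \<open>d Q\<close> is the coboundary of
  \<open>Q(0, \<partial>)\<close>. If \<open>d = 0\<close>, the homogeneous components are cocycles and are classified separately.\<close>

theorem virasoro_cocycle_classification:
  assumes sk: "skew_sym Q"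
    and J: "\<And>l m x. ev2 Q m (l+x) * ev2 (vir_weight c d) l x + ev2 (2 * lam + del) m (l+x) * ev2 Q l x
         - (ev2 Q l (m+x) * ev2 (vir_weight c d) m x + ev2 (2 * lam + del) l (m+x) * ev2 Q m x)
       = - ev2 Q l (-l-m) * ev2 (vir_weight c d) (-l-m-x) x + ev2 (2 * lam + del) l (-l-m) * ev2 Q (l+m) x"
  shows "\<exists>g. admissible c d (Q - coboundary (vir_weight c d) (2 * lam + del) g)"
proof (cases "d = 0")
  case False
  have "Q = coboundary (vir_weight c d) (2 * lam + del) (smult (1 / d) (coeff Q 0))"
  proof (rule ev2_eqI)
    fix l x
    have "ev2 Q l (- l) = - ev2 Q 0 (- l)"
      using skew_sym_ev2[OF sk, of l "-l"] by simp
    with J[of 0 l x]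
    have "d * ev2 Q l x = ev2 Q 0 (l + x) * (c * l + d + x) - ev2 Q 0 (- l) * (c * (- l - x) + d + x) - ev2 Q 0 x * (2 * l + x)"
      by (simp add: ev2_simps algebra_simps)
    moreover have "d * (1 / d) = 1" using False by simp
    ultimately show "ev2 Q l x = ev2 (coboundary (vir_weight c d) (2 * lam + del) (smult (1 / d) (coeff Q 0))) l x"
      unfolding ev2_coboundary poly_smult ev2_0_left[symmetric] ev2_simps by algebra
  qed
  then have "Q - coboundary (vir_weight c d) (2 * lam + del) (smult (1 / d) (coeff Q 0)) = 0" by simp
  moreover have "admissible c d 0" by (simp add: admissible_def skew_sym_def)
  ultimately show ?thesis by metis
next
  case True
  have co: "cocycle c (ev2 Q)"
    unfolding cocycle_def
  proof (intro allI)
    fix l m x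
    show "ev2 Q m (l + x) * (c * l + x) + (2 * m + l + x) * ev2 Q l x
      - ev2 Q l (m + x) * (c * m + x) - (2 * l + m + x) * ev2 Q m x
      = - ev2 Q l (- l - m) * (c * (- l - m - x) + x) + (l - m) * ev2 Q (l + m) x"
      using J[of m l x] by (simp add: True ev2_simps algebra_simps)
  qed
  have sk': "skew_fun (ev2 Q)" using sk by (simp add: skew_sym_iff)
  have "\<exists>z \<beta>. \<forall>l x. coeff (on_line Q l x) N = z * cob c (N - 1) l x + \<beta> * nf c N l x" for N
    by (intro homogeneous_classification is_homog_component skew_component sk' cocycle_component co)
  then obtain z \<beta> where H: "\<And>N l x. coeff (on_line Q l x) N = z N * cob c (N - 1) l x + \<beta> N * nf c N l x"
    by metis
  obtain K' where "\<And>l x. degree (on_line Q l x) \<le> K'" using on_line_degree_bounded by blast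
  \<comment> \<open>\<open>9\<close> is the largest degree of a normal form.\<close>
  then have K: "degree (on_line Q l x) \<le> K' + 9" for l x by (meson trans_le_add1)
  define g where "g = (\<Sum>N\<le>K' + 9. monom (z N) (N - 1))"
  have "ev2 (Q - coboundary (vir_weight c d) (2 * lam + del) g) l x = (\<Sum>N\<in>{1, 2, 3, 4, 7, 9}. \<beta> N * nf c N l x)" for l x
  proof -
    have "ev2 Q l x = poly (on_line Q l x) 1" by (simp add: poly_on_line)
    also have "\<dots> = (\<Sum>N\<le>K' + 9. coeff (on_line Q l x) N)"
      using arg_cong[OF poly_as_sum_of_monoms'[OF K, of l x], of "\<lambda>q. poly q 1"] by (simp only: poly_sum poly_monom power_one mult_1_right)
    also have "\<dots> = (\<Sum>N\<le>K' + 9. z N * cob c (N - 1) l x) + (\<Sum>N\<le>K' + 9. \<beta> N * nf c N l x)"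
      by (simp only: H sum.distrib)
    finally have "ev2 (Q - coboundary (vir_weight c d) (2 * lam + del) g) l x = (\<Sum>N\<le>K' + 9. \<beta> N * nf c N l x)"
      unfolding g_def ev2_simps(2) True ev2_coboundary_homogeneous by simp
    also have "\<dots> = (\<Sum>N\<in>{1, 2, 3, 4, 7, 9}. \<beta> N * nf c N l x)"
      by (intro sum.mono_neutral_right) (auto simp: nf_eq_0)
    finally show ?thesis .
  qed
  from admissible_nf[OF this] show ?thesis unfolding True by blast
qed

text \<open>Cohomologous admissible cocycles are proportional: the difference \<open>p Q - Q'\<close> is a combination of normal
  forms and a coboundary, so it vanishes degree by degree.\<close>

theorem admissible_unique:
  assumes "admissible c d Q" "admissible c d Q'" and p: "p \<noteq> 0"
    and E: "const2 p * Q = Q' + coboundary (vir_weight c d) (2 * lam + del) g"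
  shows "\<exists>k. k \<noteq> 0 \<and> Q = const2 k * Q'"
proof -
  have "const2 p * Q = Q'"
  proof (cases "d = 0")
    case False
    then have "Q = 0" "Q' = 0" using assms(1,2) by (auto simp: admissible_def)
    then show ?thesis by simp
  next
    case True
    let ?S = "{1, 2, 3, 4, 7, 9} :: nat set"
    obtain \<beta> where b: "\<And>l x. ev2 Q l x = (\<Sum>N\<in>?S. \<beta> N * nf c N l x)"
      using nf_admissible[of c Q] assms(1) True by auto
    obtain \<beta>' where b': "\<And>l x. ev2 Q' l x = (\<Sum>N\<in>?S. \<beta>' N * nf c N l x)"
      using nf_admissible[of c Q'] assms(2) True by auto
    define b where "b N = p * \<beta> N - \<beta>' N" for N
    have g: "g = (\<Sum>n\<le>degree g. monom (coeff g n) n)" by (simp add: poly_as_sum_of_monoms)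
    have D: "(\<Sum>N\<in>?S. b N * nf c N l x) = (\<Sum>n\<le>degree g. coeff g n * cob c n l x)" for l x
    proof -
      have "p * ev2 Q l x - ev2 Q' l x = ev2 (coboundary (vir_weight c 0) (2 * lam + del) g) l x"
        using arg_cong[OF E, of "\<lambda>P. ev2 P l x"] by (simp add: ev2_simps True)
      also have "\<dots> = (\<Sum>n\<le>degree g. coeff g n * cob c n l x)"
        by (subst g) (rule ev2_coboundary_homogeneous)
      finally show ?thesis unfolding b b' by (simp add: b_def algebra_simps)
    qed
    have cobt: "cob c n (t * l) (t * x) = t ^ Suc n * cob c n l x" for n t l x
    proof -
      have "cob c n (t * l) (t * x) = (t * (l + x)) ^ n * (t * (c * l + x)) - (t * (- l)) ^ n * (t * ((1 - c) * x - c * l))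
          - t * (2 * l + x) * (t * x) ^ n"
        by (simp add: cob_def algebra_simps)
      then show ?thesis unfolding cob_def power_mult_distrib by (simp add: algebra_simps)
    qed
    have main: "b N * nf c N l x = coeff g (N - 1) * cob c (N - 1) l x" if "N \<in> ?S" for N l x
    proof -
      have "(\<Sum>N\<in>?S. monom (b N * nf c N l x) N) = (\<Sum>n\<le>degree g. monom (coeff g n * cob c n l x) (Suc n))"
      proof (rule poly_eq_by_values)
        fix t
        show "poly (\<Sum>N\<in>?S. monom (b N * nf c N l x) N) t = poly (\<Sum>n\<le>degree g. monom (coeff g n * cob c n l x) (Suc n)) t"
          using D[of "t * l" "t * x", unfolded nf_homogeneous cobt] by (simp add: poly_sum poly_monom nf_homogeneous cobt mult_ac)
      qed
      from arg_cong[OF this, of "\<lambda>q. coeff q N"] 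
      have "b N * nf c N l x = (\<Sum>n\<le>degree g. if Suc n = N then coeff g n * cob c n l x else 0)"
        unfolding coeff_sum coeff_monom using that by (simp only: sum.delta finite.intros if_True)
      also have "\<dots> = (\<Sum>n\<le>degree g. if n = N - 1 then coeff g n * cob c n l x else 0)"
        using that by (intro sum.cong refl) auto
      also have "\<dots> = coeff g (N - 1) * cob c (N - 1) l x"
        by (simp add: sum.delta coeff_eq_0)
      finally show ?thesis .
    qed
    show ?thesis
    proof (rule ev2_eqI)
      fix l x
      have "b N * nf c N l x = 0" if "N \<in> ?S" for N using nf_not_cob main[OF that] by blast
      then have "(\<Sum>N\<in>?S. b N * nf c N l x) = 0" by (rule sum.neutral[OF ballI])
      then show "ev2 (const2 p * Q) l x = ev2 Q' l x" unfolding ev2_simps b b' by (simp add: b_def algebra_simps)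
    qed
  qed
  then have "Q = const2 (1 / p) * Q'" using p by (intro ev2_eqI) (auto simp: ev2_simps)
  with p show ?thesis by (intro exI[of _ "1 / p"]) simp
qed

section \<open>Isomorphisms between the models\<close>

lemma conf_hom_compose:
  assumes "conf_hom R S f" "conf_hom S T g" shows "conf_hom R T (g \<circ> f)"
proof -
  have "module_hom (act R) (act S) f" "module_hom (act S) (act T) g" using assms by (auto simp: conf_hom_def)
  then have "f 0 = 0" "g 0 = 0" "module_hom (act R) (act T) (g \<circ> f)"
    using module_hom.zero by (blast, blast, metis module_hom_compose)
  with assms show ?thesis by (simp add: conf_hom_def map_poly_map_poly)
qed

lemma conf_iso_trans: "R \<cong>\<^sub>c S \<Longrightarrow> S \<cong>\<^sub>c T \<Longrightarrow> R \<cong>\<^sub>c T"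
  unfolding conf_iso_def using conf_hom_compose bij_comp by metis

lemma act_rank2: "act (rank2 M Q V) p x = (p * fst x, p * snd x)"
  by (cases x) (simp add: rank2_def)

lemma ev_map_poly_linear:
  assumes "\<And>r. fst (G r) = p * fst r + g * snd r" "\<And>r. snd (G r) = q * fst r + e * snd r"
  shows "ev1 (fst_at d) l (map_poly G P) = poly p d * ev1 (fst_at d) l P + poly g d * ev1 (snd_at d) l P"
    and "ev1 (snd_at d) l (map_poly G P) = poly q d * ev1 (fst_at d) l P + poly e d * ev1 (snd_at d) l P"
proof -
  have G0: "G 0 = 0" using assms[of 0] by (simp add: prod_eq_iff)
  have "(\<lambda>r. fst_at d (G r)) = (\<lambda>r. poly p d * fst_at d r + poly g d * snd_at d r)"
    and "(\<lambda>r. snd_at d (G r)) = (\<lambda>r. poly q d * fst_at d r + poly e d * snd_at d r)"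
    by (simp_all add: fst_at_def snd_at_def assms fun_eq_iff)
  then show "ev1 (fst_at d) l (map_poly G P) = poly p d * ev1 (fst_at d) l P + poly g d * ev1 (snd_at d) l P"
    and "ev1 (snd_at d) l (map_poly G P) = poly q d * ev1 (fst_at d) l P + poly e d * ev1 (snd_at d) l P"
    using ev1_lin[OF additive_coords(1)[of d] additive_coords(2)[of d]] by (simp_all add: ev1_map[of G, OF G0])
qed

lemma rank2_module_hom_matrix:
  assumes "module_hom (act (rank2 M Q V)) (act (rank2 M' Q' V')) F"
  shows "fst (F r) = fst (F (1, 0)) * fst r + fst (F (0, 1)) * snd r"
    and "snd (F r) = snd (F (1, 0)) * fst r + snd (F (0, 1)) * snd r"
proof -
  interpret module_hom "act (rank2 M Q V)" "act (rank2 M' Q' V')" F by fact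
  have "r = act (rank2 M Q V) (fst r) (1, 0) + act (rank2 M Q V) (snd r) (0, 1)" by (simp add: act_rank2)
  then have F: "F r = act (rank2 M' Q' V') (fst r) (F (1, 0)) + act (rank2 M' Q' V') (snd r) (F (0, 1))"
    by (metis add scale)
  show "fst (F r) = fst (F (1, 0)) * fst r + fst (F (0, 1)) * snd r"
    and "snd (F r) = snd (F (1, 0)) * fst r + snd (F (0, 1)) * snd r"
    by (subst F; simp add: act_rank2 mult.commute)+
qed

lemma ev_rank2_hom:
  assumes "conf_hom (rank2 M Q V) (rank2 M' Q' V') F"
  shows "ev1 (fst_at d) l (br (rank2 M' Q' V') (F a) (F b))
      = poly (fst (F (1, 0))) d * ev1 (fst_at d) l (br (rank2 M Q V) a b) + poly (fst (F (0, 1))) d * ev1 (snd_at d) l (br (rank2 M Q V) a b)"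
    and "ev1 (snd_at d) l (br (rank2 M' Q' V') (F a) (F b))
      = poly (snd (F (1, 0))) d * ev1 (fst_at d) l (br (rank2 M Q V) a b) + poly (snd (F (0, 1))) d * ev1 (snd_at d) l (br (rank2 M Q V) a b)"
proof -
  have "module_hom (act (rank2 M Q V)) (act (rank2 M' Q' V')) F"
    and b: "br (rank2 M' Q' V') (F a) (F b) = map_poly F (br (rank2 M Q V) a b)"
    using assms unfolding conf_hom_def by blast+
  note ev_map_poly_linear[of F, OF rank2_module_hom_matrix[OF this(1)]]
  then show "ev1 (fst_at d) l (br (rank2 M' Q' V') (F a) (F b))
      = poly (fst (F (1, 0))) d * ev1 (fst_at d) l (br (rank2 M Q V) a b) + poly (fst (F (0, 1))) d * ev1 (snd_at d) l (br (rank2 M Q V) a b)"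
    and "ev1 (snd_at d) l (br (rank2 M' Q' V') (F a) (F b))
      = poly (snd (F (1, 0))) d * ev1 (fst_at d) l (br (rank2 M Q V) a b) + poly (snd (F (0, 1))) d * ev1 (snd_at d) l (br (rank2 M Q V) a b)"
    unfolding b by blast+
qed

lemma coords_Pair: "fst_at t (x, y) = poly x t" "snd_at t (x, y) = poly y t"
  by (simp_all add: fst_at_def snd_at_def)

text \<open>The isomorphism is \<open>A \<mapsto> \<alpha> A'\<close>, \<open>B \<mapsto> h B' + g(\<partial>)A'\<close>.\<close>

lemma rank2_iso_triangular:
  assumes "\<alpha> \<noteq> 0" "h \<noteq> 0" and M: "M = const2 h * M'" and V: "V = const2 h * V'"
    and Q: "const2 \<alpha> * Q = const2 (h ^ 2) * Q' + coboundary M V g"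
  shows "rank2 M Q V \<cong>\<^sub>c rank2 M' Q' V'"
proof -
  define G where "G r = ([:\<alpha>:] * fst r + g * snd r, [:h:] * snd r)" for r
  have G: "fst (G r) = [:\<alpha>:] * fst r + g * snd r" "snd (G r) = 0 * fst r + [:h:] * snd r" for r by (simp_all add: G_def)
  note evG = ev_map_poly_linear[of G, OF G]
  have "module_hom (act (rank2 M Q V)) (act (rank2 M' Q' V')) G"
    unfolding module_hom_iff
    by (intro conjI allI rank2_module) (simp_all add: act_rank2 G_def algebra_simps)
  moreover have "br (rank2 M' Q' V') (G a) (G b) = map_poly G (br (rank2 M Q V) a b)" for a b
  proof (rule pair_poly_eqI)
    fix l d
    have poly_const: "poly [:\<alpha>:] d = \<alpha>" by simp
    have at: "fst_at t (G r) = \<alpha> * fst_at t r + poly g t * snd_at t r" "snd_at t (G r) = h * snd_at t r" for t r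
      by (simp_all add: fst_at_def snd_at_def G)
    show "ev1 (snd_at d) l (br (rank2 M' Q' V') (G a) (G b)) = ev1 (snd_at d) l (map_poly G (br (rank2 M Q V) a b))"
      by (simp add: evG rank2_ev_br at V ev2_simps)
    have q: "\<alpha> * ev2 Q l d = h ^ 2 * ev2 Q' l d + (poly g (l + d) * (h * ev2 M' l d) - poly g (- l) * (h * ev2 M' (- l - d) d) - poly g d * (h * ev2 V' l d))"
      using arg_cong[OF Q, of "\<lambda>P. ev2 P l d"] unfolding M V ev2_coboundary ev2_simps .
    show "ev1 (fst_at d) l (br (rank2 M' Q' V') (G a) (G b)) = ev1 (fst_at d) l (map_poly G (br (rank2 M Q V) a b))"
      unfolding evG rank2_ev_br at M V ev2_simps poly_const using q by algebra
  qed
  ultimately have "conf_hom (rank2 M Q V) (rank2 M' Q' V') G" by (simp add: conf_hom_def)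
  moreover have "bij G"
  proof (rule o_bij)
    let ?H = "\<lambda>r. ([:1 / \<alpha>:] * (fst r - g * ([:1 / h:] * snd r)), [:1 / h:] * snd r)"
    show "?H \<circ> G = id" using assms(1,2) by (simp add: G_def fun_eq_iff)
    show "G \<circ> ?H = id" using assms(1,2) by (simp add: G_def fun_eq_iff)
  qed
  ultimately show ?thesis unfolding conf_iso_def by blast
qed

text \<open>Freeness of \<open>R\<close> in the form in which it is used: \<open>[p(\<partial>)x\<^sub>\<lambda> q(\<partial>)y] = 0\<close> forces \<open>[x\<^sub>\<lambda> y] = 0\<close>.\<close>

lemma sesqui_cancel:
  assumes "p \<noteq> 0" "q \<noteq> 0" "\<And>l d. poly p (- l) * poly q (l + d) * ev2 X l d = 0"
  shows "X = 0"
proof -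
  obtain l0 where "poly p l0 \<noteq> 0" using assms(1) poly_all_0_iff_0 by blast
  moreover obtain d0 where "poly q d0 \<noteq> 0" using assms(2) poly_all_0_iff_0 by blast
  ultimately have "ev2 (sesqui p q) (- l0) (d0 + l0) \<noteq> 0" by (simp add: ev2_sesqui)
  then have "sesqui p q \<noteq> 0" by (auto simp: ev2_simps)
  moreover have "sesqui p q * X = 0"
    by (rule ev2_eqI) (simp add: ev2_simps ev2_sesqui assms(3))
  ultimately show ?thesis by simp
qed

lemma del_cancel:
  assumes "p \<noteq> 0" "\<And>l d. poly p d * ev2 X l d = 0"
  shows "X = 0"
proof -
  have "[:p:] * X = 0"
    by (rule ev2_eqI) (use assms(2) in \<open>simp add: ev2_def\<close>)
  with assms(1) show ?thesis by simp
qed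

text \<open>Converse of \<open>rank2_iso_triangular\<close>: an isomorphism preserving \<open>\<complex>[\<partial>]A\<close> has units of \<open>\<complex>[\<partial>]\<close>, that is
  non-zero constants, on the diagonal of its matrix.\<close>

lemma rank2_hom_triangular:
  assumes hom: "conf_hom (rank2 M Q V) (rank2 M' Q' V') F" and bij: "bij F" and q: "snd (F (1, 0)) = 0"
  obtains \<alpha> h g where "\<alpha> \<noteq> 0" "h \<noteq> 0" "M = const2 h * M'" "V = const2 h * V'"
    "const2 \<alpha> * Q = const2 (h ^ 2) * Q' + coboundary M V g"
proof -
  define p where "p = fst (F (1, 0))"
  define g where "g = fst (F (0, 1))"
  define e where "e = snd (F (0, 1))"
  have F: "fst (F r) = p * fst r + g * snd r" "snd (F r) = e * snd r" for r
    using rank2_module_hom_matrix[of M Q V M' Q' V' F r] hom by (simp_all add: conf_hom_def p_def g_def e_def q)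
  obtain r where "F r = (0, 1)" using bij by (metis bij_pointE)
  then have "e * snd r = 1" using F(2)[of r] by simp
  then have "e dvd 1" by (metis dvd_triv_left)
  then obtain h where e: "e = [:h:]" "h dvd 1" using is_unit_poly_iff by blast
  then have h: "h \<noteq> 0" by auto
  obtain s where s: "F s = (1, 0)" using bij by (metis bij_pointE)
  then have "snd s = 0" using F(2)[of s] e h by simp
  with s have "p * fst s = 1" using F(1)[of s] by simp
  then have "p dvd 1" by (metis dvd_triv_left)
  then obtain \<alpha> where p: "p = [:\<alpha>:]" "\<alpha> dvd 1" using is_unit_poly_iff by blast
  then have \<alpha>: "\<alpha> \<noteq> 0" by auto
  have at: "fst_at t (F r) = \<alpha> * fst_at t r + poly g t * snd_at t r" "snd_at t (F r) = h * snd_at t r" for t r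
    by (simp_all add: fst_at_def snd_at_def F p e)
  have f: "ev1 (fst_at d) l (br (rank2 M' Q' V') (F a) (F b))
      = \<alpha> * ev1 (fst_at d) l (br (rank2 M Q V) a b) + poly g d * ev1 (snd_at d) l (br (rank2 M Q V) a b)"
    and s: "ev1 (snd_at d) l (br (rank2 M' Q' V') (F a) (F b)) = h * ev1 (snd_at d) l (br (rank2 M Q V) a b)"
    for l d a b unfolding ev_rank2_hom[OF hom] p_def[symmetric] g_def[symmetric] e_def[symmetric] by (simp_all add: p e q)
  have mM: "M = const2 h * M'"
  proof (rule ev2_eqI)
    fix l d
    show "ev2 M l d = ev2 (const2 h * M') l d"
      using f[of d l "(0, 1)" "(1, 0)"] \<alpha> unfolding rank2_ev_br at coords_Pair by (simp add: ev2_simps)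
  qed
  moreover have mV: "V = const2 h * V'"
  proof (rule ev2_eqI)
    fix l d
    show "ev2 V l d = ev2 (const2 h * V') l d"
      using s[of d l "(0, 1)" "(0, 1)"] h unfolding rank2_ev_br at coords_Pair by (simp add: ev2_simps)
  qed
  moreover have "const2 \<alpha> * Q = const2 (h ^ 2) * Q' + coboundary M V g"
  proof (rule ev2_eqI)
    fix l d
    have "h * poly g (l + d) * ev2 M' l d - poly g (- l) * h * ev2 M' (- l - d) d + h ^ 2 * ev2 Q' l d
      = \<alpha> * ev2 Q l d + poly g d * (h * ev2 V' l d)"
      using f[of d l "(0, 1)" "(0, 1)"] unfolding rank2_ev_br at coords_Pair mV by (simp add: ev2_simps power2_eq_square)
    then show "ev2 (const2 \<alpha> * Q) l d = ev2 (const2 (h ^ 2) * Q' + coboundary M V g) l d"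
      unfolding ev2_coboundary ev2_simps mM mV by algebra
  qed
  ultimately show ?thesis using that \<alpha> h by blast
qed

text \<open>If \<open>Q \<noteq> 0\<close> then \<open>\<complex>[\<partial>]A\<close> is preserved because \<open>Q(\<lambda>,\<partial>)\<close> times the image of \<open>A\<close> is a bracket, and all
  brackets lie in \<open>\<complex>[\<partial>]A'\<close>. If \<open>Q = 0\<close> both algebras are commutative.\<close>

theorem R_nil_iso_iff: "R_nil Q \<cong>\<^sub>c R_nil Q' \<longleftrightarrow> (\<exists>k. k \<noteq> 0 \<and> Q = const2 k * Q')"
proof
  assume "\<exists>k. k \<noteq> 0 \<and> Q = const2 k * Q'"
  then obtain k where k: "k \<noteq> 0" "Q = const2 k * Q'" by blast
  have "const2 (1 / k) * Q = const2 (1 ^ 2) * Q' + coboundary 0 0 0"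
    using k by (intro ev2_eqI) (simp add: ev2_coboundary ev2_simps)
  with k show "R_nil Q \<cong>\<^sub>c R_nil Q'" unfolding R_nil_def
    by (intro rank2_iso_triangular[of "1 / k" 1]) simp_all
next
  assume "R_nil Q \<cong>\<^sub>c R_nil Q'"
  then obtain F where hom: "conf_hom (rank2 0 Q 0) (rank2 0 Q' 0) F" and bij: "bij F"
    by (auto simp: conf_iso_def R_nil_def)
  have brF: "br (rank2 0 Q' 0) (F a) (F b) = map_poly F (br (rank2 0 Q 0) a b)" for a b
    using hom unfolding conf_hom_def by blast
  show "\<exists>k. k \<noteq> 0 \<and> Q = const2 k * Q'"
  proof (cases "Q = 0")
    case True
    obtain b where b: "F b = (0, 1)" using bij by (metis bij_pointE)
    have "br (rank2 0 Q 0) b b = 0" 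
      by (rule pair_poly_eqI) (simp_all add: rank2_ev_br True ev2_simps ev1_0)
    then have "br (rank2 0 Q' 0) (0, 1) (0, 1) = 0" using brF[of b b] b by simp
    then have "ev1 (fst_at d) l (br (rank2 0 Q' 0) (0, 1) (0, 1)) = 0" for l d by (simp add: ev1_0)
    then have "Q' = 0" by (intro ev2_eqI) (simp add: rank2_ev_br fst_at_def snd_at_def ev2_simps)
    with True show ?thesis by (intro exI[of _ 1]) simp
  next
    case False
    have "snd (F (1, 0)) = 0"
    proof (rule ccontr)
      assume n: "snd (F (1, 0)) \<noteq> 0"
      have "Q = 0"
      proof (rule del_cancel[OF n])
        fix l d
        show "poly (snd (F (1, 0))) d * ev2 Q l d = 0"
          using ev_rank2_hom(2)[OF hom, of d l "(0, 1)" "(0, 1)"] by (simp add: rank2_ev_br coords_Pair ev2_simps)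
      qed
      with False show False by simp
    qed
    from rank2_hom_triangular[OF hom bij this]
    obtain \<alpha> h g where "\<alpha> \<noteq> 0" "h \<noteq> 0" "const2 \<alpha> * Q = const2 (h ^ 2) * Q' + coboundary 0 0 g" by metis
    from arg_cong[OF this(3), of "\<lambda>P. ev2 P l d" for l d]
    have "\<alpha> * ev2 Q l d = h ^ 2 * ev2 Q' l d" for l d by (simp add: ev2_coboundary ev2_simps)
    then have "Q = const2 (h ^ 2 / \<alpha>) * Q'"
      using \<open>\<alpha> \<noteq> 0\<close> by (intro ev2_eqI) (simp add: ev2_simps field_simps)
    with \<open>\<alpha> \<noteq> 0\<close> \<open>h \<noteq> 0\<close> show ?thesis by (intro exI[of _ "h ^ 2 / \<alpha>"]) simp
  qed
qed

text \<open>\<open>\<complex>[\<partial>]A\<close> is preserved because \<open>a(\<lambda>)\<close> times the image of \<open>A\<close> is a bracket and thus lies in \<open>\<complex>[\<partial>]A'\<close>.\<close>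

theorem R_sol_iso_iff:
  assumes "a \<noteq> 0" shows "R_sol a \<cong>\<^sub>c R_sol a' \<longleftrightarrow> (\<exists>k. k \<noteq> 0 \<and> a = smult k a')"
proof
  assume "\<exists>k. k \<noteq> 0 \<and> a = smult k a'"
  then obtain k where k: "k \<noteq> 0" "a = smult k a'" by blast
  show "R_sol a \<cong>\<^sub>c R_sol a'" unfolding R_sol_def
  proof (rule rank2_iso_triangular[of 1 k])
    show "at2 a lam = const2 k * at2 a' lam" by (rule ev2_eqI) (simp add: k ev2_simps ev2_at2)
    show "const2 1 * 0 = const2 (k ^ 2) * 0 + coboundary (at2 a lam) 0 0"
      by (rule ev2_eqI) (simp add: ev2_coboundary ev2_simps)
  qed (simp_all add: k)
next
  assume "R_sol a \<cong>\<^sub>c R_sol a'"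
  then obtain F where hom: "conf_hom (rank2 (at2 a lam) 0 0) (rank2 (at2 a' lam) 0 0) F" and bij: "bij F"
    by (auto simp: conf_iso_def R_sol_def)
  have "snd (F (1, 0)) = 0"
  proof (rule ccontr)
    assume n: "snd (F (1, 0)) \<noteq> 0"
    have "at2 a lam = 0"
    proof (rule del_cancel[OF n])
      fix l d
      show "poly (snd (F (1, 0))) d * ev2 (at2 a lam) l d = 0"
        using ev_rank2_hom(2)[OF hom, of d l "(0, 1)" "(1, 0)"] by (simp add: rank2_ev_br coords_Pair ev2_simps)
    qed
    then have "poly a l = 0" for l using ev2_at2[of a lam l 0] by (simp add: ev2_simps)
    with assms show False using poly_all_0_iff_0 by blast
  qed
  from rank2_hom_triangular[OF hom bij this]
  obtain h where h: "h \<noteq> 0" "at2 a lam = const2 h * at2 a' lam" by metis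
  from arg_cong[OF this(2), of "\<lambda>P. ev2 P l 0" for l]
  have "a = smult h a'" by (intro poly_eq_by_values) (simp add: ev2_at2 ev2_simps)
  with h show "\<exists>k. k \<noteq> 0 \<and> a = smult k a'" by blast
qed

text \<open>\<open>\<complex>[\<partial>]A\<close> is preserved because the \<open>B'\<close>-component \<open>q\<close> of the image of \<open>A\<close> satisfies
  \<open>q(-\<lambda>) q(\<lambda>+\<partial>) (2\<lambda>+\<partial>) = 0\<close>. Comparing \<open>[B\<^sub>\<lambda> B]\<close> modulo \<open>A\<close> gives \<open>h = 1\<close>, so the weights \<open>c\<close> and \<open>d\<close> are
  invariants and only a multiple and a coboundary remain.\<close>

theorem R_vir_iso_iff:
  assumes adm: "admissible c d Q" "admissible c' d' Q'"
  shows "R_vir c d Q \<cong>\<^sub>c R_vir c' d' Q' \<longleftrightarrow> c = c' \<and> d = d' \<and> (\<exists>k. k \<noteq> 0 \<and> Q = const2 k * Q')"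
proof
  assume "c = c' \<and> d = d' \<and> (\<exists>k. k \<noteq> 0 \<and> Q = const2 k * Q')"
  then obtain k where k: "c = c'" "d = d'" "k \<noteq> 0" "Q = const2 k * Q'" by blast
  have "const2 (1 / k) * Q = const2 (1 ^ 2) * Q' + coboundary (vir_weight c d) (2 * lam + del) 0"
    using k by (intro ev2_eqI) (simp add: ev2_coboundary ev2_simps)
  moreover have "const2 1 = 1" by (simp add: const2_def flip: one_pCons)
  ultimately show "R_vir c d Q \<cong>\<^sub>c R_vir c' d' Q'"
    using k unfolding R_vir_def by (intro rank2_iso_triangular[of "1 / k" 1]) simp_all
next
  assume "R_vir c d Q \<cong>\<^sub>c R_vir c' d' Q'"
  then obtain F where hom: "conf_hom (rank2 (vir_weight c d) Q (2 * lam + del)) (rank2 (vir_weight c' d') Q' (2 * lam + del)) F"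
    and bij: "bij F"
    by (auto simp: conf_iso_def R_vir_def)
  have "snd (F (1, 0)) = 0"
  proof (rule ccontr)
    assume n: "snd (F (1, 0)) \<noteq> 0"
    have "2 * lam + del = 0"
    proof (rule sesqui_cancel[OF n n])
      fix l x
      have "ev1 (snd_at x) l (br (rank2 (vir_weight c d) Q (2 * lam + del)) (1, 0) (1, 0)) = 0"
        and "ev1 (fst_at x) l (br (rank2 (vir_weight c d) Q (2 * lam + del)) (1, 0) (1, 0)) = 0"
        by (simp_all add: rank2_ev_br coords_Pair)
      then show "poly (snd (F (1, 0))) (- l) * poly (snd (F (1, 0))) (l + x) * ev2 (2 * lam + del) l x = 0"
        using ev_rank2_hom(2)[OF hom, of x l "(1, 0)" "(1, 0)"] by (simp add: rank2_ev_br snd_at_def)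
    qed
    then have "ev2 (2 * lam + del) 1 0 = 0" by (simp add: ev2_simps)
    then show False by (simp add: ev2_simps)
  qed
  from rank2_hom_triangular[OF hom bij this]
  obtain \<alpha> h g where a: "\<alpha> \<noteq> 0" "h \<noteq> 0" "vir_weight c d = const2 h * vir_weight c' d'" "2 * lam + del = const2 h * (2 * lam + del)"
    "const2 \<alpha> * Q = const2 (h ^ 2) * Q' + coboundary (vir_weight c d) (2 * lam + del) g" by metis
  have h: "h = 1" using arg_cong[OF a(4), of "\<lambda>P. ev2 P 0 1"] by (simp add: ev2_simps)
  have d: "d = d'" using arg_cong[OF a(3), of "\<lambda>P. ev2 P 0 0"] by (simp add: ev2_simps h)
  have c: "c = c'" using arg_cong[OF a(3), of "\<lambda>P. ev2 P 1 0"] by (simp add: ev2_simps h d)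
  have "const2 (h ^ 2) = 1" by (simp add: h const2_def flip: one_pCons)
  with a(5) have "const2 \<alpha> * Q = Q' + coboundary (vir_weight c d) (2 * lam + del) g" by simp
  from admissible_unique[OF adm(1) adm(2)[folded c d] a(1) this] c d
  show "c = c' \<and> d = d' \<and> (\<exists>k. k \<noteq> 0 \<and> Q = const2 k * Q')" by blast
qed

section \<open>Brackets and modules of rank one\<close>

definition at_lam :: "complex poly poly \<Rightarrow> complex \<Rightarrow> complex poly" where
  "at_lam M l = poly M [:l:]"

lemma poly_at_lam: "poly (at_lam M l) d = ev2 M l d"
  by (simp add: at_lam_def ev2_def)

lemma coeff_at_lam: "coeff (at_lam M l) n = poly (map_poly (\<lambda>p. coeff p n) M) l"
proof (induction M)
  case (pCons p M)
  then show ?case by (cases "p = 0 \<and> M = 0") (auto simp: at_lam_def map_poly_pCons)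
qed (simp add: at_lam_def)

lemma degree_at_lam_bounded: "\<exists>K. \<forall>l. degree (at_lam M l) \<le> K"
proof (induction M)
  case (pCons p M)
  then obtain K where K: "\<And>l. degree (at_lam M l) \<le> K" by blast
  have "degree (at_lam (pCons p M) l) \<le> max (degree p) K" for l
  proof -
    have "at_lam (pCons p M) l = p + smult l (at_lam M l)" by (simp add: at_lam_def)
    also have "degree \<dots> \<le> max (degree p) K"
      using K[of l] degree_smult_le[of l "at_lam M l"] by (intro degree_add_le) auto
    finally show ?thesis .
  qed
  then show ?case by blast
qed (auto simp: at_lam_def)

lemma coeff_shift_top:
  fixes p :: "complex poly"
  assumes "degree p \<le> Suc n"
  shows "coeff (pcompose p [:l, 1:]) (Suc n) = coeff p (Suc n)"
    and "coeff (pcompose p [:l, 1:]) n = coeff p n + of_nat (Suc n) * l * coeff p (Suc n)"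
    and "degree (pcompose p [:l, 1:]) \<le> Suc n"
proof -
  have "p = (\<Sum>i\<le>Suc n. monom (coeff p i) i)" using poly_as_sum_of_monoms'[OF assms] by simp
  then have "pcompose p [:l, 1:] = (\<Sum>i\<le>Suc n. smult (coeff p i) ([:l, 1:] ^ i))"
    by (intro poly_eq_by_values) (metis (no_types, lifting) poly_pcompose poly_sum poly_monom poly_smult poly_power sum.cong)
  then have c: "coeff (pcompose p [:l, 1:]) j = (\<Sum>i\<le>Suc n. coeff p i * (of_nat (i choose j) * l ^ (i - j)))" for j
    by (simp add: coeff_sum coeff_linear_power del: sum.atMost_Suc power_Suc)
  have 0: "(\<Sum>i\<le>n. coeff p i * of_nat (i choose Suc n)) = 0"
    by (intro sum.neutral) auto
  show "coeff (pcompose p [:l, 1:]) (Suc n) = coeff p (Suc n)" unfolding c by (simp add: 0)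
  have "(\<Sum>i\<le>n. coeff p i * (of_nat (i choose n) * l ^ (i - n))) = (\<Sum>i\<le>n. if i = n then coeff p i else 0)"
    by (intro sum.cong refl) auto
  then show "coeff (pcompose p [:l, 1:]) n = coeff p n + of_nat (Suc n) * l * coeff p (Suc n)"
    unfolding c by (simp add: algebra_simps)
  show "degree (pcompose p [:l, 1:]) \<le> Suc n" using assms degree_pcompose_le[of p "[:l, 1:]"] by simp
qed

text \<open>The second highest coefficient of a product. The highest ones cancel in the equation below.\<close>

lemma coeff_mult_second:
  fixes p q :: "complex poly"
  assumes "degree p \<le> Suc n" "degree q \<le> Suc n"
  shows "coeff (p * q) (Suc (2 * n)) = coeff p (Suc n) * coeff q n + coeff p n * coeff q (Suc n)"
proof -
  have "coeff (p * q) (Suc (2 * n)) = (\<Sum>i\<in>{n, Suc n}. coeff p i * coeff q (Suc (2 * n) - i))"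
    unfolding coeff_mult
  proof (rule sum.mono_neutral_right)
    show "\<forall>i\<in>{..Suc (2 * n)} - {n, Suc n}. coeff p i * coeff q (Suc (2 * n) - i) = 0"
    proof
      fix i assume "i \<in> {..Suc (2 * n)} - {n, Suc n}"
      then have "Suc n < i \<or> Suc n < Suc (2 * n) - i" by auto
      with assms show "coeff p i * coeff q (Suc (2 * n) - i) = 0"
        by (auto simp: coeff_eq_0 intro: le_less_trans)
    qed
  qed auto
  then show ?thesis by (simp add: Suc_diff_le mult_2)
qed

lemma infinitely_vanishing: "(\<And>l. l \<noteq> l0 \<Longrightarrow> poly p l = 0) \<Longrightarrow> p = (0 :: complex poly)"
proof (rule ccontr)
  assume *: "\<And>l. l \<noteq> l0 \<Longrightarrow> poly p l = 0" and "p \<noteq> 0"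
  then have "finite {l. poly p l = 0}" by (intro poly_roots_finite)
  moreover have "UNIV - {l0} \<subseteq> {l. poly p l = 0}" using * by auto
  ultimately show False using infinite_UNIV_char_0[where 'a=complex] by (meson finite.emptyI finite_Diff2 finite_insert finite_subset)
qed

text \<open>If \<open>n \<ge> 2\<close> is the degree of \<open>M\<close> in \<open>\<partial>\<close> and \<open>v(\<lambda>)\<close> its leading coefficient, the left-hand side has
  \<open>\<partial>\<^bsup>2n-1\<^esup>\<close>-coefficient \<open>n (l - m) v(l) v(m)\<close>, whereas the right-hand side only has degree \<open>n < 2n - 1\<close>.\<close>

lemma degree_at_lam_le_1:
  assumes J: "\<And>l m d. ev2 M m (l + d) * ev2 M l d - ev2 M l (m + d) * ev2 M m d = s l m * ev2 M (l + m) d"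
  shows "degree (at_lam M l) \<le> 1"
proof -
  have "(\<forall>l. degree (at_lam M l) \<le> Suc k) \<Longrightarrow> \<forall>l. degree (at_lam M l) \<le> 1" for k
  proof (induction k)
    case (Suc k)
    let ?n = "Suc k"
    have deg: "degree (at_lam M l) \<le> Suc ?n" for l using Suc.prems by auto
    have top: "(l - m) * coeff (at_lam M l) (Suc ?n) * coeff (at_lam M m) (Suc ?n) = 0" for l m
    proof -
      have "pcompose (at_lam M m) [:l, 1:] * at_lam M l - pcompose (at_lam M l) [:m, 1:] * at_lam M m = smult (s l m) (at_lam M (l + m))"
        by (rule poly_eq_by_values) (use J in \<open>simp add: poly_pcompose poly_at_lam\<close>)
      from arg_cong[OF this, of "\<lambda>p. coeff p (Suc (2 * ?n))"]
      have "coeff (pcompose (at_lam M m) [:l, 1:] * at_lam M l) (Suc (2 * ?n)) - coeff (pcompose (at_lam M l) [:m, 1:] * at_lam M m) (Suc (2 * ?n))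
         = s l m * coeff (at_lam M (l + m)) (Suc (2 * ?n))" by simp
      moreover have "coeff (at_lam M (l + m)) (Suc (2 * ?n)) = 0" using deg[of "l + m"] by (intro coeff_eq_0) simp
      ultimately have "of_nat (Suc ?n) * ((l - m) * coeff (at_lam M l) (Suc ?n) * coeff (at_lam M m) (Suc ?n)) = 0"
        unfolding coeff_mult_second[OF coeff_shift_top(3)[OF deg] deg] coeff_shift_top(1,2)[OF deg]
        by (simp add: algebra_simps)
      then show ?thesis by (metis mult_eq_0_iff of_nat_neq_0)
    qed
    have "coeff (at_lam M l0) (Suc ?n) = 0" for l0
    proof (rule ccontr)
      assume n: "coeff (at_lam M l0) (Suc ?n) \<noteq> 0"
      \<comment> \<open>the leading coefficient, as a polynomial in \<open>\<lambda>\<close>\<close>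
      have "map_poly (\<lambda>p. coeff p (Suc ?n)) M = 0"
      proof (rule infinitely_vanishing)
        fix m assume "m \<noteq> l0"
        with top[of l0 m] n show "poly (map_poly (\<lambda>p. coeff p (Suc ?n)) M) m = 0"
          unfolding coeff_at_lam[symmetric] by simp
      qed
      with n show False by (simp add: coeff_at_lam)
    qed
    then have "\<forall>l. degree (at_lam M l) \<le> Suc k" using deg by (metis degree_le leI le_SucE leading_coeff_0_iff order_refl zero_le degree_0)
    then show ?case by (rule Suc.IH)
  qed simp
  moreover obtain K where "\<And>l. degree (at_lam M l) \<le> K" using degree_at_lam_bounded by blast
  then have "\<forall>l. degree (at_lam M l) \<le> Suc K" by (simp add: le_SucI)
  ultimately show ?thesis by blast
qed

text \<open>The equation of a module over a rank one Lie conformal algebra, split into the coefficients of \<open>\<partial>\<close> and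
  of \<open>1\<close>. For \<open>M = V\<close> it is the Jacobi identity of that algebra.\<close>

lemma affine_in_del:
  assumes J: "\<And>l m d. ev2 M m (l + d) * ev2 M l d - ev2 M l (m + d) * ev2 M m d = s l m * ev2 M (l + m) d"
  obtains a b where "\<And>l d. ev2 M l d = poly a l + poly b l * d"
    "\<And>l m. (l - m) * (poly b l * poly b m) = s l m * poly b (l + m)"
    "\<And>l m. poly b m * l * poly a l - poly b l * m * poly a m = s l m * poly a (l + m)"
proof
  let ?a = "map_poly (\<lambda>p. coeff p 0) M" and ?b = "map_poly (\<lambda>p. coeff p 1) M"
  show M: "ev2 M l d = poly ?a l + poly ?b l * d" for l d
  proof -
    have "poly (at_lam M l) d = (\<Sum>i\<le>1. coeff (at_lam M l) i * d ^ i)"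
      using arg_cong[OF poly_as_sum_of_monoms'[OF degree_at_lam_le_1[OF J], of l], of "\<lambda>p. poly p d"]
      by (simp add: poly_sum poly_monom)
    then show ?thesis by (simp add: poly_at_lam coeff_at_lam)
  qed
  show "(l - m) * (poly ?b l * poly ?b m) = s l m * poly ?b (l + m)" for l m
    using J[of m l 0] J[of m l 1] unfolding M by algebra
  show "poly ?b m * l * poly ?a l - poly ?b l * m * poly ?a m = s l m * poly ?a (l + m)" for l m
    using J[of m l 0] unfolding M by algebra
qed

text \<open>Rank one Lie conformal algebras are commutative or Virasoro: if \<open>V = a(\<lambda>) + b(\<lambda>)\<partial>\<close> is
  not \<open>0\<close>, the Jacobi identity at \<open>m = 0\<close> gives \<open>a = \<lambda> (b + b(0))\<close>, and symmetrizing it makes \<open>b\<close> constant.\<close>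

theorem rank_one_bracket:
  assumes sk: "skew_fun (ev2 V)"
    and J: "\<And>l m d. ev2 V m (l + d) * ev2 V l d - ev2 V l (m + d) * ev2 V m d = ev2 V l (- l - m) * ev2 V (l + m) d"
  shows "\<exists>v. V = const2 v * (2 * lam + del)"
proof -
  obtain a b where V: "\<And>l d. ev2 V l d = poly a l + poly b l * d"
    and b: "\<And>l m. (l - m) * (poly b l * poly b m) = ev2 V l (- l - m) * poly b (l + m)"
    using affine_in_del[of V "\<lambda>l m. ev2 V l (- l - m)", OF J] by metis
  note sk' = sk[unfolded skew_fun_def, rule_format, unfolded V]
  show ?thesis
  proof (cases "b = 0")
    case True
    have "poly a 0 = - poly a 0" using sk'[of 0 0] True by simp
    then have "poly a l = 0" for l using sk'[of l "-l"] True by simp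
    then have "V = 0" by (intro ev2_eqI) (simp add: V True ev2_simps)
    then show ?thesis by (intro exI[of _ 0]) (simp add: const2_def)
  next
    case False
    define b0 where "b0 = poly b 0"
    have "b * (a - [:0, 1:] * (b + [:b0:])) = 0"
      by (rule poly_eq_by_values) (use b[of _ 0] in \<open>simp add: V b0_def algebra_simps\<close>)
    then have "a = [:0, 1:] * (b + [:b0:])" using False by simp
    then have a: "poly a l = l * (poly b l + b0)" for l by simp
    \<comment> \<open>Adding the equation for \<open>(l, m)\<close> to the one for \<open>(m, l)\<close> makes the left-hand sides cancel.\<close>
    have e: "l * b0 - m * poly b l + m * b0 - l * poly b m = 0" for l m
    proof -
      have "([:l * b0, b0 - poly b l:] - smult l b) * pcompose b [:l, 1:] = 0"
      proof (rule poly_eq_by_values)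
        fix m
        have "(l - m) * (poly b l * poly b m) = (l * b0 - m * poly b l) * poly b (l + m)"
          "(m - l) * (poly b m * poly b l) = (m * b0 - l * poly b m) * poly b (l + m)"
          using b[of l m] b[of m l] by (simp_all add: V a algebra_simps)
        then show "poly (([:l * b0, b0 - poly b l:] - smult l b) * pcompose b [:l, 1:]) m = poly 0 m"
          by (simp add: poly_pcompose add.commute[of m l]) algebra
      qed
      moreover have "pcompose b [:l, 1:] \<noteq> 0"
      proof
        assume "pcompose b [:l, 1:] = 0"
        moreover have "poly b m = poly (pcompose b [:l, 1:]) (m - l)" for m by (simp add: poly_pcompose)
        ultimately have "poly b m = 0" for m by simp
        with False show False using poly_all_0_iff_0 by blast
      qed
      ultimately have "[:l * b0, b0 - poly b l:] - smult l b = 0" by simp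
      from arg_cong[OF this, of "\<lambda>p. poly p m"] show ?thesis by (simp add: algebra_simps)
    qed
    have "b - [:b0:] = 0"
    proof (rule infinitely_vanishing[of 0])
      fix l :: complex assume "l \<noteq> 0"
      have "2 * l * (poly b l - b0) = 0" using e[of l l] by algebra
      with \<open>l \<noteq> 0\<close> show "poly (b - [:b0:]) l = 0" by simp
    qed
    then have "V = const2 b0 * (2 * lam + del)"
      by (intro ev2_eqI) (simp add: V a ev2_simps algebra_simps)
    then show ?thesis by blast
  qed
qed

theorem rank_one_module_trivial:
  assumes J: "\<And>l m d. ev2 M m (l + d) * ev2 M l d - ev2 M l (m + d) * ev2 M m d = 0"
  shows "\<exists>a. M = at2 a lam"
proof -
  obtain a b where M: "\<And>l d. ev2 M l d = poly a l + poly b l * d"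
    and b: "\<And>l m. (l - m) * (poly b l * poly b m) = 0"
    using affine_in_del[of M "\<lambda>_ _. 0"] J by (metis mult_zero_left)
  have "b = 0"
  proof (rule ccontr)
    assume "b \<noteq> 0"
    then obtain l0 where l0: "poly b l0 \<noteq> 0" using poly_all_0_iff_0 by blast
    have "poly b m = 0" if "m \<noteq> l0" for m using b[of l0 m] l0 that by simp
    then have "b = 0" by (rule infinitely_vanishing)
    with \<open>b \<noteq> 0\<close> show False by simp
  qed
  then have "M = at2 a lam" by (intro ev2_eqI) (simp add: M ev2_at2 ev2_simps)
  then show ?thesis by blast
qed

text \<open>The coefficient \<open>b\<close> of \<open>\<partial>\<close> is multiplicative, so it is \<open>0\<close> or invertible, hence \<open>0\<close> or \<open>1\<close>; in the second case
  the constant term \<open>a\<close> is affine because its deviation \<open>\<alpha>\<close> from \<open>a(0)\<close> is odd and satisfies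
  \<open>(l - m) \<alpha>(l + m) = (l + m) \<alpha>(l - m)\<close>.\<close>

theorem rank_one_module_virasoro:
  assumes J: "\<And>l m d. ev2 M m (l + d) * ev2 M l d - ev2 M l (m + d) * ev2 M m d = ev2 (2 * lam + del) l (- l - m) * ev2 M (l + m) d"
  shows "M = 0 \<or> (\<exists>c d. M = vir_weight c d)"
proof -
  have s: "ev2 (2 * lam + del) l (- l - m) = l - m" for l m by (simp add: ev2_simps)
  obtain a b where M: "\<And>l d. ev2 M l d = poly a l + poly b l * d"
    and b: "\<And>l m. (l - m) * (poly b l * poly b m) = (l - m) * poly b (l + m)"
    and a: "\<And>l m. poly b m * l * poly a l - poly b l * m * poly a m = (l - m) * poly a (l + m)"
    using affine_in_del[of M "\<lambda>l m. l - m"] J unfolding s by metis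
  have b2: "poly b l * poly b m = poly b (l + m)" if "l \<noteq> m" for l m using b[of l m] that by simp
  show ?thesis
  proof (cases "poly b 0 = 0")
    case True
    have b0: "b = 0" by (rule infinitely_vanishing[of 0]) (use b2[of _ 0] True in auto)
    have "poly a t = 0" for t using a[of "t / 2 - 1" "t / 2 + 1"] b0 by simp
    then have "M = 0" by (intro ev2_eqI) (simp add: M b0 ev2_simps)
    then show ?thesis ..
  next
    case False
    then have b0: "poly b 0 = 1" using b2[of 1 0] b2[of "-1" 1] by auto
    have "b * pcompose b [:0, - 1:] = 1"
    proof (rule poly_eq_by_values)
      fix l
      show "poly (b * pcompose b [:0, - 1:]) l = poly 1 l"
        using b2[of l "-l"] b0 by (cases "l = 0") (auto simp: poly_pcompose)
    qed
    then have "b dvd 1" by (metis dvd_triv_left)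
    then obtain k where "b = [:k:]" using is_unit_poly_iff by blast
    with b0 have b1: "poly b l = 1" for l by simp
    note a' = a[unfolded b1 mult_1_left]
    define \<alpha> where "\<alpha> l = poly a l - poly a 0" for l
    have odd: "\<alpha> (- l) = - \<alpha> l" for l
    proof (cases "l = 0")
      case False
      have "l * (poly a l + poly a (- l) - 2 * poly a 0) = 0" using a'[of l "-l"] by (simp add: algebra_simps)
      with False have "poly a l + poly a (- l) - 2 * poly a 0 = 0" by (metis mult_eq_0_iff)
      then show ?thesis unfolding \<alpha>_def by algebra
    qed (simp add: \<alpha>_def)
    have lin: "l * \<alpha> l - m * \<alpha> m = (l - m) * \<alpha> (l + m)" for l m
      using a'[of l m] by (simp add: \<alpha>_def algebra_simps)
    have \<alpha>: "\<alpha> u = \<alpha> 1 * u" for u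
    proof -
      define x y where "x = (u + 1) / 2" and "y = (u - 1) / 2"
      have xy: "x - y = 1" "x + y = u" by (simp_all add: x_def y_def field_simps)
      show ?thesis using lin[of x y] lin[of x "- y"] xy by (simp add: odd)
    qed
    have "M = vir_weight (\<alpha> 1) (poly a 0)"
    proof (rule ev2_eqI)
      fix l d
      have "poly a l = \<alpha> 1 * l + poly a 0" using \<alpha>[of l] by (simp add: \<alpha>_def algebra_simps)
      then show "ev2 M l d = ev2 (vir_weight (\<alpha> 1) (poly a 0)) l d" unfolding M b1 ev2_simps by simp
    qed
    then show ?thesis by blast
  qed
qed

text \<open>Used to see that \<open>Q(-\<partial>, \<partial> - s)\<close>, for a number \<open>s\<close>, is a polynomial in \<open>\<partial>\<close>.\<close>

lemma poly_along_curve: "\<exists>g. \<forall>t. poly g t = ev2 Q (poly u t) (poly v t)"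
proof (induction Q)
  case 0 show ?case by (intro exI[of _ 0]) (simp add: ev2_simps)
next
  case (pCons p Q)
  then obtain g where "\<And>t. poly g t = ev2 Q (poly u t) (poly v t)" by blast
  then show ?case by (intro exI[of _ "pcompose p v + u * g"]) (simp add: ev2_def poly_pcompose)
qed

text \<open>Put \<open>F(l, m) = Q(l, -l-m)\<close> and \<open>s = -l-m-x\<close>. The equation is
  \<open>F(l,m) a(s) = F(l,s) a(m) - F(m,s) a(l)\<close>, and fixing \<open>s\<close> with \<open>a(s) \<noteq> 0\<close> writes \<open>F\<close> as a coboundary.\<close>

theorem solvable_cocycle_trivial:
  assumes "a \<noteq> 0"
    and J: "\<And>l m x. ev2 Q m (l + x) * poly a l - ev2 Q l (m + x) * poly a m = - ev2 Q l (- l - m) * poly a (- l - m - x)"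
  shows "\<exists>g. Q = coboundary (at2 a lam) 0 g"
proof -
  obtain s where s: "poly a s \<noteq> 0" using assms(1) poly_all_0_iff_0 by blast
  obtain g where g: "\<And>t. poly g t = ev2 Q (poly [:0, -1:] t) (poly [:- s, 1:] t)"
    using poly_along_curve by metis
  have "Q = coboundary (at2 a lam) 0 (smult (- 1 / poly a s) g)"
  proof (rule ev2_eqI)
    fix l d
    \<comment> \<open>\<open>m = -l-d\<close> makes \<open>Q\<close> on the right appear at \<open>(l, d)\<close>, and \<open>x = d - s\<close> makes the argument of \<open>a\<close> there equal to \<open>s\<close>.\<close>
    have "ev2 Q (- l - d) (l + d - s) * poly a l - ev2 Q l (- l - s) * poly a (- l - d) = - ev2 Q l d * poly a s"
      using J[of "- l - d" l "d - s"] by (simp add: algebra_simps)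
    moreover have at: "poly [:0, -1:] (l + d) = - l - d" "poly [:- s, 1:] (l + d) = l + d - s"
      "poly [:0, -1:] (- l) = l" "poly [:- s, 1:] (- l) = - l - s" by simp_all
    moreover have "poly g (l + d) = ev2 Q (- l - d) (l + d - s)" "poly g (- l) = ev2 Q l (- l - s)"
      unfolding g at by simp_all
    ultimately show "ev2 Q l d = ev2 (coboundary (at2 a lam) 0 (smult (- 1 / poly a s) g)) l d"
      using s unfolding ev2_coboundary ev2_at2 by (simp add: ev2_simps field_simps)
  qed
  then show ?thesis by blast
qed

text \<open>At \<open>m = 0\<close> the equation reads \<open>\<partial> Q(\<lambda>,\<partial>) = (2\<lambda>+\<partial>) Q(0,\<partial>)\<close>, and \<open>Q(0,\<partial>)\<close> is divisible by \<open>\<partial>\<close>.\<close>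

theorem trivial_cocycle_virasoro:
  assumes J: "\<And>l m x. ev2 (2 * lam + del) m (l + x) * ev2 Q l x - ev2 (2 * lam + del) l (m + x) * ev2 Q m x
       = ev2 (2 * lam + del) l (- l - m) * ev2 Q (l + m) x"
  shows "\<exists>g. Q = coboundary 0 (2 * lam + del) g"
proof -
  have E: "x * ev2 Q l x = (2 * l + x) * poly (coeff Q 0) x" for l x
    using J[of 0 l x] by (simp add: ev2_simps ev2_0_left[of Q] algebra_simps)
  have "poly (coeff Q 0) 0 = 0" using E[of 0 1] by simp
  then obtain r where r: "coeff Q 0 = [:0, 1:] * r" by (metis dvdE minus_zero poly_eq_0_iff_dvd)
  have "del * (Q - coboundary 0 (2 * lam + del) (- r)) = 0"
    by (rule ev2_eqI) (use E in \<open>simp add: ev2_simps ev2_coboundary r algebra_simps\<close>)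
  moreover have "del \<noteq> 0" by (simp add: del_def)
  ultimately have "Q = coboundary 0 (2 * lam + del) (- r)" by simp
  then show ?thesis by blast
qed

section \<open>Abelian ideals\<close>

text \<open>A functional on \<open>R\<close> that factors through \<open>\<partial> = d\<close>. Applied coefficientwise, such functionals turn the axioms,
  which are identities in \<open>R[\<lambda>]\<close> and \<open>R[\<lambda>,\<mu>]\<close>, into equations between complex numbers.\<close>

definition point_eval :: "'a::ab_group_add conf_alg \<Rightarrow> complex \<Rightarrow> ('a \<Rightarrow> complex) \<Rightarrow> bool" where
  "point_eval R d h \<longleftrightarrow> additive_map h \<and> (\<forall>p r. h (act R p r) = poly p d * h r)"

context lie_conformal_algebra
begin

lemma act_pCons: "act R (pCons z p) a = cscale R z a + deriv_op R (act R p a)"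
proof -
  have "pCons z p = [:z:] + [:0, 1:] * p" by simp
  then show ?thesis unfolding cscale_def deriv_op_def by (metis scale_left_distrib scale_scale)
qed

lemma cscale_zero_right: "cscale R z 0 = 0" and deriv_op_zero: "deriv_op R 0 = 0"
  by (simp_all add: cscale_def deriv_op_def)

lemma br_zero_left: "br R 0 b = 0" using br_add_left[of 0 0 b] by simp
lemma br_zero_right: "br R a 0 = 0" using br_add_right[of a 0 0] by simp

lemma point_eval_additive: "point_eval R d h \<Longrightarrow> additive_map h"
  by (simp add: point_eval_def)

lemma point_eval_cscale: "point_eval R d h \<Longrightarrow> h (cscale R z r) = z * h r"
  by (simp add: point_eval_def cscale_def)

lemma point_eval_deriv: "point_eval R d h \<Longrightarrow> h (deriv_op R r) = d * h r"
  by (simp add: point_eval_def deriv_op_def)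

lemma ev_cscale: "point_eval R d h \<Longrightarrow> ev1 h l (map_poly (cscale R z) P) = z * ev1 h l P"
  by (simp add: ev1_map[of "cscale R z"] cscale_zero_right point_eval_additive point_eval_cscale ev1_scale)

lemma ev_deriv: "point_eval R d h \<Longrightarrow> ev1 h l (map_poly (deriv_op R) P) = d * ev1 h l P"
  by (simp add: ev1_map[of "deriv_op R"] deriv_op_zero point_eval_additive point_eval_deriv ev1_scale)

lemma ev_lambda: "point_eval R d h \<Longrightarrow> ev1 h l (pCons 0 P) = l * ev1 h l P"
  using ev1_pCons[OF point_eval_additive, of d h l 0 P] additive_map_0[OF point_eval_additive, of d h] by simp

lemma ev_additive: "point_eval R d h \<Longrightarrow> additive_map (ev1 h l)"
  by (intro additive_map_ev point_eval_additive)

lemma ev_br_act_left: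
  assumes h: "point_eval R d h"
  shows "ev1 h l (br R (act R p a) b) = poly p (- l) * ev1 h l (br R a b)"
proof (induction p)
  case 0 then show ?case by (simp add: br_zero_left ev1_0)
next
  case (pCons z p)
  then show ?case
    by (simp add: act_pCons br_add_left br_scale_left br_deriv_left additive_map_add[OF ev_additive[OF h]]
      additive_map_minus[OF ev_additive[OF h]] ev_cscale[OF h] ev_lambda[OF h] algebra_simps)
qed

lemma ev_br_act_right:
  assumes h: "point_eval R d h"
  shows "ev1 h l (br R a (act R p b)) = poly p (l + d) * ev1 h l (br R a b)"
proof (induction p)
  case 0 then show ?case by (simp add: br_zero_right ev1_0)
next
  case (pCons z p)
  then show ?case
    by (simp add: act_pCons br_add_right br_scale_right br_deriv_right additive_map_add[OF ev_additive[OF h]]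
      ev_cscale[OF h] ev_deriv[OF h] ev_lambda[OF h] algebra_simps)
qed

lemma ev_skew:
  assumes h: "point_eval R d h"
  shows "ev1 h l (br R b a) = - ev1 h (- l - d) (br R a b)"
proof -
  have "ev1 h l (subst_op (neg_lam_del R) (\<lambda>r. [:r:]) (br R a b)) = ev1 h (- l - d) (br R a b)"
  proof (rule subst_ev)
    show "ev1 h l (neg_lam_del R x) = (- l - d) * ev1 h l x" for x
      by (simp add: neg_lam_del_def additive_map_diff[OF ev_additive[OF h]] additive_map_minus[OF ev_additive[OF h]]
        ev_lambda[OF h] ev_deriv[OF h] algebra_simps)
  qed (simp_all add: ev_additive[OF h] point_eval_additive[OF h] ev1_const)
  then show ?thesis
    by (subst skew_symmetry) (simp add: additive_map_minus[OF ev_additive[OF h]])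
qed

lemma ev_br_additive:
  assumes h: "point_eval R d h"
  shows "additive_map (\<lambda>r. ev1 h l (br R a r))" and "additive_map (\<lambda>r. ev1 h l (br R r a))"
  by (simp_all add: additive_map_def br_add_left br_add_right additive_map_add[OF ev_additive[OF h]])

lemma ev_jacobi:
  assumes h: "point_eval R d h"
  shows "ev1 (\<lambda>r. ev1 h l (br R a r)) m (br R b c) - ev1 (\<lambda>r. ev1 h m (br R b r)) l (br R a c)
    = ev1 (\<lambda>t. ev1 h (l + m) (br R t c)) l (br R a b)"
proof -
  note ad = ev_additive[OF h] additive_map_ev[OF ev_additive[OF h]]
  have h0: "h 0 = 0" by (rule additive_map_0[OF point_eval_additive[OF h]])
  have lm: "ev1 (ev1 h l) m (mult_lam P) = l * ev1 (ev1 h l) m P" for P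
    unfolding mult_lam_def by (simp add: ev1_map[of "pCons 0"] ad ev_lambda[OF h] ev1_scale)
  have mm: "ev1 (ev1 h l) m (mult_mu P) = m * ev1 (ev1 h l) m P" for P
    unfolding mult_mu_def by (simp add: ev1_pCons ad ev1_0)
  have lmm: "ev1 (ev1 h l) m (mult_lam_mu P) = (l + m) * ev1 (ev1 h l) m P" for P
    unfolding mult_lam_mu_def by (simp add: additive_map_add[OF ad(2)] lm mm algebra_simps)
  have 1: "ev1 (ev1 h l) m (subst_op mult_mu (\<lambda>r. [:br R a r:]) (br R b c)) = ev1 (\<lambda>r. ev1 h l (br R a r)) m (br R b c)"
    by (rule subst_ev) (simp_all add: ad mm ev1_const ev_br_additive[OF h])
  have 2: "ev1 (ev1 h l) m (subst_op mult_lam (\<lambda>s. map_poly (\<lambda>u. [:u:]) (br R b s)) (br R a c)) = ev1 (\<lambda>r. ev1 h m (br R b r)) l (br R a c)"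
    by (rule subst_ev) (simp_all add: ad lm ev_br_additive[OF h] ev1_map[of "\<lambda>u. [:u:]"] ev1_const point_eval_additive[OF h])
  have 3: "ev1 (ev1 h l) m (subst_op mult_lam_mu (\<lambda>u. [:[:u:]:]) (br R t c)) = ev1 h (l + m) (br R t c)" for t
    by (rule subst_ev) (simp_all add: ad lmm ev1_const point_eval_additive[OF h])
  have 4: "ev1 (ev1 h l) m (subst_op mult_lam (\<lambda>t. subst_op mult_lam_mu (\<lambda>u. [:[:u:]:]) (br R t c)) (br R a b))
      = ev1 (\<lambda>t. ev1 h (l + m) (br R t c)) l (br R a b)"
    by (rule subst_ev) (simp_all add: ad lm 3 ev_br_additive[OF h])
  from arg_cong[OF jacobi, of "ev1 (ev1 h l) m" a b c]
  show ?thesis unfolding additive_map_diff[OF ad(2)] 1 2 4 .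
qed

lemma cscale_module: "module (cscale R)"
  unfolding cscale_def
proof
  fix x y :: 'a and a b :: complex
  show "act R [:a:] (x + y) = act R [:a:] x + act R [:a:] y" by (rule scale_right_distrib)
  show "act R [:a + b:] x = act R [:a:] x + act R [:b:] x"
    using scale_left_distrib[of "[:a:]" "[:b:]" x] by simp
  show "act R [:a:] (act R [:b:] x) = act R [:a * b:] x" by (simp add: mult.commute)
  show "act R [:1:] x = x" by (metis one_pCons scale_one)
qed

lemma cscale_fact: "cscale R (1 / fact n) (cscale R (fact n) x) = x"
  using module.scale_scale[OF cscale_module, of "1 / fact n" "fact n" x] module.scale_one[OF cscale_module] by simp

lemma ideal_subspace: "conf_ideal R S \<Longrightarrow> subspace S"
  by (simp add: conf_ideal_def)

text \<open>\<open>n\<close>-th products and coefficients of the bracket differ by the invertible factor \<open>n!\<close>.\<close>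

lemma ideal_coeff: "conf_ideal R S \<Longrightarrow> b \<in> S \<Longrightarrow> coeff (br R a b) n \<in> S"
  unfolding conf_ideal_def nth_product_def using cscale_fact[of n] subspace_scale
  by (metis cscale_def)

lemma derived_subspace: "module.subspace (cscale R) (derived R S)"
  unfolding derived_def cspan_def by (rule module.subspace_span[OF cscale_module])

lemma derived_coeff: "a \<in> S \<Longrightarrow> b \<in> S \<Longrightarrow> coeff (br R a b) n \<in> derived R S"
proof -
  assume "a \<in> S" "b \<in> S"
  then have "nth_product R a n b \<in> derived R S"
    unfolding derived_def cspan_def by (intro module.span_base[OF cscale_module]) blast
  then have "cscale R (1 / fact n) (nth_product R a n b) \<in> derived R S"
    by (rule module.subspace_scale[OF cscale_module derived_subspace])
  then show ?thesis by (simp add: nth_product_def cscale_fact)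
qed

lemma derived_induct [consumes 1, case_names zero coeff add scale]:
  assumes "x \<in> derived R S" "P 0" "\<And>a b n. a \<in> S \<Longrightarrow> b \<in> S \<Longrightarrow> P (coeff (br R a b) n)"
    "\<And>x y. P x \<Longrightarrow> P y \<Longrightarrow> P (x + y)" "\<And>z x. P x \<Longrightarrow> P (cscale R z x)"
  shows "P x"
proof -
  have "module.span (cscale R) {nth_product R a n b |a b n. a \<in> S \<and> b \<in> S} \<subseteq> {x. P x}"
    by (rule module.span_minimal[OF cscale_module])
      (use assms(2-) in \<open>auto simp: nth_product_def module.subspace_def[OF cscale_module]\<close>)
  with assms(1) show ?thesis by (auto simp: derived_def cspan_def)
qed

definition coeffs2_in :: "'a set \<Rightarrow> 'a poly poly \<Rightarrow> bool" where
  "coeffs2_in T P \<longleftrightarrow> (\<forall>i j. coeff (coeff P i) j \<in> T)"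

lemma coeffs2_in_subst_op:
  assumes T: "module.subspace (cscale R) T"
    and step: "\<And>P. coeffs2_in T P \<Longrightarrow> coeffs2_in T (f P)" and "\<And>n. coeffs2_in T (g (coeff P n))"
  shows "coeffs2_in T (subst_op f g P)"
proof -
  have "coeffs2_in T ((f ^^ n) (g (coeff P n)))" for n
  proof -
    have "coeffs2_in T X \<Longrightarrow> coeffs2_in T ((f ^^ n) X)" for X by (induction n) (auto intro: step)
    then show ?thesis using assms(3) .
  qed
  then show ?thesis unfolding coeffs2_in_def subst_op_def coeff_sum
    by (intro allI module.subspace_sum[OF cscale_module T]) blast
qed

lemma coeffs2_in_mult_lam:
  assumes T: "module.subspace (cscale R) T" and P: "coeffs2_in T P" shows "coeffs2_in T (mult_lam P)"
proof -
  have "coeff (coeff (mult_lam P) i) j = (case j of 0 \<Rightarrow> 0 | Suc k \<Rightarrow> coeff (coeff P i) k)" for i j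
    by (simp add: mult_lam_def coeff_map_poly coeff_pCons)
  with P module.subspace_0[OF cscale_module T] show ?thesis
    by (simp add: coeffs2_in_def split: nat.split)
qed

lemma coeffs2_in_mult_lam_mu:
  assumes T: "module.subspace (cscale R) T" and P: "coeffs2_in T P" shows "coeffs2_in T (mult_lam_mu P)"
proof -
  have "coeff (coeff (mult_mu P) i) j \<in> T" for i j
    using P module.subspace_0[OF cscale_module T] by (cases i) (simp_all add: mult_mu_def coeffs2_in_def)
  with coeffs2_in_mult_lam[OF T P] module.subspace_add[OF cscale_module T] show ?thesis
    by (simp add: coeffs2_in_def mult_lam_mu_def)
qed

lemma coeff_subst_op_mult_mu:
  fixes F :: "'a \<Rightarrow> 'a poly"
  assumes "F 0 = 0" shows "coeff (subst_op mult_mu (\<lambda>r. [:F r:]) P) n = F (coeff P n)"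
proof -
  have "(mult_mu ^^ k) [:x:] = monom x k" for k and x :: "'a poly"
    by (induction k) (simp_all add: mult_mu_def monom_Suc monom_0)
  then have "coeff (subst_op mult_mu (\<lambda>r. [:F r:]) P) n = (\<Sum>k\<le>degree P. if k = n then F (coeff P k) else 0)"
    by (simp add: subst_op_def coeff_sum)
  then show ?thesis using assms by (simp add: coeff_eq_0)
qed

text \<open>The Jacobi identity writes \<open>[a\<^sub>\<lambda> [b\<^sub>\<mu> c]]\<close>, for \<open>b, c \<in> S\<close>, through brackets of elements of \<open>S\<close>.\<close>

theorem derived_ideal:
  assumes S: "conf_ideal R S" shows "conf_ideal R (derived R S)"
proof -
  note sub = derived_subspace[of S]
  note D = module.subspace_0[OF cscale_module sub] module.subspace_add[OF cscale_module sub]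
    module.subspace_scale[OF cscale_module sub] module.subspace_diff[OF cscale_module sub]
  have "deriv_op R x \<in> derived R S" if "x \<in> derived R S" for x
    using that
  proof (induction rule: derived_induct)
    case (coeff a b n)
    have "deriv_op R b \<in> S" unfolding deriv_op_def by (rule subspace_scale[OF ideal_subspace[OF S] coeff(2)])
    have "coeff (br R a (deriv_op R b)) n = coeff (pCons 0 (br R a b)) n + deriv_op R (coeff (br R a b) n)"
      unfolding br_deriv_right by (simp add: coeff_map_poly deriv_op_zero)
    then have "deriv_op R (coeff (br R a b) n) = coeff (br R a (deriv_op R b)) n - coeff (pCons 0 (br R a b)) n" by simp
    moreover have "coeff (pCons 0 (br R a b)) n \<in> derived R S"
      by (cases n) (simp_all add: D derived_coeff coeff)
    ultimately show ?case using D(4) derived_coeff[OF coeff(1) \<open>deriv_op R b \<in> S\<close>] by simp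
  next
    case (add x y)
    then show ?case by (simp add: deriv_op_def scale_right_distrib D)
  next
    case (scale z x)
    have "deriv_op R (cscale R z x) = cscale R z (deriv_op R x)" unfolding deriv_op_def cscale_def by (rule scale_left_commute)
    with scale show ?case by (simp add: D)
  qed (simp add: deriv_op_zero D)
  then have act: "act R p x \<in> derived R S" if "x \<in> derived R S" for p x
    by (induction p) (simp_all add: D act_pCons that)
  have br: "coeff (br R a x) j \<in> derived R S" if "x \<in> derived R S" for a x j
    using that
  proof (induction arbitrary: j rule: derived_induct)
    case zero show ?case by (simp add: br_zero_right D)
  next
    case (add x y) then show ?case by (simp add: br_add_right D)
  next
    case (scale z x) then show ?case by (simp add: br_scale_right coeff_map_poly cscale_zero_right D)
  next
    case (coeff b c n)
    have 2: "coeffs2_in (derived R S) (subst_op mult_lam (\<lambda>s. map_poly (\<lambda>u. [:u:]) (br R b s)) (br R a c))"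
    proof (rule coeffs2_in_subst_op[OF sub coeffs2_in_mult_lam[OF sub]])
      fix n
      have "coeff (br R a c) n \<in> S" using ideal_coeff[OF S coeff(2)] .
      then show "coeffs2_in (derived R S) (map_poly (\<lambda>u. [:u:]) (br R b (coeff (br R a c) n)))"
        unfolding coeffs2_in_def by (auto simp: coeff_map_poly coeff_pCons D derived_coeff coeff split: nat.splits)
    qed
    have t: "coeffs2_in (derived R S) (subst_op mult_lam_mu (\<lambda>u. [:[:u:]:]) (br R t c))" if "t \<in> S" for t
      by (rule coeffs2_in_subst_op[OF sub coeffs2_in_mult_lam_mu[OF sub]])
        (auto simp: coeffs2_in_def coeff_pCons D derived_coeff that coeff split: nat.splits)
    have 3: "coeffs2_in (derived R S) (subst_op mult_lam (\<lambda>t. subst_op mult_lam_mu (\<lambda>u. [:[:u:]:]) (br R t c)) (br R a b))"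
    proof (rule coeffs2_in_subst_op[OF sub coeffs2_in_mult_lam[OF sub]])
      show "coeffs2_in (derived R S) (subst_op mult_lam_mu (\<lambda>u. [:[:u:]:]) (br R (coeff (br R a b) n) c))" for n
        by (rule t[OF ideal_coeff[OF S coeff(1)]])
    qed
    have "br R a (coeff (br R b c) n) = coeff (subst_op mult_mu (\<lambda>r. [:br R a r:]) (br R b c)) n"
      by (rule coeff_subst_op_mult_mu[symmetric]) (rule br_zero_right)
    also have "\<dots> = coeff (subst_op mult_lam (\<lambda>t. subst_op mult_lam_mu (\<lambda>u. [:[:u:]:]) (br R t c)) (br R a b)) n
        + coeff (subst_op mult_lam (\<lambda>s. map_poly (\<lambda>u. [:u:]) (br R b s)) (br R a c)) n"
      using arg_cong[OF jacobi[of a b c], of "\<lambda>P. coeff P n"] by (simp add: algebra_simps)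
    finally show ?case using 2 3 by (simp add: coeffs2_in_def D)
  qed
  have "subspace (derived R S)" using D(1,2) act by (rule subspaceI)
  then show ?thesis unfolding conf_ideal_def nth_product_def using br D(3) by blast
qed

text \<open>The last non-zero term of the derived series of a solvable ideal.\<close>

theorem abelian_ideal_exists:
  assumes "\<not> semisimple R"
  obtains T where "conf_ideal R T" "T \<noteq> {0}" "\<And>a b. a \<in> T \<Longrightarrow> b \<in> T \<Longrightarrow> br R a b = 0"
proof -
  from assms obtain S n where S: "conf_ideal R S" "S \<noteq> {0}" and n: "(derived R ^^ n) S = {0}"
    by (auto simp: semisimple_def solvable_on_def derived_series_def)
  define k where "k = (LEAST n. (derived R ^^ n) S = {0})"
  have k: "(derived R ^^ k) S = {0}" unfolding k_def by (rule LeastI[of _ n]) (rule n)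
  with S(2) obtain j where j: "k = Suc j" by (cases k) auto
  let ?T = "(derived R ^^ j) S"
  have "conf_ideal R ((derived R ^^ i) S)" for i by (induction i) (simp_all add: S derived_ideal)
  moreover have "?T \<noteq> {0}" using not_less_Least[of j "\<lambda>n. (derived R ^^ n) S = {0}"] j by (auto simp: k_def)
  moreover have "br R a b = 0" if "a \<in> ?T" "b \<in> ?T" for a b
    using derived_coeff[OF that] k unfolding j by (intro poly_eqI) simp
  ultimately show ?thesis using that by blast
qed

end

section \<open>A triangular basis\<close>

text \<open>A generator of the ideal \<open>(p, q)\<close>, found as an element of least degree.\<close>

lemma bezout_complex_poly:
  fixes p q :: "complex poly"
  assumes "p \<noteq> 0 \<or> q \<noteq> 0"
  obtains g p' q' u v where "p = g * p'" "q = g * q'" "u * p' + v * q' = 1" "g \<noteq> 0"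
proof -
  define W where "W w \<longleftrightarrow> w \<noteq> 0 \<and> (\<exists>u v. w = u * p + v * q)" for w
  have "W p \<or> W q" unfolding W_def using assms by (metis add.left_neutral add.right_neutral mult_1 mult_zero_left)
  then obtain w where w: "W w" and min: "\<And>z. W z \<Longrightarrow> degree w \<le> degree z"
    using ex_has_least_nat[of W _ degree] by metis
  then obtain u v where uv: "w = u * p + v * q" and w0: "w \<noteq> 0" by (auto simp: W_def)
  have dvd: "w dvd u' * p + v' * q" for u' v'
  proof (rule ccontr)
    let ?z = "u' * p + v' * q"
    assume "\<not> w dvd ?z"
    then have n: "?z mod w \<noteq> 0" by (simp add: dvd_eq_mod_eq_0)
    have "?z mod w = ?z - ?z div w * w" by (simp add: minus_div_mult_eq_mod)
    also have "\<dots> = (u' - ?z div w * u) * p + (v' - ?z div w * v) * q" by (simp add: uv algebra_simps)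
    finally have "W (?z mod w)" unfolding W_def using n by blast
    from min[OF this] degree_mod_less[OF w0, of ?z] n show False by simp
  qed
  obtain p' q' where pq: "p = w * p'" "q = w * q'" using dvd[of 1 0] dvd[of 0 1] unfolding dvd_def by auto
  have "w * (u * p' + v * q') = u * (w * p') + v * (w * q')" by (simp add: algebra_simps)
  then have "w * (u * p' + v * q') = w * 1" unfolding pq[symmetric] uv[symmetric] by simp
  then have "u * p' + v * q' = 1" using w0 by (metis mult_left_cancel)
  with that pq w0 show ?thesis by blast
qed

text \<open>The same thing as an ordered basis of two elements, but easier to transform.\<close>

definition coordinates :: "'a::ab_group_add conf_alg \<Rightarrow> ('a \<Rightarrow> complex poly \<times> complex poly) \<Rightarrow> bool" where
  "coordinates R f \<longleftrightarrow> bij f \<and> (\<forall>x y. f (x + y) = f x + f y) \<and> (\<forall>p x. f (act R p x) = (p * fst (f x), p * snd (f x)))"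

lemma coordinates_eval:
  assumes "coordinates R f"
  shows "point_eval R d (\<lambda>r. fst_at d (f r))" "point_eval R d (\<lambda>r. snd_at d (f r))"
  using assms by (simp_all add: point_eval_def additive_map_def coordinates_def fst_at_def snd_at_def)

lemma coordinates_zero: "coordinates R f \<Longrightarrow> f 0 = 0"
  unfolding coordinates_def by (metis add_cancel_right_right)

context lie_conformal_algebra
begin

lemma coordinates_exist:
  assumes "has_rank R 2" obtains f where "coordinates R f"
proof -
  from assms obtain X where X: "finite X" "card X = 2" "\<not> dependent X" "span X = UNIV"
    by (auto simp: has_rank_def is_basis_def)
  then obtain A B where AB: "X = {A, B}" "A \<noteq> B" by (auto simp: card_2_iff)
  define G where "G z = act R (fst z) A + act R (snd z) B" for z
  have G: "G (z + w) = G z + G w" "G (p * fst z, p * snd z) = act R p (G z)" for z w p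
    by (simp_all add: G_def scale_left_distrib scale_right_distrib algebra_simps)
  have "inj G"
  proof (rule injI)
    fix z w assume "G z = G w"
    then have "act R (fst z - fst w) A + act R (snd z - snd w) B = 0"
      by (simp add: G_def scale_left_diff_distrib algebra_simps)
    moreover have "fst z - fst w = 0 \<and> snd z - snd w = 0"
      if "act R (fst z - fst w) A + act R (snd z - snd w) B = 0"
    proof -
      let ?u = "\<lambda>x. if x = A then fst z - fst w else snd z - snd w"
      have "(\<Sum>x\<in>X. act R (?u x) x) = 0" unfolding AB(1) using that AB(2) by simp
      then have "dependent X" if "\<exists>x\<in>X. ?u x \<noteq> 0"
        unfolding dependent_finite[OF X(1)] using that by (intro exI[of _ ?u] conjI)
      then have "\<forall>x\<in>X. ?u x = 0" using X(3) by blast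
      from bspec[OF this, of A] bspec[OF this, of B] show ?thesis using AB by simp
    qed
    ultimately show "z = w" by (simp add: prod_eq_iff)
  qed
  moreover have "surj G"
  proof (rule surjI)
    fix r
    have "r \<in> span X" using X(4) by simp
    then obtain p where "r - act R p A \<in> span {B}" unfolding AB(1) span_breakdown_eq[of r A] by blast
    then obtain q where "r - act R p A = act R q B" unfolding span_singleton by blast
    then have "G (p, q) = r" by (simp add: G_def algebra_simps)
    then have "\<exists>z. G z = r" by blast
    then show "G (SOME z. G z = r) = r" by (rule someI_ex)
  qed
  ultimately have G_bij: "bij G" by (simp add: bij_def)
  then have inv: "inv G (G z) = z" "G (inv G r) = r" for z r by (simp_all add: bij_is_inj bij_is_surj surj_f_inv_f)
  have "coordinates R (inv G)" unfolding coordinates_def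
  proof (intro conjI allI)
    show "bij (inv G)" using G_bij by (rule bij_imp_bij_inv)
    show "inv G (x + y) = inv G x + inv G y" for x y by (metis G(1) inv)
    show "inv G (act R p x) = (p * fst (inv G x), p * snd (inv G x))" for p x by (metis G(2) inv)
  qed
  then show ?thesis by (rule that)
qed

text \<open>Every non-zero element is a polynomial multiple of a member of some basis: its coordinates divided by
  their greatest common divisor form the first column of a matrix of determinant \<open>1\<close>.\<close>

lemma adapted_coordinates:
  assumes f: "coordinates R f" and "a \<noteq> 0"
  obtains f' g where "coordinates R f'" "f' a = (g, 0)" "g \<noteq> 0"
proof -
  have "f a \<noteq> 0" using assms coordinates_zero[OF f] unfolding coordinates_def by (metis bij_is_inj injD)
  then have "fst (f a) \<noteq> 0 \<or> snd (f a) \<noteq> 0" by (simp add: prod_eq_iff)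
  then obtain g p q u v where g: "fst (f a) = g * p" "snd (f a) = g * q" "u * p + v * q = 1" "g \<noteq> 0"
    by (rule bezout_complex_poly)
  define H where "H z = (u * fst z + v * snd z, p * snd z - q * fst z)" for z
  have "bij H"
  proof (rule o_bij)
    \<comment> \<open>the inverse matrix, by Cramer's rule and determinant \<open>1\<close>\<close>
    let ?K = "\<lambda>z. (p * fst z - v * snd z, q * fst z + u * snd z)"
    have g3: "(u * p + v * q) * x = x" for x using g(3) by simp
    show "?K \<circ> H = id" using g3 by (simp add: H_def fun_eq_iff algebra_simps)
    show "H \<circ> ?K = id" using g3 by (simp add: H_def fun_eq_iff algebra_simps)
  qed
  with f have "coordinates R (H \<circ> f)"
    by (simp add: coordinates_def bij_comp H_def algebra_simps)
  moreover have "(H \<circ> f) a = (g, 0)"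
    using g by (simp add: H_def algebra_simps flip: distrib_left)
  ultimately show ?thesis using that g(4) by blast
qed

lemma coordinates_expand:
  assumes f: "coordinates R f" and A: "f A = (1, 0)" and B: "f B = (0, 1)"
  shows "r = act R (fst (f r)) A + act R (snd (f r)) B"
proof -
  have "f r = f (act R (fst (f r)) A + act R (snd (f r)) B)"
    using f A B by (simp add: coordinates_def)
  then show ?thesis using f unfolding coordinates_def by (metis bij_is_inj injD)
qed

lemma ev_br_expand:
  assumes f: "coordinates R f" and A: "f A = (1, 0)" and B: "f B = (0, 1)" and h: "point_eval R d h"
  shows "ev1 h l (br R a b)
    = fst_at (- l) (f a) * fst_at (l + d) (f b) * ev1 h l (br R A A)
    - fst_at (- l) (f a) * snd_at (l + d) (f b) * ev1 h (- l - d) (br R B A)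
    + snd_at (- l) (f a) * fst_at (l + d) (f b) * ev1 h l (br R B A)
    + snd_at (- l) (f a) * snd_at (l + d) (f b) * ev1 h l (br R B B)"
  by (subst coordinates_expand[OF f A B, of a], subst coordinates_expand[OF f A B, of b])
    (simp add: br_add_left br_add_right additive_map_add[OF ev_additive[OF h]] ev_br_act_left[OF h] ev_br_act_right[OF h]
      ev_skew[OF h, of l A B] fst_at_def snd_at_def algebra_simps)

lemma ev_coordinates:
  assumes f: "coordinates R f"
  shows "ev1 (\<lambda>r. fst_at d (f r)) l P = ev2 (map_poly (\<lambda>r. fst (f r)) P) l d"
    and "ev1 (\<lambda>r. snd_at d (f r)) l P = ev2 (map_poly (\<lambda>r. snd (f r)) P) l d"
proof -
  have p: "ev1 (\<lambda>x. poly x d) l P = ev2 P l d" for P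
    using ev1_pair(1)[of d l P 0]
  proof (induction P)
    case (pCons a P)
    have "additive_map (\<lambda>x::complex poly. poly x d)" by (simp add: additive_map_def)
    with pCons show ?case by (simp add: ev1_pCons ev2_def ev1_pair)
  qed (simp add: ev1_0 ev2_simps)
  have ad: "additive_map (\<lambda>x::complex poly. poly x d)" by (simp add: additive_map_def)
  show "ev1 (\<lambda>r. fst_at d (f r)) l P = ev2 (map_poly (\<lambda>r. fst (f r)) P) l d"
    unfolding p[symmetric] fst_at_def by (simp add: ev1_map[OF _ ad] coordinates_zero[OF f])
  show "ev1 (\<lambda>r. snd_at d (f r)) l P = ev2 (map_poly (\<lambda>r. snd (f r)) P) l d"
    unfolding p[symmetric] snd_at_def by (simp add: ev1_map[OF _ ad] coordinates_zero[OF f])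
qed

text \<open>The coordinates are adapted to a non-zero element \<open>a = g(\<partial>)A\<close> of an abelian ideal, and \<open>g\<close> is cancelled.\<close>

theorem rank2_presentation:
  assumes rank: "has_rank R 2" and ns: "\<not> semisimple R"
  obtains f M Q V where "conf_hom R (rank2 M Q V) f" "bij f"
proof -
  obtain T where T: "conf_ideal R T" "T \<noteq> {0}" and ab: "\<And>a b. a \<in> T \<Longrightarrow> b \<in> T \<Longrightarrow> br R a b = 0"
    using abelian_ideal_exists[OF ns] by metis
  have "0 \<in> T" using T(1) by (auto simp: conf_ideal_def subspace_def)
  with T(2) obtain a where a: "a \<in> T" "a \<noteq> 0" by auto
  obtain f g where f: "coordinates R f" and fa: "f a = (g, 0)" and g: "g \<noteq> 0"
    using coordinates_exist[OF rank] adapted_coordinates a(2) by metis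
  obtain A B where A: "f A = (1, 0)" and B: "f B = (0, 1)" using f unfolding coordinates_def by (metis bij_pointE)
  note ex = ev_br_expand[OF f A B]
  note e1 = coordinates_eval(1)[OF f] and e2 = coordinates_eval(2)[OF f]
  have zero: "X = 0" if "\<And>l d. ev1 (\<lambda>r. fst_at d (f r)) l X = 0" "\<And>l d. ev1 (\<lambda>r. snd_at d (f r)) l X = 0" for X
  proof (rule poly_eqI)
    fix n
    have "map_poly (\<lambda>r. fst (f r)) X = 0" "map_poly (\<lambda>r. snd (f r)) X = 0"
      by (rule ev2_eqI, use that in \<open>simp add: ev_coordinates[OF f] ev2_simps\<close>)+
    from arg_cong[OF this(1), of "\<lambda>P. coeff P n"] arg_cong[OF this(2), of "\<lambda>P. coeff P n"]
    have "f (coeff X n) = 0" by (simp add: coeff_map_poly coordinates_zero[OF f] prod_eq_iff)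
    then show "coeff X n = coeff 0 n" using f coordinates_zero[OF f] unfolding coordinates_def by (metis bij_is_inj coeff_0 injD)
  qed
  have AA: "br R A A = 0"
  proof (rule zero)
    fix l d
    have "map_poly (\<lambda>r. fst (f r)) (br R A A) = 0" "map_poly (\<lambda>r. snd (f r)) (br R A A) = 0"
      using ex[OF e1, of _ _ a a] ex[OF e2, of _ _ a a] ab[OF a(1) a(1)]
      by (intro sesqui_cancel[OF g g]; simp add: fa coords_Pair ev_coordinates[OF f, symmetric] ev1_0)+
    then show "ev1 (\<lambda>r. fst_at d (f r)) l (br R A A) = 0" "ev1 (\<lambda>r. snd_at d (f r)) l (br R A A) = 0"
      by (simp_all add: ev_coordinates[OF f] ev2_simps)
  qed
  have BA: "map_poly (\<lambda>r. snd (f r)) (br R B A) = 0"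
  proof (cases "\<forall>t\<in>T. snd (f t) = 0")
    case True
    show ?thesis
    proof (rule sesqui_cancel[OF one_neq_zero g])
      fix l d
      have "map_poly (\<lambda>r. snd (f r)) (br R B a) = 0"
        by (rule poly_eqI) (simp add: coeff_map_poly coordinates_zero[OF f] True ideal_coeff[OF T(1) a(1)])
      then have "ev1 (\<lambda>r. snd_at d (f r)) l (br R B a) = 0" by (simp add: ev_coordinates[OF f] ev2_simps)
      then show "poly 1 (- l) * poly g (l + d) * ev2 (map_poly (\<lambda>r. snd (f r)) (br R B A)) l d = 0"
        using ex[OF e2, of d l B a] by (simp add: fa B coords_Pair ev_coordinates[OF f])
    qed
  next
    case False
    \<comment> \<open>An element outside \<open>\<complex>[\<partial>]A\<close> that commutes with \<open>a\<close> forces \<open>[B\<^sub>\<lambda> A] = 0\<close>.\<close>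
    then obtain b where b: "b \<in> T" "snd (f b) \<noteq> 0" by blast
    show ?thesis
    proof (rule sesqui_cancel[OF b(2) g])
      fix l d
      show "poly (snd (f b)) (- l) * poly g (l + d) * ev2 (map_poly (\<lambda>r. snd (f r)) (br R B A)) l d = 0"
        using ex[OF e2, of d l b a] ab[OF b(1) a(1)] unfolding fa coords_Pair AA ev1_0 ev_coordinates[OF f]
        by (simp add: ev2_simps snd_at_def)
    qed
  qed
  let ?M = "map_poly (\<lambda>r. fst (f r)) (br R B A)" and ?Q = "map_poly (\<lambda>r. fst (f r)) (br R B B)"
    and ?V = "map_poly (\<lambda>r. snd (f r)) (br R B B)"
  have "module_hom (act R) (act (rank2 ?M ?Q ?V)) f"
    unfolding module_hom_iff using f module_axioms rank2_module
    by (simp add: coordinates_def act_rank2)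
  moreover have "br (rank2 ?M ?Q ?V) (f x) (f y) = map_poly f (br R x y)" for x y
  proof (rule pair_poly_eqI)
    fix l d
    show "ev1 (fst_at d) l (br (rank2 ?M ?Q ?V) (f x) (f y)) = ev1 (fst_at d) l (map_poly f (br R x y))"
      unfolding rank2_ev_br ev1_map[of f, OF coordinates_zero[OF f] additive_coords(1)] ex[OF e1, of d l x y] AA
      by (simp add: ev_coordinates[OF f] ev2_simps)
    show "ev1 (snd_at d) l (br (rank2 ?M ?Q ?V) (f x) (f y)) = ev1 (snd_at d) l (map_poly f (br R x y))"
      unfolding rank2_ev_br ev1_map[of f, OF coordinates_zero[OF f] additive_coords(2)] ex[OF e2, of d l x y] AA
      by (simp add: ev_coordinates[OF f] BA ev2_simps)
  qed
  ultimately have "conf_hom R (rank2 ?M ?Q ?V) f" by (simp add: conf_hom_def)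
  moreover have "bij f" using f by (simp add: coordinates_def)
  ultimately show ?thesis by (rule that)
qed

lemma conf_hom_coordinates:
  assumes "conf_hom R (rank2 M Q V) f" "bij f" shows "coordinates R f"
  using assms module_hom.add[of "act R" _ f] module_hom.scale[of "act R" _ f]
  by (auto simp: coordinates_def conf_hom_def act_rank2)

text \<open>Skew-symmetry for \<open>B, B\<close> and the Jacobi identity for \<open>B, B, A\<close> and \<open>B, B, B\<close>, in coordinates.\<close>

theorem structure_equations:
  assumes hom: "conf_hom R (rank2 M Q V) f" and bij: "bij f"
  shows "skew_fun (ev2 V)" and "skew_fun (ev2 Q)"
    and "\<And>l m d. ev2 M m (l+d) * ev2 M l d - ev2 M l (m+d) * ev2 M m d = ev2 V l (-l-m) * ev2 M (l+m) d"
    and "\<And>l m d. ev2 V m (l+d) * ev2 V l d - ev2 V l (m+d) * ev2 V m d = ev2 V l (-l-m) * ev2 V (l+m) d"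
    and "\<And>l m d. ev2 Q m (l+d) * ev2 M l d + ev2 V m (l+d) * ev2 Q l d
         - (ev2 Q l (m+d) * ev2 M m d + ev2 V l (m+d) * ev2 Q m d)
       = - ev2 Q l (-l-m) * ev2 M (-l-m-d) d + ev2 V l (-l-m) * ev2 Q (l+m) d"
proof -
  have f: "coordinates R f" by (rule conf_hom_coordinates[OF hom bij])
  note e1 = coordinates_eval(1)[OF f] and e2 = coordinates_eval(2)[OF f]
  obtain A B where A: "f A = (1, 0)" and B: "f B = (0, 1)" using bij by (metis bij_pointE)
  have br: "br (rank2 M Q V) (f x) (f y) = map_poly f (br R x y)" for x y using hom by (simp add: conf_hom_def)
  have b1: "ev1 (\<lambda>r. fst_at d (f r)) l (br R x y) = snd_at (-l) (f x) * fst_at (l+d) (f y) * ev2 M l d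
      - fst_at (-l) (f x) * snd_at (l+d) (f y) * ev2 M (-l-d) d + snd_at (-l) (f x) * snd_at (l+d) (f y) * ev2 Q l d" for x y l d
    using rank2_ev_br(1)[of d l M Q V "f x" "f y"] unfolding br ev1_map[of f, OF coordinates_zero[OF f] additive_coords(1)] .
  have b2: "ev1 (\<lambda>r. snd_at d (f r)) l (br R x y) = snd_at (-l) (f x) * snd_at (l+d) (f y) * ev2 V l d" for x y l d
    using rank2_ev_br(2)[of d l M Q V "f x" "f y"] unfolding br ev1_map[of f, OF coordinates_zero[OF f] additive_coords(2)] .
  show "skew_fun (ev2 V)" unfolding skew_fun_def
  proof (intro allI)
    show "ev2 V l x = - ev2 V (- l - x) x" for l x
      using ev_skew[OF e2[of x], of l B B] by (simp add: b2 B coords_Pair)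
  qed
  show "skew_fun (ev2 Q)" unfolding skew_fun_def
  proof (intro allI)
    show "ev2 Q l x = - ev2 Q (- l - x) x" for l x
      using ev_skew[OF e1[of x], of l B B] by (simp add: b1 B coords_Pair)
  qed
  have lin: "ev1 (\<lambda>r. K * fst_at t (f r) + K' * snd_at t (f r)) l P
      = K * ev1 (\<lambda>r. fst_at t (f r)) l P + K' * ev1 (\<lambda>r. snd_at t (f r)) l P" for K K' t l P
    by (rule ev1_lin[OF point_eval_additive[OF e1] point_eval_additive[OF e2]])
  have r1: "(\<lambda>r. ev1 (\<lambda>r. fst_at d (f r)) l (br R B r)) = (\<lambda>r. ev2 M l d * fst_at (l+d) (f r) + ev2 Q l d * snd_at (l+d) (f r))" for l d
    by (simp add: b1 B coords_Pair algebra_simps)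
  have r2: "(\<lambda>r. ev1 (\<lambda>r. snd_at d (f r)) l (br R B r)) = (\<lambda>r. 0 * fst_at (l+d) (f r) + ev2 V l d * snd_at (l+d) (f r))" for l d
    by (simp add: b2 B coords_Pair algebra_simps)
  have l1: "(\<lambda>r. ev1 (\<lambda>r. fst_at d (f r)) l (br R r A)) = (\<lambda>r. 0 * fst_at (-l) (f r) + ev2 M l d * snd_at (-l) (f r))" for l d
    by (simp add: b1 A coords_Pair algebra_simps)
  have l1': "(\<lambda>r. ev1 (\<lambda>r. fst_at d (f r)) l (br R r B)) = (\<lambda>r. - ev2 M (-l-d) d * fst_at (-l) (f r) + ev2 Q l d * snd_at (-l) (f r))" for l d
    by (simp add: b1 B coords_Pair algebra_simps)
  have l2: "(\<lambda>r. ev1 (\<lambda>r. snd_at d (f r)) l (br R r B)) = (\<lambda>r. 0 * fst_at (-l) (f r) + ev2 V l d * snd_at (-l) (f r))" for l d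
    by (simp add: b2 B coords_Pair algebra_simps)
  have s: "- (l + m) = - l - m" "- (l + m) - d = - l - m - d" for l m d :: complex by simp_all
  fix l m d
  show "ev2 M m (l+d) * ev2 M l d - ev2 M l (m+d) * ev2 M m d = ev2 V l (-l-m) * ev2 M (l+m) d"
    using ev_jacobi[OF e1[of d], of l B m B A] unfolding r1 l1 unfolding lin unfolding b1 b2 A B coords_Pair s by (simp add: mult_ac)
  show "ev2 V m (l+d) * ev2 V l d - ev2 V l (m+d) * ev2 V m d = ev2 V l (-l-m) * ev2 V (l+m) d"
    using ev_jacobi[OF e2[of d], of l B m B B] unfolding r2 l2 unfolding lin unfolding b1 b2 A B coords_Pair s by (simp add: mult_ac)
  show "ev2 Q m (l+d) * ev2 M l d + ev2 V m (l+d) * ev2 Q l d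
         - (ev2 Q l (m+d) * ev2 M m d + ev2 V l (m+d) * ev2 Q m d)
       = - ev2 Q l (-l-m) * ev2 M (-l-m-d) d + ev2 V l (-l-m) * ev2 Q (l+m) d"
    using ev_jacobi[OF e1[of d], of l B m B B] unfolding r1 l1' unfolding lin unfolding b1 b2 A B coords_Pair s by (simp add: mult_ac)
qed

end

section \<open>Solvability, nilpotency and the classification\<close>

lemma sesqui_zero: "sesqui 0 g = 0" "sesqui f 0 = 0"
  by (rule ev2_eqI, simp add: ev2_sesqui ev2_simps)+

lemma sesqui_nonzero: "f \<noteq> 0 \<Longrightarrow> g \<noteq> 0 \<Longrightarrow> sesqui f g \<noteq> 0"
  using sesqui_cancel[of f g 1] by (metis ev2_sesqui ev2_simps(8) mult_zero_left one_neq_zero)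

lemma coeff_pair_poly: "coeff (pair_poly P Q) n = (coeff P n, coeff Q n)"
  by (simp add: pair_poly_def coeff_map_poly zero_prod_def)

lemma poly_coeff_nonzero: "P \<noteq> 0 \<Longrightarrow> \<exists>n. coeff P n \<noteq> 0"
  using leading_coeff_0_iff by blast

context lie_conformal_algebra
begin

lemma nth_product_coordinates:
  assumes hom: "conf_hom R (rank2 M Q V) f" and bij: "bij f"
  shows "f (nth_product R a n b) = ([:fact n:] * coeff (sesqui (snd (f a)) (fst (f b)) * M
      - sesqui (fst (f a)) (snd (f b)) * pcompose M (- lam - del) + sesqui (snd (f a)) (snd (f b)) * Q) n,
    [:fact n:] * coeff (sesqui (snd (f a)) (snd (f b)) * V) n)"
proof -
  have f: "coordinates R f" by (rule conf_hom_coordinates[OF hom bij])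
  have "f (coeff (br R a b) n) = coeff (map_poly f (br R a b)) n"
    by (simp add: coeff_map_poly coordinates_zero[OF f])
  also have "map_poly f (br R a b) = br (rank2 M Q V) (f a) (f b)" using hom by (simp add: conf_hom_def)
  also have "coeff \<dots> n = (coeff (sesqui (snd (f a)) (fst (f b)) * M
      - sesqui (fst (f a)) (snd (f b)) * pcompose M (- lam - del) + sesqui (snd (f a)) (snd (f b)) * Q) n,
    coeff (sesqui (snd (f a)) (snd (f b)) * V) n)"
    by (simp add: rank2_def coeff_pair_poly split: prod.split)
  finally show ?thesis using f by (simp add: nth_product_def cscale_def coordinates_def)
qed

lemma coordinates_eq_0: "coordinates R f \<Longrightarrow> f x = 0 \<longleftrightarrow> x = 0"
  using coordinates_zero[of R f] unfolding coordinates_def by (metis bij_is_inj injD)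

lemma cspan_trivial: "\<forall>x\<in>X. x = 0 \<Longrightarrow> cspan R X = {0}"
proof -
  assume "\<forall>x\<in>X. x = 0"
  then have "X \<subseteq> {0}" by blast
  moreover have "module.subspace (cscale R) {0}" by (rule module.subspace_single_0[OF cscale_module])
  ultimately have "cspan R X \<subseteq> {0}" unfolding cspan_def by (intro module.span_minimal[OF cscale_module])
  moreover have "0 \<in> cspan R X" unfolding cspan_def by (rule module.span_zero[OF cscale_module])
  ultimately show ?thesis by blast
qed

text \<open>All products lie in \<open>\<complex>[\<partial>]A\<close>, which is commutative.\<close>

lemma solvable_if_V_zero:
  assumes hom: "conf_hom R (rank2 M Q 0) f" and bij: "bij f"
  shows "solvable R"
proof -
  have f: "coordinates R f" by (rule conf_hom_coordinates[OF hom bij])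
  note np = nth_product_coordinates[OF hom bij]
  have 1: "snd (f x) = 0" if "x \<in> derived R UNIV" for x
  proof -
    have "module.subspace (cscale R) {x. snd (f x) = 0}"
      using f unfolding module.subspace_def[OF cscale_module] by (simp add: coordinates_def coordinates_zero[OF f] cscale_def)
    then have "derived R UNIV \<subseteq> {x. snd (f x) = 0}"
      unfolding derived_def cspan_def by (intro module.span_minimal[OF cscale_module]) (auto simp: np)
    with that show ?thesis by blast
  qed
  have "nth_product R a n b = 0" if "a \<in> derived R UNIV" "b \<in> derived R UNIV" for a b n
    using np[of a n b] 1[OF that(1)] 1[OF that(2)] by (simp add: sesqui_zero coordinates_eq_0[OF f, symmetric] zero_prod_def)
  then have "derived R (derived R UNIV) = {0}" unfolding derived_def[of R "derived R UNIV"] by (intro cspan_trivial) auto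
  then show ?thesis unfolding solvable_def solvable_on_def derived_series_def
    by (intro exI[of _ 3]) (simp add: numeral_2_eq_2)
qed

lemma nilpotent_if_M_V_zero:
  assumes hom: "conf_hom R (rank2 0 Q 0) f" and bij: "bij f"
  shows "nilpotent R"
proof -
  have f: "coordinates R f" by (rule conf_hom_coordinates[OF hom bij])
  note np = nth_product_coordinates[OF hom bij]
  have "nth_product R a n (nth_product R b m c) = 0" for a n b m c
    using np[of a n "nth_product R b m c"] np[of b m c] by (simp add: sesqui_zero coordinates_eq_0[OF f, symmetric] zero_prod_def)
  then have "\<forall>x\<in>nested R 2. x = 0" by (auto simp: numeral_2_eq_2)
  then have "lower_series R 3 = {0}" unfolding lower_series_def by (intro cspan_trivial) simp
  then show ?thesis unfolding nilpotent_def by (intro exI[of _ 3]) simp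
qed

text \<open>A property of non-zero elements that some left multiplication preserves survives in all iterated
  products.\<close>

lemma not_nilpotent_criterion:
  assumes "P b" "\<And>x. P x \<Longrightarrow> x \<noteq> 0" "\<And>x. P x \<Longrightarrow> \<exists>a n. P (nth_product R a n x)"
  shows "\<not> nilpotent R"
proof
  assume "nilpotent R"
  then obtain n where n: "lower_series R n = {0}" by (auto simp: nilpotent_def)
  have "\<exists>x\<in>nested R k. P x" for k
  proof (induction k)
    case (Suc k) then show ?case using assms(3) by fastforce
  qed (use assms(1) in auto)
  then obtain x where "x \<in> nested R (n - 1)" "P x" by blast
  moreover from this have "x \<in> lower_series R n"
    unfolding lower_series_def cspan_def by (intro module.span_base[OF cscale_module])
  ultimately show False using n assms(2) by blast
qed

text \<open>Some product of \<open>B\<close> with a non-zero multiple of \<open>A\<close> is again a non-zero multiple of \<open>A\<close>.\<close>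

lemma not_nilpotent_if_M_nonzero:
  assumes hom: "conf_hom R (rank2 M Q 0) f" and bij: "bij f" and M: "M \<noteq> 0"
  shows "\<not> nilpotent R"
proof -
  have f: "coordinates R f" by (rule conf_hom_coordinates[OF hom bij])
  note np = nth_product_coordinates[OF hom bij]
  obtain A B where A: "f A = (1, 0)" and B: "f B = (0, 1)" using bij by (metis bij_pointE)
  show ?thesis
  proof (rule not_nilpotent_criterion[of "\<lambda>x. fst (f x) \<noteq> 0 \<and> snd (f x) = 0" A])
    show "x \<noteq> 0" if "fst (f x) \<noteq> 0 \<and> snd (f x) = 0" for x using that coordinates_zero[OF f] by auto
    show "\<exists>a n. fst (f (nth_product R a n x)) \<noteq> 0 \<and> snd (f (nth_product R a n x)) = 0"
      if x: "fst (f x) \<noteq> 0 \<and> snd (f x) = 0" for x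
    proof -
      have "sesqui 1 (fst (f x)) * M \<noteq> 0" using M x sesqui_nonzero[of 1] by simp
      then obtain n where "coeff (sesqui 1 (fst (f x)) * M) n \<noteq> 0" using poly_coeff_nonzero by blast
      then have "fst (f (nth_product R B n x)) \<noteq> 0 \<and> snd (f (nth_product R B n x)) = 0"
        using x by (simp add: np B sesqui_zero)
      then show ?thesis by blast
    qed
  qed (simp add: A)
qed

text \<open>Some product of two elements with non-zero \<open>B\<close>-components has a non-zero \<open>B\<close>-component.\<close>

lemma not_solvable_if_V_nonzero:
  assumes hom: "conf_hom R (rank2 M Q V) f" and bij: "bij f" and V: "V \<noteq> 0"
  shows "\<not> nilpotent R" and "\<not> solvable R"
proof -
  have f: "coordinates R f" by (rule conf_hom_coordinates[OF hom bij])
  note np = nth_product_coordinates[OF hom bij]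
  obtain B where B: "f B = (0, 1)" using bij by (metis bij_pointE)
  have step: "\<exists>n. snd (f (nth_product R a n b)) \<noteq> 0" if "snd (f a) \<noteq> 0" "snd (f b) \<noteq> 0" for a b
  proof -
    have "sesqui (snd (f a)) (snd (f b)) * V \<noteq> 0" using V that sesqui_nonzero by simp
    then obtain n where "coeff (sesqui (snd (f a)) (snd (f b)) * V) n \<noteq> 0" using poly_coeff_nonzero by blast
    then have "snd (f (nth_product R a n b)) \<noteq> 0" by (simp add: np)
    then show ?thesis by blast
  qed
  have nz: "x \<noteq> 0" if "snd (f x) \<noteq> 0" for x using that coordinates_zero[OF f] by auto
  show "\<not> nilpotent R"
    by (rule not_nilpotent_criterion[of "\<lambda>x. snd (f x) \<noteq> 0" B]) (use step B nz in \<open>auto, metis\<close>)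
  have "\<exists>x\<in>(derived R ^^ k) UNIV. snd (f x) \<noteq> 0" for k
  proof (induction k)
    case (Suc k)
    then obtain x where x: "x \<in> (derived R ^^ k) UNIV" "snd (f x) \<noteq> 0" by blast
    then obtain n where n: "snd (f (nth_product R x n x)) \<noteq> 0" using step by blast
    have "nth_product R x n x \<in> (derived R ^^ Suc k) UNIV"
      using x(1) unfolding funpow.simps o_def derived_def[of R "(derived R ^^ k) UNIV"] cspan_def
      by (intro module.span_base[OF cscale_module]) blast
    with n show ?case by blast
  qed (use B in \<open>auto intro!: exI[of _ B]\<close>)
  then have "(derived R ^^ k) UNIV \<noteq> {0}" for k using nz by blast
  then show "\<not> solvable R" by (simp add: solvable_def solvable_on_def derived_series_def)
qed

lemma map_poly_inj:
  assumes f: "coordinates R f" and "map_poly f P = map_poly f P'" shows "P = P'"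
proof (rule poly_eqI)
  fix n
  have "f (coeff P n) = f (coeff P' n)"
    using arg_cong[OF assms(2), of "\<lambda>p. coeff p n"] by (simp add: coeff_map_poly coordinates_zero[OF f])
  then show "coeff P n = coeff P' n" using f unfolding coordinates_def by (metis bij_is_inj injD)
qed

lemma basis_of_presentation:
  assumes hom: "conf_hom R (rank2 M Q V) f" and bij: "bij f"
  obtains A B where "A \<noteq> B" "is_basis R {A, B}" "br R A A = 0" "br R B A = poly_act R M A"
    "br R B B = poly_act R Q A + poly_act R V B"
proof -
  have f: "coordinates R f" by (rule conf_hom_coordinates[OF hom bij])
  obtain A B where A: "f A = (1, 0)" and B: "f B = (0, 1)" using bij by (metis bij_pointE)
  have brf: "map_poly f (br R x y) = br (rank2 M Q V) (f x) (f y)" for x y using hom by (simp add: conf_hom_def)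
  have act: "f (act R p x) = act (rank2 M Q V) p (f x)" and add: "f (x + y) = f x + f y" for p x y
    using f by (simp_all add: coordinates_def act_rank2)
  have mp_act: "map_poly f (poly_act R P x) = poly_act (rank2 M Q V) P (f x)" for P x
    by (rule poly_eqI) (simp add: poly_act_def coeff_map_poly coordinates_zero[OF f] act act_rank2 zero_prod_def)
  have mp_add: "map_poly f (P + P') = map_poly f P + map_poly f P'" for P P'
    by (rule poly_eqI) (simp add: coeff_map_poly coordinates_zero[OF f] add)
  note rb = rank2_brackets[of M Q V, folded A B]
  have "A \<noteq> B" using A B by auto
  moreover have "is_basis R {A, B}" unfolding is_basis_def
  proof (intro conjI)
    show "independent {A, B}"
    proof
      assume "dependent {A, B}"
      then obtain u where u: "\<exists>x\<in>{A, B}. u x \<noteq> 0" "(\<Sum>x\<in>{A, B}. act R (u x) x) = 0"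
        unfolding dependent_finite[OF finite.insertI[OF finite.insertI[OF finite.emptyI]]] by blast
      from u(2) have "f (act R (u A) A + act R (u B) B) = 0" using \<open>A \<noteq> B\<close> coordinates_zero[OF f] by simp
      then have "u A = 0 \<and> u B = 0" by (simp add: add act act_rank2 A B zero_prod_def)
      with u(1) show False by simp
    qed
    have "r \<in> span {A, B}" for r
      by (subst coordinates_expand[OF f A B, of r]) (intro span_add span_scale span_base; simp)
    then show "span {A, B} = UNIV" by blast
  qed
  moreover have "br R A A = 0"
    by (rule map_poly_inj[OF f]) (simp add: brf rb)
  moreover have "br R B A = poly_act R M A"
    by (rule map_poly_inj[OF f]) (simp add: brf rb mp_act)
  moreover have "br R B B = poly_act R Q A + poly_act R V B"
    by (rule map_poly_inj[OF f]) (simp add: brf rb mp_act mp_add)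
  ultimately show ?thesis by (rule that)
qed

end

lemma const2_one: "const2 1 = 1"
  by (simp add: const2_def flip: one_pCons)

lemma rank2_iso_coboundary:
  assumes "Q = Q' + coboundary M V g" shows "rank2 M Q V \<cong>\<^sub>c rank2 M Q' V"
  by (rule rank2_iso_triangular[of 1 1 _ _ _ _ _ _ g]) (simp_all add: assms const2_one)

definition abelian_rank1 :: "complex poly conf_alg" where
  "abelian_rank1 = \<lparr>act = (*), br = (\<lambda>_ _. 0)\<rparr>"

lemma abelian_rank1_module: "module (act abelian_rank1)"
  by standard (simp_all add: abelian_rank1_def algebra_simps)

lemma abelian_rank1: "lie_conformal_algebra abelian_rank1" "commutative abelian_rank1" "has_rank abelian_rank1 1"
proof -
  interpret module "act abelian_rank1" by (rule abelian_rank1_module)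
  show "lie_conformal_algebra abelian_rank1"
    by (intro lie_conformal_algebra.intro lie_conformal_algebra_axioms.intro abelian_rank1_module)
      (simp_all add: abelian_rank1_def subst_op_def mult_mu_def mult_lam_def)
  show "commutative abelian_rank1" by (simp add: commutative_def abelian_rank1_def)
  have "independent {1}" unfolding dependent_finite[OF finite.insertI[OF finite.emptyI]] by (simp add: abelian_rank1_def)
  moreover have "r \<in> span {1}" for r unfolding span_singleton by (simp add: abelian_rank1_def)
  ultimately have "is_basis abelian_rank1 {1}" by (auto simp: is_basis_def)
  then show "has_rank abelian_rank1 1" unfolding has_rank_def by (intro exI[of _ "{1}"]) simp
qed

lemma direct_sum_rank2: "direct_sum abelian_rank1 Vir = rank2 0 0 (2 * lam + del)"
  by (simp add: direct_sum_def abelian_rank1_def Vir_def rank2_def fun_eq_iff)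

text \<open>The four families together with their position relative to solvability and nilpotency, from which the
  classification follows by elimination.\<close>

theorem nonsemisimple_rank_two_cases:
  assumes "lie_conformal_algebra R" and "has_rank R 2" and "\<not> semisimple R"
  obtains (nil) Q where "skew_sym Q" "R \<cong>\<^sub>c R_nil Q" "nilpotent R" "solvable R"
  | (sol) a where "a \<noteq> 0" "R \<cong>\<^sub>c R_sol a" "\<not> nilpotent R" "solvable R"
  | (sum) "R \<cong>\<^sub>c direct_sum abelian_rank1 Vir" "\<not> nilpotent R" "\<not> solvable R"
  | (vir) c d Q where "admissible c d Q" "R \<cong>\<^sub>c R_vir c d Q" "\<not> nilpotent R" "\<not> solvable R"
proof -
  interpret lie_conformal_algebra R by fact
  obtain f M Q V where hom: "conf_hom R (rank2 M Q V) f" and bij: "bij f"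
    using rank2_presentation[OF assms(2,3)] by metis
  have iso: "R \<cong>\<^sub>c rank2 M Q V" using hom bij by (auto simp: conf_iso_def)
  note eqs = structure_equations[OF hom bij]
  obtain v where v: "V = const2 v * (2 * lam + del)" using rank_one_bracket[OF eqs(1,4)] by blast
  have skQ: "skew_sym Q" using eqs(2) by (simp add: skew_sym_iff)
  show ?thesis
  proof (cases "v = 0")
    case True
    then have V: "V = 0" by (simp add: v const2_def)
    have "ev2 M m (l + d) * ev2 M l d - ev2 M l (m + d) * ev2 M m d = 0" for l m d
      using eqs(3)[of m l d] by (simp add: V ev2_simps)
    then obtain a where a: "M = at2 a lam" using rank_one_module_trivial by metis
    have sol': "solvable R" using solvable_if_V_zero[OF hom[unfolded V] bij] .
    show ?thesis
    proof (cases "a = 0")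
      case True
      then have M: "M = 0" by (simp add: a at2_def)
      show ?thesis using nil[of Q] skQ iso sol' nilpotent_if_M_V_zero[OF hom[unfolded V M] bij] by (simp add: R_nil_def V M)
    next
      case False
      have "M \<noteq> 0"
      proof
        assume "M = 0"
        then have "poly a l = 0" for l using ev2_at2[of a lam l 0] by (simp add: a ev2_simps)
        with False show False using poly_all_0_iff_0 by blast
      qed
      then have nn: "\<not> nilpotent R" using not_nilpotent_if_M_nonzero[OF hom[unfolded V] bij] by simp
      have "ev2 Q m (l + x) * poly a l - ev2 Q l (m + x) * poly a m = - ev2 Q l (- l - m) * poly a (- l - m - x)" for l m x
        using eqs(5)[of m l x] by (simp add: V a ev2_simps ev2_at2)
      then obtain g where "Q = coboundary (at2 a lam) 0 g" using solvable_cocycle_trivial[OF False] by metis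
      then have "rank2 M Q V \<cong>\<^sub>c R_sol a" unfolding R_sol_def V a by (intro rank2_iso_coboundary) simp
      with iso have "R \<cong>\<^sub>c R_sol a" by (rule conf_iso_trans)
      with sol[of a] False nn sol' show ?thesis by blast
    qed
  next
    case False
    have ev0: "ev2 (2 * lam + del) 0 1 = 1" by (simp add: ev2_simps)
    have "V \<noteq> 0"
    proof
      assume "V = 0"
      then have "ev2 (const2 v * (2 * lam + del)) 0 1 = 0" by (simp add: v[symmetric] ev2_simps)
      with False show False by (simp add: ev2_simps)
    qed
    note ns = not_solvable_if_V_nonzero[OF hom bij this]
    \<comment> \<open>Rescaling \<open>B\<close> to \<open>B / v\<close> makes the quotient the Virasoro algebra with its standard generator.\<close>
    define M' where "M' = const2 (1 / v) * M"
    define Q' where "Q' = const2 (1 / v ^ 2) * Q"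
    have M: "M = const2 v * M'" and Q: "Q = const2 (v ^ 2) * Q'"
      using False by (auto intro!: ev2_eqI simp: M'_def Q'_def ev2_simps)
    have "rank2 M Q V \<cong>\<^sub>c rank2 M' Q' (2 * lam + del)"
    proof (rule rank2_iso_triangular[OF _ False M v])
      show "const2 1 * Q = const2 (v\<^sup>2) * Q' + coboundary M V 0"
        by (rule ev2_eqI) (simp add: ev2_coboundary ev2_simps Q)
    qed simp
    with iso have iso': "R \<cong>\<^sub>c rank2 M' Q' (2 * lam + del)" by (rule conf_iso_trans)
    have J1: "ev2 M' m (l + d) * ev2 M' l d - ev2 M' l (m + d) * ev2 M' m d = ev2 (2 * lam + del) l (- l - m) * ev2 M' (l + m) d" for l m d
    proof -
      have "v ^ 2 * (ev2 M' m (l + d) * ev2 M' l d - ev2 M' l (m + d) * ev2 M' m d - ev2 (2 * lam + del) l (- l - m) * ev2 M' (l + m) d) = 0"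
        using eqs(3)[of m l d] unfolding M v ev2_simps by algebra
      with False show ?thesis by simp
    qed
    have J3: "ev2 Q' m (l + x) * ev2 M' l x + ev2 (2 * lam + del) m (l + x) * ev2 Q' l x
         - (ev2 Q' l (m + x) * ev2 M' m x + ev2 (2 * lam + del) l (m + x) * ev2 Q' m x)
       = - ev2 Q' l (- l - m) * ev2 M' (- l - m - x) x + ev2 (2 * lam + del) l (- l - m) * ev2 Q' (l + m) x" for l m x
    proof -
      have "v ^ 3 * (ev2 Q' m (l + x) * ev2 M' l x + ev2 (2 * lam + del) m (l + x) * ev2 Q' l x
         - (ev2 Q' l (m + x) * ev2 M' m x + ev2 (2 * lam + del) l (m + x) * ev2 Q' m x)
         - (- ev2 Q' l (- l - m) * ev2 M' (- l - m - x) x + ev2 (2 * lam + del) l (- l - m) * ev2 Q' (l + m) x)) = 0"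
        using eqs(5)[of m l x] unfolding M Q v ev2_simps by algebra
      with False show ?thesis by simp
    qed
    have "skew_fun (ev2 Q')" using eqs(2) unfolding skew_fun_def Q'_def ev2_simps by (metis minus_mult_right)
    then have skQ': "skew_sym Q'" by (simp add: skew_sym_iff)
    from rank_one_module_virasoro[of M'] J1 consider "M' = 0" | c d where "M' = vir_weight c d" by blast
    then show ?thesis
    proof cases
      case 1
      have "ev2 (2 * lam + del) m (l + x) * ev2 Q' l x - ev2 (2 * lam + del) l (m + x) * ev2 Q' m x
        = ev2 (2 * lam + del) l (- l - m) * ev2 Q' (l + m) x" for l m x
        using J3[of m l x] unfolding 1 by (simp add: ev2_simps(8))
      then obtain g where "Q' = coboundary 0 (2 * lam + del) g" using trivial_cocycle_virasoro[of Q'] by metis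
      then have "rank2 M' Q' (2 * lam + del) \<cong>\<^sub>c rank2 0 0 (2 * lam + del)" unfolding 1 by (intro rank2_iso_coboundary) simp
      with iso' have "R \<cong>\<^sub>c direct_sum abelian_rank1 Vir" unfolding direct_sum_rank2 by (rule conf_iso_trans)
      with sum ns show ?thesis by blast
    next
      case 2
      obtain g where g: "admissible c d (Q' - coboundary (vir_weight c d) (2 * lam + del) g)"
        using virasoro_cocycle_classification[OF skQ'] J3[unfolded 2] by metis
      have "rank2 M' Q' (2 * lam + del) \<cong>\<^sub>c R_vir c d (Q' - coboundary (vir_weight c d) (2 * lam + del) g)"
        unfolding 2 R_vir_def by (rule rank2_iso_coboundary[of _ _ _ _ g]) simp
      with iso' have "R \<cong>\<^sub>c R_vir c d (Q' - coboundary (vir_weight c d) (2 * lam + del) g)" by (rule conf_iso_trans)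
      with vir g ns show ?thesis by blast
    qed
  qed
qed

theorem theorem2p21:
  fixes R :: "'a::ab_group_add conf_alg"
  assumes "lie_conformal_algebra R" and "has_rank R 2" and "\<not> semisimple R"
  shows
    "(nilpotent R \<longrightarrow> (\<exists>Q. skew_sym Q \<and> R \<cong>\<^sub>c R_nil Q)) \<and>
     (\<forall>Q Q'. skew_sym Q \<longrightarrow> skew_sym Q' \<longrightarrow>
        (R_nil Q \<cong>\<^sub>c R_nil Q' \<longleftrightarrow> (\<exists>k. k \<noteq> 0 \<and> Q = const2 k * Q'))) \<and>
     (solvable R \<and> \<not> nilpotent R \<longrightarrow> (\<exists>a. a \<noteq> 0 \<and> R \<cong>\<^sub>c R_sol a)) \<and>
     (\<forall>a a'. a \<noteq> 0 \<longrightarrow> a' \<noteq> 0 \<longrightarrow>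
        (R_sol a \<cong>\<^sub>c R_sol a' \<longleftrightarrow> (\<exists>k. k \<noteq> 0 \<and> a = smult k a'))) \<and>
     (\<not> solvable R \<longrightarrow>
        (\<exists>S :: complex poly conf_alg. lie_conformal_algebra S \<and> has_rank S 1 \<and> commutative S \<and>
           R \<cong>\<^sub>c direct_sum S Vir) \<or>
        (\<exists>A B c d Q. A \<noteq> B \<and> is_basis R {A, B} \<and> br R A A = 0 \<and>
           br R B A = poly_act R (const2 c * lam + const2 d + del) A \<and>
           br R B B = poly_act R Q A + poly_act R (2 * lam + del) B \<and>
           admissible c d Q)) \<and>
     (\<forall>c d Q c' d' Q'. admissible c d Q \<longrightarrow> admissible c' d' Q' \<longrightarrow>
        (R_vir c d Q \<cong>\<^sub>c R_vir c' d' Q' \<longleftrightarrow>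
           c = c' \<and> d = d' \<and> (\<exists>k. k \<noteq> 0 \<and> Q = const2 k * Q')))"
proof (intro conjI)
  show "\<forall>Q Q'. skew_sym Q \<longrightarrow> skew_sym Q' \<longrightarrow>
        (R_nil Q \<cong>\<^sub>c R_nil Q' \<longleftrightarrow> (\<exists>k. k \<noteq> 0 \<and> Q = const2 k * Q'))"
    by (intro allI impI R_nil_iso_iff)
  show "\<forall>a a'. a \<noteq> 0 \<longrightarrow> a' \<noteq> 0 \<longrightarrow> (R_sol a \<cong>\<^sub>c R_sol a' \<longleftrightarrow> (\<exists>k. k \<noteq> 0 \<and> a = smult k a'))"
    by (intro allI impI R_sol_iso_iff)
  show "\<forall>c d Q c' d' Q'. admissible c d Q \<longrightarrow> admissible c' d' Q' \<longrightarrow>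
        (R_vir c d Q \<cong>\<^sub>c R_vir c' d' Q' \<longleftrightarrow> c = c' \<and> d = d' \<and> (\<exists>k. k \<noteq> 0 \<and> Q = const2 k * Q'))"
    by (intro allI impI R_vir_iso_iff)
  show "nilpotent R \<longrightarrow> (\<exists>Q. skew_sym Q \<and> R \<cong>\<^sub>c R_nil Q)"
    by (rule nonsemisimple_rank_two_cases[OF assms]) blast+
  show "solvable R \<and> \<not> nilpotent R \<longrightarrow> (\<exists>a. a \<noteq> 0 \<and> R \<cong>\<^sub>c R_sol a)"
    by (rule nonsemisimple_rank_two_cases[OF assms]) blast+
  show "\<not> solvable R \<longrightarrow>
        (\<exists>S :: complex poly conf_alg. lie_conformal_algebra S \<and> has_rank S 1 \<and> commutative S \<and>
           R \<cong>\<^sub>c direct_sum S Vir) \<or>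
        (\<exists>A B c d Q. A \<noteq> B \<and> is_basis R {A, B} \<and> br R A A = 0 \<and>
           br R B A = poly_act R (const2 c * lam + const2 d + del) A \<and>
           br R B B = poly_act R Q A + poly_act R (2 * lam + del) B \<and>
           admissible c d Q)" (is "_ \<longrightarrow> ?sum \<or> ?vir")
  proof (rule nonsemisimple_rank_two_cases[OF assms])
    assume "R \<cong>\<^sub>c direct_sum abelian_rank1 Vir"
    with abelian_rank1 have ?sum by blast
    then show "\<not> solvable R \<longrightarrow> ?sum \<or> ?vir" by blast
  next
    fix c d Q assume adm: "admissible c d Q" and iso: "R \<cong>\<^sub>c R_vir c d Q"
    then obtain f where "conf_hom R (rank2 (vir_weight c d) Q (2 * lam + del)) f" "bij f"
      by (auto simp: conf_iso_def R_vir_def)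
    from lie_conformal_algebra.basis_of_presentation[OF assms(1) this] adm have ?vir by metis
    then show "\<not> solvable R \<longrightarrow> ?sum \<or> ?vir" by blast
  qed blast+
qed

end
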